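(* Let $\alpha\ge1$ and $p\in[1,\infty]$ be fixed. There is an algorithm which, given a set $P$ of $n$ points in the plane, computes, for every $k$ with $1\le k\le n$, a family of at most $k$ $L_p$-disks centered on the $x$-axis whose union covers $P$ and which minimizes $\sum_i r(D_i)^\alpha$ among all coverings of $P$ by at most $k$ such disks. The total running time for all $k=1,\dots,n$ together is $O(n^3\log n)$ for $1\le p<\infty$ and $O(n^3)$ for $p=\infty$.
   Context: For $c\in\mathbb{R}$ and $r\ge 0$, the $L_p$-disk centered on the $x$-axis with center $c$ and radius $r$ is $D=\{z\in\mathbb{R}^2 : \|z-(c,0)\|_p\le r\}$, and $r(D)=r$ denotes its radius; the cost of such a disk is $r(D)^\alpha$. A covering of $P$ is a finite family of such disks whose union contains $P$; its cost is the sum of the costs of its disks. Running times are in the real-RAM model, where arithmetic on reals and elementary geometric primitives for $L_p$ distances (evaluating distances, intersecting the $L_p$ bisector of two points with the $x$-axis, computing the smallest axis-centered disk through at most two given points) take constant time. *)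

theory Defs
  imports "HOL-Analysis.Analysis" "HOL-Library.Extended_Real"
begin

definition lp_norm :: "ereal \<Rightarrow> real \<times> real \<Rightarrow> real" where
  "lp_norm p z = (if p = \<infinity> then max \<bar>fst z\<bar> \<bar>snd z\<bar>
     else (\<bar>fst z\<bar> powr real_of_ereal p + \<bar>snd z\<bar> powr real_of_ereal p)
            powr (1 / real_of_ereal p))"

definition lp_dist :: "ereal \<Rightarrow> real \<times> real \<Rightarrow> real \<times> real \<Rightarrow> real" where
  "lp_dist p z w = lp_norm p (z - w)"

text \<open>An axis-centered disk is a pair (c, r): centre (c,0), radius r.\<close>
type_synonym disk = "real \<times> real"

definition in_disk :: "ereal \<Rightarrow> disk \<Rightarrow> real \<times> real \<Rightarrow> bool" where
  "in_disk p D z \<longleftrightarrow> lp_dist p z (fst D, 0) \<le> snd D"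

definition covers :: "ereal \<Rightarrow> disk list \<Rightarrow> (real \<times> real) set \<Rightarrow> bool" where
  "covers p Ds P \<longleftrightarrow> (\<forall>D\<in>set Ds. snd D \<ge> 0) \<and> (\<forall>z\<in>P. \<exists>D\<in>set Ds. in_disk p D z)"

definition cover_cost :: "real \<Rightarrow> disk list \<Rightarrow> real" where
  "cover_cost \<alpha> Ds = (\<Sum>D\<leftarrow>Ds. snd D powr \<alpha>)"

definition optimal_k_cover :: "ereal \<Rightarrow> real \<Rightarrow> nat \<Rightarrow> (real \<times> real) set \<Rightarrow> disk list \<Rightarrow> bool" where
  "optimal_k_cover p \<alpha> k P Ds \<longleftrightarrow> length Ds \<le> k \<and> covers p Ds P \<and>
     (\<forall>Es. length Es \<le> k \<longrightarrow> covers p Es P \<longrightarrow> cover_cost \<alpha> Ds \<le> cover_cost \<alpha> Es)"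

definition bisector_x :: "ereal \<Rightarrow> real \<times> real \<Rightarrow> real \<times> real \<Rightarrow> real" where
  "bisector_x p a b = (if \<exists>c. lp_dist p a (c,0) = lp_dist p b (c,0)
     then SOME c. lp_dist p a (c,0) = lp_dist p b (c,0) else 0)"

definition min_disk2 :: "ereal \<Rightarrow> real \<times> real \<Rightarrow> real \<times> real \<Rightarrow> disk" where
  "min_disk2 p a b = (SOME D. snd D = max (lp_dist p a (fst D,0)) (lp_dist p b (fst D,0)) \<and>
      (\<forall>c. snd D \<le> max (lp_dist p a (c,0)) (lp_dist p b (c,0))))"

text \<open>Integer registers I (word RAM part, used for addresses / control) and real
  registers R.  Every instruction costs one time unit.\<close>
datatype instr =
    IConst nat int | IAdd nat nat nat | ISub nat nat nat | IMul nat nat nat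
  | IDiv nat nat nat | IMod nat nat nat | ILess nat nat nat
  | ILoad nat nat | IStore nat nat
  | RConst nat int | ItoR nat nat
  | RAdd nat nat nat | RSub nat nat nat | RMul nat nat nat | RDiv nat nat nat
  | RLess nat nat nat
  | RLoad nat nat | RStore nat nat
  | Jmp nat | JmpZ nat nat | Halt
  | PDist nat nat nat nat nat
  | PBisect nat nat nat nat nat
  | PMinDisk nat nat nat nat nat nat
  | PPow nat nat

record state =
  pc :: nat
  ireg :: "nat \<Rightarrow> int"
  rreg :: "nat \<Rightarrow> real"

definition halted :: "instr list \<Rightarrow> state \<Rightarrow> bool" where
  "halted prog s \<longleftrightarrow> pc s \<ge> length prog \<or> prog ! pc s = Halt"

fun exec :: "ereal \<Rightarrow> real \<Rightarrow> instr \<Rightarrow> state \<Rightarrow> state" where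
  "exec p \<alpha> (IConst d c) s = s\<lparr>pc := Suc (pc s), ireg := (ireg s)(d := c)\<rparr>"
| "exec p \<alpha> (IAdd d a b) s = s\<lparr>pc := Suc (pc s), ireg := (ireg s)(d := ireg s a + ireg s b)\<rparr>"
| "exec p \<alpha> (ISub d a b) s = s\<lparr>pc := Suc (pc s), ireg := (ireg s)(d := ireg s a - ireg s b)\<rparr>"
| "exec p \<alpha> (IMul d a b) s = s\<lparr>pc := Suc (pc s), ireg := (ireg s)(d := ireg s a * ireg s b)\<rparr>"
| "exec p \<alpha> (IDiv d a b) s = s\<lparr>pc := Suc (pc s), ireg := (ireg s)(d := ireg s a div ireg s b)\<rparr>"
| "exec p \<alpha> (IMod d a b) s = s\<lparr>pc := Suc (pc s), ireg := (ireg s)(d := ireg s a mod ireg s b)\<rparr>"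
| "exec p \<alpha> (ILess d a b) s = s\<lparr>pc := Suc (pc s), ireg := (ireg s)(d := (if ireg s a < ireg s b then 1 else 0))\<rparr>"
| "exec p \<alpha> (ILoad d a) s = s\<lparr>pc := Suc (pc s), ireg := (ireg s)(d := ireg s (nat (ireg s a)))\<rparr>"
| "exec p \<alpha> (IStore a v) s = s\<lparr>pc := Suc (pc s), ireg := (ireg s)(nat (ireg s a) := ireg s v)\<rparr>"
| "exec p \<alpha> (RConst d c) s = s\<lparr>pc := Suc (pc s), rreg := (rreg s)(d := of_int c)\<rparr>"
| "exec p \<alpha> (ItoR d a) s = s\<lparr>pc := Suc (pc s), rreg := (rreg s)(d := of_int (ireg s a))\<rparr>"
| "exec p \<alpha> (RAdd d a b) s = s\<lparr>pc := Suc (pc s), rreg := (rreg s)(d := rreg s a + rreg s b)\<rparr>"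
| "exec p \<alpha> (RSub d a b) s = s\<lparr>pc := Suc (pc s), rreg := (rreg s)(d := rreg s a - rreg s b)\<rparr>"
| "exec p \<alpha> (RMul d a b) s = s\<lparr>pc := Suc (pc s), rreg := (rreg s)(d := rreg s a * rreg s b)\<rparr>"
| "exec p \<alpha> (RDiv d a b) s = s\<lparr>pc := Suc (pc s), rreg := (rreg s)(d := rreg s a / rreg s b)\<rparr>"
| "exec p \<alpha> (RLess d a b) s = s\<lparr>pc := Suc (pc s), ireg := (ireg s)(d := (if rreg s a < rreg s b then 1 else 0))\<rparr>"
| "exec p \<alpha> (RLoad d a) s = s\<lparr>pc := Suc (pc s), rreg := (rreg s)(d := rreg s (nat (ireg s a)))\<rparr>"
| "exec p \<alpha> (RStore a v) s = s\<lparr>pc := Suc (pc s), rreg := (rreg s)(nat (ireg s a) := rreg s v)\<rparr>"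
| "exec p \<alpha> (Jmp t) s = s\<lparr>pc := t\<rparr>"
| "exec p \<alpha> (JmpZ a t) s = s\<lparr>pc := (if ireg s a = 0 then t else Suc (pc s))\<rparr>"
| "exec p \<alpha> Halt s = s"
| "exec p \<alpha> (PDist d a1 a2 b1 b2) s = s\<lparr>pc := Suc (pc s), rreg := (rreg s)(d :=
      lp_dist p (rreg s a1, rreg s a2) (rreg s b1, rreg s b2))\<rparr>"
| "exec p \<alpha> (PBisect d a1 a2 b1 b2) s = s\<lparr>pc := Suc (pc s), rreg := (rreg s)(d :=
      bisector_x p (rreg s a1, rreg s a2) (rreg s b1, rreg s b2))\<rparr>"
| "exec p \<alpha> (PMinDisk dc dr a1 a2 b1 b2) s = (let D = min_disk2 p (rreg s a1, rreg s a2) (rreg s b1, rreg s b2)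
      in s\<lparr>pc := Suc (pc s), rreg := ((rreg s)(dc := fst D))(dr := snd D)\<rparr>)"
| "exec p \<alpha> (PPow d a) s = s\<lparr>pc := Suc (pc s), rreg := (rreg s)(d := rreg s a powr \<alpha>)\<rparr>"

definition step :: "ereal \<Rightarrow> real \<Rightarrow> instr list \<Rightarrow> state \<Rightarrow> state" where
  "step p \<alpha> prog s = (if halted prog s then s else exec p \<alpha> (prog ! pc s) s)"

definition halts_in :: "ereal \<Rightarrow> real \<Rightarrow> instr list \<Rightarrow> state \<Rightarrow> nat \<Rightarrow> state \<Rightarrow> bool" where
  "halts_in p \<alpha> prog s0 t s \<longleftrightarrow> (step p \<alpha> prog ^^ t) s0 = s \<and> halted prog s \<and>
     (\<forall>t'<t. \<not> halted prog ((step p \<alpha> prog ^^ t') s0))"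

definition init_state :: "(real \<times> real) list \<Rightarrow> state" where
  "init_state P = \<lparr>pc = 0,
     ireg = (\<lambda>i. if i = 0 then int (length P) else 0),
     rreg = (\<lambda>i. if i < 2 * length P then (if even i then fst (P ! (i div 2)) else snd (P ! (i div 2))) else 0)\<rparr>"

definition output_cover :: "nat \<Rightarrow> state \<Rightarrow> nat \<Rightarrow> disk list" where
  "output_cover n s k = map (\<lambda>j. (rreg s (2 * (k * (n + 1) + j)), rreg s (2 * (k * (n + 1) + j) + 1)))
                           [0..<nat (ireg s k)]"

definition correct_output :: "ereal \<Rightarrow> real \<Rightarrow> (real \<times> real) list \<Rightarrow> state \<Rightarrow> bool" where
  "correct_output p \<alpha> P s \<longleftrightarrow> (\<forall>k\<in>{1..length P}. 0 \<le> ireg s k \<and>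
      optimal_k_cover p \<alpha> k (set P) (output_cover (length P) s k))"

text \<open>Word-size restriction: all integer registers stay polynomially bounded in n
  during the first t steps (prevents unit-cost big-integer tricks).\<close>
definition ints_bounded :: "ereal \<Rightarrow> real \<Rightarrow> instr list \<Rightarrow> state \<Rightarrow> nat \<Rightarrow> int \<Rightarrow> bool" where
  "ints_bounded p \<alpha> prog s0 t B \<longleftrightarrow> (\<forall>t'\<le>t. \<forall>i. \<bar>ireg ((step p \<alpha> prog ^^ t') s0) i\<bar> \<le> B)"

end

theory Submission
  imports Defs
begin

text \<open>
  For every \<open>p\<close>, the points can be assigned to the disks of a covering so that each disk serves a contiguous
  run in the order of the \<open>x\<close>-coordinates: for finite \<open>p\<close> use the power diagram of the disks with the power
  \<open>|x - c|^p + |y|^p - r^p\<close>, for \<open>p = \<infinity>\<close> send a point to the largest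
  of the disks whose \<open>x\<close>-range contains it. Hence an optimal covering by \<open>k\<close> disks comes from an optimal partition of the sorted points
  into at most \<open>k\<close> runs, each covered by its smallest disk. By Helly's theorem on the line the radius of
  the smallest disk of a run is the maximum over pairs of points, so that all runs are handled in cubic time;
  dynamic programming over prefixes and numbers of disks and backtracking are cubic as well.

  Padding with disks of radius 0 makes all coverings for \<open>k\<close> consist of exactly \<open>k\<close> disks, so that the
  count registers \<open>1, \<dots>, n\<close>, which collide with the working registers of the program, can be
  filled by constants at the end.
\<close>

section \<open>A loop language compiled to the machine\<close>

text \<open>The claim concerns an explicit program on a machine with absolute jumps, so its exact
  runs, its step count and a bound on every integer register are needed at once. The loop language
  separates these concerns: a command acts on the real memory as a plain function, integers come
  only from loop variables and address arithmetic, and bounds on time and registers are read off the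
  syntax. Correctness can then be argued for functions on the memory alone.

  One cubic program shape serves every \<open>p\<close>; for finite \<open>p\<close> the logarithm
  in the claim is slack. Treating all runs in cubic time is possible because enlarging a run by its
  last point adds only linearly many pairs. Integers cannot be loaded from data, so backtracking has
  to search its table column with a loop; this still keeps the nesting depth at three.\<close>

definition regs_bounded :: "int \<Rightarrow> (nat \<Rightarrow> int) \<Rightarrow> bool" where
  "regs_bounded B I \<longleftrightarrow> (\<forall>i. \<bar>I i\<bar> \<le> B)"

lemma regs_bounded_upd [simp]: "regs_bounded B I \<Longrightarrow> \<bar>v\<bar> \<le> B \<Longrightarrow> regs_bounded B (I(d := v))"
  by (simp add: regs_bounded_def)

section \<open>Runs of the machine\<close>

definition code_at :: "instr list \<Rightarrow> nat \<Rightarrow> instr list \<Rightarrow> bool" where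
  "code_at prog pos code \<longleftrightarrow> (\<forall>i<length code. pos + i < length prog \<and> prog ! (pos + i) = code ! i)"

lemma code_at_Nil [simp]: "code_at prog pos []"
  by (simp add: code_at_def)

lemma code_at_Cons [simp]:
  "code_at prog pos (x # xs) \<longleftrightarrow> pos < length prog \<and> prog ! pos = x \<and> code_at prog (Suc pos) xs"
  by (auto simp: code_at_def nth_Cons less_Suc_eq_0_disj split: nat.splits)

lemma code_at_append [simp]:
  "code_at prog pos (xs @ ys) \<longleftrightarrow> code_at prog pos xs \<and> code_at prog (pos + length xs) ys"
  by (induction xs arbitrary: pos) auto

text \<open>Unlike in \<open>halts_in\<close>, the last state need not be halted, so that executions
  can be concatenated. The bound on the integer registers is demanded of every state on the way, as
  \<open>ints_bounded\<close> will require.\<close>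

definition runs :: "ereal \<Rightarrow> real \<Rightarrow> int \<Rightarrow> instr list \<Rightarrow> state \<Rightarrow> nat \<Rightarrow> state \<Rightarrow> bool" where
  "runs p \<alpha> B prog s t s' \<longleftrightarrow> (step p \<alpha> prog ^^ t) s = s' \<and>
     (\<forall>t'<t. \<not> halted prog ((step p \<alpha> prog ^^ t') s)) \<and>
     (\<forall>t'\<le>t. regs_bounded B (ireg ((step p \<alpha> prog ^^ t') s)))"

lemma runs_refl: "regs_bounded B (ireg s) \<Longrightarrow> runs p \<alpha> B prog s 0 s"
  by (simp add: runs_def)

lemma runs_step:
  assumes "pc s < length prog" "prog ! pc s \<noteq> Halt" "regs_bounded B (ireg s)"
    and "runs p \<alpha> B prog (exec p \<alpha> (prog ! pc s) s) t s'"
  shows "runs p \<alpha> B prog s (Suc t) s'"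
proof -
  have st: "step p \<alpha> prog s = exec p \<alpha> (prog ! pc s) s" and nh: "\<not> halted prog s"
    using assms by (auto simp: step_def halted_def)
  have shift: "(step p \<alpha> prog ^^ Suc u) s = (step p \<alpha> prog ^^ u) (exec p \<alpha> (prog ! pc s) s)" for u
    by (simp add: funpow_swap1 st)
  show ?thesis
    unfolding runs_def
  proof (intro conjI allI impI)
    show "(step p \<alpha> prog ^^ Suc t) s = s'"
      using assms(4) unfolding shift by (simp add: runs_def)
    fix u assume "u < Suc t"
    then show "\<not> halted prog ((step p \<alpha> prog ^^ u) s)"
      using assms(4) nh by (cases u) (auto simp: runs_def shift simp del: funpow.simps(2))
  next
    fix u assume "u \<le> Suc t"
    then show "regs_bounded B (ireg ((step p \<alpha> prog ^^ u) s))"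
      using assms(3,4) by (cases u) (auto simp: runs_def shift simp del: funpow.simps(2))
  qed
qed

lemma runs_trans:
  assumes "runs p \<alpha> B prog s t s'" "runs p \<alpha> B prog s' u s''"
  shows "runs p \<alpha> B prog s (t + u) s''"
proof -
  let ?f = "step p \<alpha> prog"
  have shift: "(?f ^^ (t + v)) s = (?f ^^ v) s'" for v
    using assms(1) by (simp add: runs_def funpow_add add.commute[of t])
  show ?thesis
    unfolding runs_def
  proof (intro conjI allI impI)
    show "(?f ^^ (t + u)) s = s''" using assms(2) by (simp add: shift runs_def)
    fix v assume "v < t + u"
    then show "\<not> halted prog ((?f ^^ v) s)"
      using assms shift[of "v - t"] by (cases "v < t") (auto simp: runs_def)
  next
    fix v assume "v \<le> t + u"
    then show "regs_bounded B (ireg ((?f ^^ v) s))"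
      using assms shift[of "v - t"] by (cases "v < t") (auto simp: runs_def)
  qed
qed

lemma runs_regs_bounded: "runs p \<alpha> B prog s t s' \<Longrightarrow> regs_bounded B (ireg s')"
  by (auto simp: runs_def)

section \<open>Symbolic execution of straight-line integer code\<close>

fun int_op :: "instr \<Rightarrow> (nat \<Rightarrow> int) \<Rightarrow> (nat \<Rightarrow> int) option" where
  "int_op (IConst d c) I = Some (I(d := c))"
| "int_op (IAdd d a b) I = Some (I(d := I a + I b))"
| "int_op (ISub d a b) I = Some (I(d := I a - I b))"
| "int_op (IMul d a b) I = Some (I(d := I a * I b))"
| "int_op (ILess d a b) I = Some (I(d := (if I a < I b then 1 else 0)))"
| "int_op (IStore a v) I = Some (I(nat (I a) := I v))"
| "int_op _ I = None"

text \<open>The bound is tested before each instruction and at the end, so a result other than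
  \<open>None\<close> certifies the effect of the code together with the bound at all intermediate
  states.\<close>

fun int_ops :: "int \<Rightarrow> instr list \<Rightarrow> (nat \<Rightarrow> int) \<Rightarrow> (nat \<Rightarrow> int) option" where
  "int_ops B [] I = (if regs_bounded B I then Some I else None)"
| "int_ops B (x # xs) I = (if regs_bounded B I then Option.bind (int_op x I) (int_ops B xs) else None)"

lemma int_op_exec:
  "int_op x (ireg s) = Some J \<Longrightarrow> x \<noteq> Halt \<and> exec p \<alpha> x s = s\<lparr>pc := Suc (pc s), ireg := J\<rparr>"
  by (cases x) auto

lemma int_ops_append:
  "int_ops B (xs @ ys) I = Option.bind (int_ops B xs I) (int_ops B ys)"
  by (induction xs arbitrary: I) (auto split: Option.bind_splits, cases ys, auto)

lemma int_ops_regs_bounded: "int_ops B xs I = Some J \<Longrightarrow> regs_bounded B I \<and> regs_bounded B J"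
  by (induction xs arbitrary: I) (auto split: if_splits Option.bind_splits)

lemma int_ops_runs:
  "int_ops B code (ireg s) = Some J \<Longrightarrow> code_at prog (pc s) code \<Longrightarrow>
   runs p \<alpha> B prog s (length code) (s\<lparr>pc := pc s + length code, ireg := J\<rparr>)"
proof (induction code arbitrary: s)
  case Nil
  then show ?case by (auto intro: runs_refl split: if_splits)
next
  case (Cons x xs)
  then obtain K where K: "int_op x (ireg s) = Some K" "int_ops B xs K = Some J" "regs_bounded B (ireg s)"
    by (auto split: if_splits Option.bind_splits)
  note e = int_op_exec[OF K(1), of p \<alpha>]
  have "runs p \<alpha> B prog (exec p \<alpha> x s) (length xs) ((exec p \<alpha> x s)\<lparr>pc := pc (exec p \<alpha> x s) + length xs, ireg := J\<rparr>)"
    using Cons.prems K e by (intro Cons.IH) auto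
  then show ?case
    using Cons.prems(2) e K(3) by (auto intro!: runs_step)
qed

text \<open>
  Loops are the only source of integer values, so that an upper bound on the running time can be read
  off the nesting depth. \<open>Ix x off w\<close> stands for the truncated \<open>x + off - w\<close>. \<open>Lo\<close> addresses the input and output
  region, \<open>Hi\<close> a working memory of arrays with up to three indices, the first component being the name of the
  array. Integer register 0 holds \<open>n\<close> and register 1 the constant 0; registers 2 to 7 are loop variables and
  8 to 15 are scratch. \<open>Mark a\<close> stores \<open>16 + a\<close> in the integer register of that number.
\<close>

datatype ix = Ix nat nat nat

datatype adr = Lo nat ix ix | Hi nat ix ix ix

datatype cmd = Skip | RI instr | Get nat adr | Put nat adr | ToR nat ix | Mark ix
  | Seq cmd cmd (infixr ";;;" 60) | Cond nat nat cmd cmd | For nat ix ix cmd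

fun ix_val :: "(nat \<Rightarrow> nat) \<Rightarrow> ix \<Rightarrow> nat" where
  "ix_val e (Ix x off w) = e x + off - e w"

definition pair_code :: "nat \<Rightarrow> nat \<Rightarrow> nat" where
  "pair_code a b = (a + b) * (a + b) + a"

text \<open>The layout fixed by the input and output conventions: row \<open>a\<close> holds the
  covering by \<open>a\<close> disks and \<open>\<beta>\<close> selects centre or radius; row 0 is
  the input, where \<open>\<beta>\<close> selects the coordinate.\<close>

definition low_addr :: "nat \<Rightarrow> nat \<Rightarrow> nat \<Rightarrow> nat \<Rightarrow> nat" where
  "low_addr n \<beta> a b = 2 * (a * (n + 1) + b) + \<beta>"

text \<open>The offset lies beyond all rows and columns up to \<open>n\<close> of the low region.
  The nested pairing separates arrays and indices while the address stays polynomial in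
  \<open>n\<close> for indices of order \<open>n\<close>.\<close>

definition high_addr :: "nat \<Rightarrow> nat \<Rightarrow> nat \<Rightarrow> nat \<Rightarrow> nat \<Rightarrow> nat" where
  "high_addr n r a b c = 4 * ((n + 2) * (n + 2)) + pair_code a (pair_code b (pair_code c r))"

text \<open>An injective pairing without division: \<open>a\<close> is less than the gap between \<open>(a + b)^2\<close> and the next square.\<close>

lemma pair_code_inject: "pair_code a b = pair_code c d \<longleftrightarrow> a = c \<and> b = d"
proof
  assume eq: "pair_code a b = pair_code c d"
  have mono: "pair_code a b < pair_code c d" if "a + b < c + d" for a b c d
  proof -
    have "pair_code a b < Suc (a + b) * Suc (a + b)" by (simp add: pair_code_def)
    also have "\<dots> \<le> (c + d) * (c + d)" using that by (intro mult_le_mono) auto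
    finally show ?thesis by (simp add: pair_code_def)
  qed
  have "a + b = c + d" using mono[of a b c d] mono[of c d a b] eq by (metis less_irrefl nat_neq_iff)
  then show "a = c \<and> b = d" using eq by (simp add: pair_code_def)
qed auto

lemma high_addr_inject [simp]: "high_addr n r a b c = high_addr n r' a' b' c' \<longleftrightarrow> r = r' \<and> a = a' \<and> b = b' \<and> c = c'"
  by (auto simp: high_addr_def pair_code_inject)

fun adr_val :: "(nat \<Rightarrow> nat) \<Rightarrow> adr \<Rightarrow> nat" where
  "adr_val e (Lo \<beta> a b) = low_addr (e 0) \<beta> (ix_val e a) (ix_val e b)"
| "adr_val e (Hi r a b c) = high_addr (e 0) r (ix_val e a) (ix_val e b) (ix_val e c)"

fun real_op :: "instr \<Rightarrow> bool" where
  "real_op (RConst _ _) = True"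
| "real_op (RAdd _ _ _) = True"
| "real_op (RDiv _ _ _) = True"
| "real_op (PMinDisk _ _ _ _ _ _) = True"
| "real_op (PPow _ _) = True"
| "real_op _ = False"

definition real_sem :: "ereal \<Rightarrow> real \<Rightarrow> instr \<Rightarrow> (nat \<Rightarrow> real) \<Rightarrow> nat \<Rightarrow> real" where
  "real_sem p \<alpha> x R = rreg (exec p \<alpha> x \<lparr>pc = 0, ireg = (\<lambda>_. 0), rreg = R\<rparr>)"

lemma real_sem_simps [simp]:
  "real_sem p \<alpha> (RConst d c) R = R(d := of_int c)"
  "real_sem p \<alpha> (RAdd d a b) R = R(d := R a + R b)"
  "real_sem p \<alpha> (RDiv d a b) R = R(d := R a / R b)"
  "real_sem p \<alpha> (PPow d a) R = R(d := R a powr \<alpha>)"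
  "real_sem p \<alpha> (PMinDisk dc dr a1 a2 b1 b2) R =
     R(dc := fst (min_disk2 p (R a1, R a2) (R b1, R b2)), dr := snd (min_disk2 p (R a1, R a2) (R b1, R b2)))"
  by (simp_all add: real_sem_def Let_def)

lemma real_op_exec:
  "real_op x \<Longrightarrow> x \<noteq> Halt \<and> exec p \<alpha> x s = s\<lparr>pc := Suc (pc s), rreg := real_sem p \<alpha> x (rreg s)\<rparr>"
  by (cases x) (auto simp: Let_def)

text \<open>Loop variables live in the environment \<open>e\<close>, so a command is a function on
  the real memory. The effect of \<open>Mark\<close> on the integer registers is recorded by
  \<open>marked\<close>.\<close>

fun denote :: "ereal \<Rightarrow> real \<Rightarrow> cmd \<Rightarrow> (nat \<Rightarrow> nat) \<Rightarrow> (nat \<Rightarrow> real) \<Rightarrow> nat \<Rightarrow> real" where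
  "denote p \<alpha> Skip e R = R"
| "denote p \<alpha> (RI x) e R = real_sem p \<alpha> x R"
| "denote p \<alpha> (Get d a) e R = R(d := R (adr_val e a))"
| "denote p \<alpha> (Put d a) e R = R(adr_val e a := R d)"
| "denote p \<alpha> (ToR d a) e R = R(d := real (ix_val e a))"
| "denote p \<alpha> (Mark a) e R = R"
| "denote p \<alpha> (Seq c d) e R = denote p \<alpha> d e (denote p \<alpha> c e R)"
| "denote p \<alpha> (Cond a b c d) e R = (if R a < R b then denote p \<alpha> c e R else denote p \<alpha> d e R)"
| "denote p \<alpha> (For v l h c) e R = fold (\<lambda>i. denote p \<alpha> c (e(v := i))) [ix_val e l..<ix_val e h] R"

text \<open>Conditionals contribute nothing, since \<open>scoped\<close> keeps \<open>Mark\<close>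
  out of their branches; the marked registers are thus independent of the real data.\<close>

fun marked :: "cmd \<Rightarrow> (nat \<Rightarrow> nat) \<Rightarrow> nat set" where
  "marked (Mark a) e = {16 + ix_val e a}"
| "marked (Seq c d) e = marked c e \<union> marked d e"
| "marked (For v l h c) e = (\<Union>i\<in>{ix_val e l..<ix_val e h}. marked c (e(v := i)))"
| "marked _ e = {}"

fun markfree :: "cmd \<Rightarrow> bool" where
  "markfree (Mark _) = False"
| "markfree (Seq c d) = (markfree c \<and> markfree d)"
| "markfree (Cond _ _ c d) = (markfree c \<and> markfree d)"
| "markfree (For _ _ _ c) = markfree c"
| "markfree _ = True"

lemma marked_markfree [simp]: "markfree c \<Longrightarrow> marked c e = {}"
  by (induction c arbitrary: e) auto

fun ix_ok :: "nat set \<Rightarrow> ix \<Rightarrow> bool" where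
  "ix_ok S (Ix x off w) = (x \<in> S \<and> w \<in> S)"

fun adr_ok :: "nat set \<Rightarrow> adr \<Rightarrow> bool" where
  "adr_ok S (Lo \<beta> a b) = (ix_ok S a \<and> ix_ok S b)"
| "adr_ok S (Hi r a b c) = (ix_ok S a \<and> ix_ok S b \<and> ix_ok S c)"

text \<open>\<open>S\<close> collects the registers whose contents the environment describes. A loop
  must take a fresh register below the scratch area, so no body can overwrite a variable still in
  use.\<close>

fun scoped :: "nat set \<Rightarrow> cmd \<Rightarrow> bool" where
  "scoped S Skip = True"
| "scoped S (RI x) = real_op x"
| "scoped S (Get d a) = adr_ok S a"
| "scoped S (Put d a) = adr_ok S a"
| "scoped S (ToR d a) = ix_ok S a"
| "scoped S (Mark a) = ix_ok S a"
| "scoped S (Seq c d) = (scoped S c \<and> scoped S d)"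
| "scoped S (Cond a b c d) = (scoped S c \<and> scoped S d \<and> markfree c \<and> markfree d)"
| "scoped S (For v l h c) = (v < 8 \<and> v \<notin> S \<and> ix_ok S l \<and> ix_ok S h \<and> scoped (insert v S) c)"

fun ix_off :: "ix \<Rightarrow> nat" where
  "ix_off (Ix x off w) = off"

fun adr_off :: "adr \<Rightarrow> nat" where
  "adr_off (Lo \<beta> a b) = \<beta> + ix_off a + ix_off b"
| "adr_off (Hi r a b c) = r + ix_off a + ix_off b + ix_off c"

text \<open>How far loop variables, indices and array names can exceed the largest value in scope.
  Bounds of nested loops build on each other, so their offsets add up; sequences and branches need
  only the maximum.\<close>

fun offs :: "cmd \<Rightarrow> nat" where
  "offs Skip = 0"
| "offs (RI x) = 0"
| "offs (Get d a) = adr_off a"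
| "offs (Put d a) = adr_off a"
| "offs (ToR d a) = ix_off a"
| "offs (Mark a) = ix_off a"
| "offs (Seq c d) = max (offs c) (offs d)"
| "offs (Cond a b c d) = max (offs c) (offs d)"
| "offs (For v l h c) = max (ix_off l) (ix_off h) + offs c"

text \<open>Truncated subtraction without a jump: the difference is multiplied by the outcome of the
  comparison, kept in register 9.\<close>

fun ix_code :: "nat \<Rightarrow> ix \<Rightarrow> instr list" where
  "ix_code d (Ix x off w) =
     [IConst 9 (int off), IAdd d x 9, ILess 9 w d, ISub d d w, IMul d d 9]"

fun adr_code :: "adr \<Rightarrow> instr list" where
  "adr_code (Lo \<beta> a b) = ix_code 10 a @ ix_code 11 b @
     [IConst 9 1, IAdd 9 0 9, IMul 10 10 9, IAdd 10 10 11, IAdd 10 10 10, IConst 9 (int \<beta>), IAdd 8 10 9]"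
| "adr_code (Hi r a b c) = ix_code 10 a @ ix_code 11 b @ ix_code 12 c @
     [IConst 9 (int r), IAdd 8 12 9, IMul 8 8 8, IAdd 8 8 12, IAdd 8 11 8, IMul 8 8 8, IAdd 8 8 11,
      IAdd 8 10 8, IMul 8 8 8, IAdd 8 8 10,
      IConst 9 2, IAdd 13 0 9, IMul 13 13 13, IConst 9 4, IMul 13 9 13, IAdd 8 13 8]"

text \<open>Jumps are absolute, hence the argument \<open>pos\<close>. A loop returns to the code of
  its upper bound, at \<open>pos + 5\<close>, because the scratch register with that bound does not
  survive the body.\<close>

fun compile :: "cmd \<Rightarrow> nat \<Rightarrow> instr list" where
  "compile Skip pos = []"
| "compile (RI x) pos = [x]"
| "compile (Get d a) pos = adr_code a @ [RLoad d 8]"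
| "compile (Put d a) pos = adr_code a @ [RStore 8 d]"
| "compile (ToR d a) pos = ix_code 8 a @ [ItoR d 8]"
| "compile (Mark a) pos = ix_code 8 a @ [IConst 9 16, IAdd 8 9 8, IStore 8 8]"
| "compile (Seq c d) pos = compile c pos @ compile d (pos + length (compile c pos))"
| "compile (Cond a b c d) pos = (let cc = compile c (pos + 2); m = pos + 3 + length cc; cd = compile d m in
     [RLess 8 a b, JmpZ 8 m] @ cc @ [Jmp (m + length cd)] @ cd)"
| "compile (For v l h c) pos = (let cb = compile c (pos + 12) in
     ix_code v l @ ix_code 8 h @ [ILess 8 v 8, JmpZ 8 (pos + 15 + length cb)] @ cb @
     [IConst 8 1, IAdd v v 8, Jmp (pos + 5)])"

definition addr_bound :: "nat \<Rightarrow> nat" where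
  "addr_bound L = 16 + 4 * ((L + 2) * (L + 2)) + pair_code L (pair_code L (pair_code L L))"

text \<open>For a loop, 12 is made up of 5 instructions for the lower bound and 7 for the final
  test; a round costs 7 for its test and 3 for increment and jump. The 40 covers at most 31
  instructions of address code and the access.\<close>

fun cost_bound :: "cmd \<Rightarrow> nat \<Rightarrow> nat" where
  "cost_bound Skip L = 0"
| "cost_bound (RI x) L = 1"
| "cost_bound (Get d a) L = 40"
| "cost_bound (Put d a) L = 40"
| "cost_bound (ToR d a) L = 6"
| "cost_bound (Mark a) L = 8"
| "cost_bound (Seq c d) L = cost_bound c L + cost_bound d L"
| "cost_bound (Cond a b c d) L = 3 + cost_bound c L + cost_bound d L"
| "cost_bound (For v l h c) L = 12 + L * (cost_bound c L + 10)"

section \<open>Correctness of the translation\<close>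

lemma addr_bound_ge: "16 + L \<le> addr_bound L"
  by (simp add: addr_bound_def)

lemma pair_code_mono: "a \<le> a' \<Longrightarrow> b \<le> b' \<Longrightarrow> pair_code a b \<le> pair_code a' b'"
  unfolding pair_code_def by (intro add_mono mult_mono) auto

lemma pair_code_ge: "a + b \<le> pair_code a b" "(a + b) * (a + b) \<le> pair_code a b"
proof -
  show "(a + b) * (a + b) \<le> pair_code a b" by (simp add: pair_code_def)
  moreover have "a + b \<le> (a + b) * (a + b)" by (cases "a + b") auto
  ultimately show "a + b \<le> pair_code a b" by linarith
qed

lemma int_ops_ix_code:
  assumes "regs_bounded B I" "I x = int (e x)" "I w = int (e w)" "e x + off \<le> L" "int L \<le> B" "1 \<le> B"
    and "d \<noteq> 9" "x \<noteq> 9" "w \<noteq> 9" "w \<noteq> d"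
  shows "\<exists>u. int_ops B (ix_code d (Ix x off w)) I = Some (I(9 := u, d := int (ix_val e (Ix x off w))))"
proof -
  \<comment> \<open>A negative difference has absolute value at most \<open>e w\<close> before it is
    multiplied by 0.\<close>
  have "\<bar>I w\<bar> \<le> B" using assms(1) by (auto simp: regs_bounded_def)
  then have "\<bar>int (e w)\<bar> \<le> B" using assms by simp
  then show ?thesis
    using assms
    by (cases "e w < e x + off") (auto simp: fun_upd_twist of_nat_diff Let_def)
qed

lemma int_ops_adr_code:
  assumes bI: "regs_bounded B I" and ok: "adr_ok S a" and S: "S \<subseteq> {..<8}" "0 \<in> S"
    and I: "\<And>x. x \<in> S \<Longrightarrow> I x = int (e x)" and e: "\<And>x. x \<in> S \<Longrightarrow> e x \<le> M"
    and L: "M + adr_off a \<le> L" and B: "int (addr_bound L) \<le> B"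
  shows "\<exists>J. int_ops B (adr_code a) I = Some J \<and> J 8 = int (adr_val e a) \<and> (\<forall>x. x \<notin> {8..13} \<longrightarrow> J x = I x)"
proof -
  have BL: "int L \<le> B" "1 \<le> B" "16 \<le> B" using B addr_bound_ge[of L] by linarith+
  have n: "I 0 = int (e 0)" using I S by auto
  have nL: "e 0 \<le> L" using e[of 0] S L by auto
  show ?thesis
  proof (cases a)
    case (Lo \<beta> a b)
    obtain xa oa wa xb ob wb where ab: "a = Ix xa oa wa" "b = Ix xb ob wb" by (metis ix.exhaust)
    have in_S: "xa \<in> S" "wa \<in> S" "xb \<in> S" "wb \<in> S" using ok Lo ab by auto
    then have l8: "xa < 8" "wa < 8" "xb < 8" "wb < 8" using S by auto
    have le: "e xa + oa \<le> L" "e xb + ob \<le> L" "\<beta> \<le> L"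
      using e[OF in_S(1)] e[OF in_S(3)] L Lo ab by auto
    obtain u where u: "int_ops B (ix_code 10 a) I = Some (I(9 := u, 10 := int (ix_val e a)))"
      using int_ops_ix_code[of B I xa e wa oa L 10] bI I in_S le BL l8 ab by auto
    let ?I1 = "I(9 := u, 10 := int (ix_val e a))"
    have b1: "regs_bounded B ?I1" using u int_ops_regs_bounded by blast
    obtain v where v: "int_ops B (ix_code 11 b) ?I1 = Some (?I1(9 := v, 11 := int (ix_val e b)))"
      using int_ops_ix_code[of B ?I1 xb e wb ob L 11] b1 I in_S le BL l8 ab by auto
    let ?I2 = "?I1(9 := v, 11 := int (ix_val e b))"
    have b2: "regs_bounded B ?I2" using v int_ops_regs_bounded by blast
    have tail: "int_ops B (adr_code (Lo \<beta> a b)) I = int_ops B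
       [IConst 9 1, IAdd 9 0 9, IMul 10 10 9, IAdd 10 10 11, IAdd 10 10 10, IConst 9 (int \<beta>), IAdd 8 10 9] ?I2"
      by (simp only: adr_code.simps int_ops_append u v Option.bind.simps)
    define A where "A = ix_val e a"
    define C where "C = ix_val e b"
    have AC: "A \<le> L" "C \<le> L" using le ab by (auto simp: A_def C_def)
    have m: "A * (e 0 + 1) \<le> L * (L + 1)" using AC nL by (intro mult_le_mono) auto
    have "2 * (A * (e 0 + 1) + C) + \<beta> \<le> addr_bound L"
      using m AC le by (auto simp: addr_bound_def algebra_simps)
    then have "int (2 * (A * (e 0 + 1) + C) + \<beta>) \<le> B" using B by (meson of_nat_le_iff order_trans)
    then have f: "2 * (int A * (1 + int (e 0)) + int C) + int \<beta> \<le> B" by (simp add: algebra_simps)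
    have pos: "0 \<le> int A * int (e 0)" by simp
    have nB: "int (e 0) + 1 \<le> B"
      using nL B addr_bound_ge[of L] by linarith
    show ?thesis
      using bI b2 n f pos nB BL AC le(3)
      unfolding Lo tail A_def[symmetric] C_def[symmetric] adr_val.simps
      by (simp add: low_addr_def add.commute abs_mult algebra_simps)
  next
    case (Hi r a b c)
    obtain xa oa wa xb ob wb xc oc wc where ab: "a = Ix xa oa wa" "b = Ix xb ob wb" "c = Ix xc oc wc"
      by (metis ix.exhaust)
    have in_S: "xa \<in> S" "wa \<in> S" "xb \<in> S" "wb \<in> S" "xc \<in> S" "wc \<in> S" using ok Hi ab by auto
    then have l8: "xa < 8" "wa < 8" "xb < 8" "wb < 8" "xc < 8" "wc < 8" using S by auto
    have le: "e xa + oa \<le> L" "e xb + ob \<le> L" "e xc + oc \<le> L" "r \<le> L"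
      using e[OF in_S(1)] e[OF in_S(3)] e[OF in_S(5)] L Hi ab by auto
    obtain u where u: "int_ops B (ix_code 10 a) I = Some (I(9 := u, 10 := int (ix_val e a)))"
      using int_ops_ix_code[of B I xa e wa oa L 10] bI I in_S le BL l8 ab by auto
    let ?I1 = "I(9 := u, 10 := int (ix_val e a))"
    have b1: "regs_bounded B ?I1" using u int_ops_regs_bounded by blast
    obtain v where v: "int_ops B (ix_code 11 b) ?I1 = Some (?I1(9 := v, 11 := int (ix_val e b)))"
      using int_ops_ix_code[of B ?I1 xb e wb ob L 11] b1 I in_S le BL l8 ab by auto
    let ?I2 = "?I1(9 := v, 11 := int (ix_val e b))"
    have b2: "regs_bounded B ?I2" using v int_ops_regs_bounded by blast
    obtain w where w: "int_ops B (ix_code 12 c) ?I2 = Some (?I2(9 := w, 12 := int (ix_val e c)))"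
      using int_ops_ix_code[of B ?I2 xc e wc oc L 12] b2 I in_S le BL l8 ab by auto
    let ?I3 = "?I2(9 := w, 12 := int (ix_val e c))"
    have b3: "regs_bounded B ?I3" using w int_ops_regs_bounded by blast
    have tail: "int_ops B (adr_code (Hi r a b c)) I = int_ops B
       [IConst 9 (int r), IAdd 8 12 9, IMul 8 8 8, IAdd 8 8 12, IAdd 8 11 8, IMul 8 8 8, IAdd 8 8 11,
      IAdd 8 10 8, IMul 8 8 8, IAdd 8 8 10,
      IConst 9 2, IAdd 13 0 9, IMul 13 13 13, IConst 9 4, IMul 13 9 13, IAdd 8 13 8] ?I3"
      by (simp only: adr_code.simps int_ops_append u v w Option.bind.simps)
    define A where "A = ix_val e a"
    define C where "C = ix_val e b"
    define D where "D = ix_val e c"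
    have ACD: "A \<le> L" "C \<le> L" "D \<le> L" using le ab by (auto simp: A_def C_def D_def)
    define z1 where "z1 = pair_code D r"
    define z2 where "z2 = pair_code C z1"
    define z3 where "z3 = pair_code A z2"
    have z3: "z3 \<le> pair_code L (pair_code L (pair_code L L))"
      unfolding z1_def z2_def z3_def using ACD le by (intro pair_code_mono) auto
    define q where "q = (e 0 + 2) * (e 0 + 2)"
    have q: "q \<le> (L + 2) * (L + 2)" unfolding q_def using nL by (intro mult_le_mono) auto
    have tot: "4 * q + z3 \<le> addr_bound L" using q z3 by (simp add: addr_bound_def)
    \<comment> \<open>A pairing dominates the sum of its arguments and the square of that sum, so
      every intermediate value of the nested evaluation is at most \<open>z3\<close>.\<close>
    have z12: "C + z1 \<le> z2" "(C + z1) * (C + z1) \<le> z2" "A + z2 \<le> z3" "(A + z2) * (A + z2) \<le> z3"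
      "D + r \<le> z1" "(D + r) * (D + r) \<le> z1"
      unfolding z2_def z3_def z1_def by (rule pair_code_ge)+
    have "e 0 + 2 \<le> q" by (simp add: q_def)
    have iz: "(int D + int r) * (int D + int r) + int D = int z1"
      "(int C + int z1) * (int C + int z1) + int C = int z2"
      "(int A + int z2) * (int A + int z2) + int A = int z3"
      "(int (e 0) + 2) * (int (e 0) + 2) = int q"
      by (simp_all only: z1_def[unfolded pair_code_def] z2_def[unfolded pair_code_def] z3_def[unfolded pair_code_def] q_def of_nat_add of_nat_mult of_nat_numeral)
    have iq: "(int D + int r) * (int D + int r) \<le> int z1"
      "(int C + int z1) * (int C + int z1) \<le> int z2"
      "(int A + int z2) * (int A + int z2) \<le> int z3"
      using iz by linarith+
    have bds: "int z1 \<le> B" "int z2 \<le> B" "int z3 \<le> B" "int q \<le> B" "4 * int q \<le> B" "4 * int q + int z3 \<le> B"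
      "int D + int r \<le> B" "int C + int z1 \<le> B" "int A + int z2 \<le> B" "int (e 0) + 2 \<le> B"
      using tot z12 B \<open>e 0 + 2 \<le> q\<close> by linarith+
    have fin: "int (high_addr (e 0) r A C D) = 4 * int q + int z3"
      by (simp add: high_addr_def q_def z3_def z2_def z1_def)
    have iq': "(int D + int r) * (int D + int r) \<le> B"
      "(int C + int z1) * (int C + int z1) \<le> B"
      "(int A + int z2) * (int A + int z2) \<le> B" using iq bds by linarith+
    show ?thesis
      using bI b3 n bds iq' BL ACD le(4)
      unfolding Hi tail A_def[symmetric] C_def[symmetric] D_def[symmetric] adr_val.simps
      by (simp add: fin iz)
  qed
qed

lemma length_ix_code [simp]: "length (ix_code d a) = 5"
  by (cases a) auto

lemma length_adr_code: "length (adr_code a) \<le> 31"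
  by (cases a) auto

lemma int_ops_ix:
  assumes "regs_bounded B I" "ix_ok S a" "S \<subseteq> {..<8}" "\<And>x. x \<in> S \<Longrightarrow> I x = int (e x)" "\<And>x. x \<in> S \<Longrightarrow> e x \<le> M"
    and "M + ix_off a \<le> L" "int (addr_bound L) \<le> B" "d \<noteq> 9" "d \<notin> S"
  shows "\<exists>u. int_ops B (ix_code d a) I = Some (I(9 := u, d := int (ix_val e a)))" "ix_val e a \<le> M + ix_off a"
proof -
  obtain x off w where a: "a = Ix x off w" by (cases a) auto
  have xw: "x \<in> S" "w \<in> S" using assms(2) a by auto
  then have "x \<noteq> 9" "w \<noteq> 9" "w \<noteq> d" using assms(3,9) by auto
  moreover have "e x + off \<le> L" using assms(5)[OF xw(1)] assms(6) a by auto
  moreover have "int L \<le> B" "1 \<le> B" using assms(7) addr_bound_ge[of L] by linarith+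
  ultimately show "\<exists>u. int_ops B (ix_code d a) I = Some (I(9 := u, d := int (ix_val e a)))"
    unfolding a using assms(1,4,8) xw by (intro int_ops_ix_code[of B I x e w off L d]) auto
  show "ix_val e a \<le> M + ix_off a" using assms(5)[OF xw(1)] a by auto
qed

lemma runs_one:
  assumes "pc s < length prog" "prog ! pc s \<noteq> Halt" "regs_bounded B (ireg s)"
    and "s' = exec p \<alpha> (prog ! pc s) s" "regs_bounded B (ireg s')"
  shows "runs p \<alpha> B prog s 1 s'"
  using runs_step[OF assms(1-3), of p \<alpha> 0 s'] assms(4,5) by (auto intro: runs_refl)

text \<open>Only registers in scope and registers from 16 on are described; the others are scratch.
  \<open>M\<close> bounds the values in scope and grows on entering a loop, while \<open>L\<close>
  and \<open>B\<close> stay fixed, so the induction generalises over \<open>M\<close>,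
  \<open>S\<close> and \<open>e\<close>.\<close>

lemma compile_correct:
  assumes "scoped S c" "S \<subseteq> {..<8}" "0 \<in> S" "\<And>x. x \<in> S \<Longrightarrow> ireg s x = int (e x)" "\<And>x. x \<in> S \<Longrightarrow> e x \<le> M"
    and "M + offs c \<le> L" "int (addr_bound L) \<le> B" "regs_bounded B (ireg s)" "code_at prog (pc s) (compile c (pc s))"
  shows "\<exists>t s'. runs p \<alpha> B prog s t s' \<and> t \<le> cost_bound c L \<and> pc s' = pc s + length (compile c (pc s)) \<and>
      rreg s' = denote p \<alpha> c e (rreg s) \<and> (\<forall>x\<in>S. ireg s' x = ireg s x) \<and>
      (\<forall>x\<ge>16. ireg s' x = (if x \<in> marked c e then int x else ireg s x))"
  using assms
proof (induction c arbitrary: S s e M)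
  case Skip
  then show ?case by (intro exI[of _ 0] exI[of _ s]) (auto intro: runs_refl)
next
  case (RI x)
  let ?s = "s\<lparr>pc := Suc (pc s), rreg := real_sem p \<alpha> x (rreg s)\<rparr>"
  have "runs p \<alpha> B prog s 1 ?s"
    using RI real_op_exec[of x p \<alpha> s] by (intro runs_one) auto
  then show ?case by (intro exI[of _ 1] exI[of _ ?s]) auto
next
  case (Get d a)
  obtain J where J: "int_ops B (adr_code a) (ireg s) = Some J" "J 8 = int (adr_val e a)" "\<And>x. x \<notin> {8..13} \<Longrightarrow> J x = ireg s x"
    using int_ops_adr_code[of B "ireg s" S a e M L] Get.prems by auto
  let ?s1 = "s\<lparr>pc := pc s + length (adr_code a), ireg := J\<rparr>"
  let ?s2 = "?s1\<lparr>pc := Suc (pc ?s1), rreg := denote p \<alpha> (Get d a) e (rreg s)\<rparr>"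
  have "runs p \<alpha> B prog s (length (adr_code a)) ?s1"
    using Get.prems J by (intro int_ops_runs) auto
  moreover have "runs p \<alpha> B prog ?s1 1 ?s2"
    using Get.prems J int_ops_regs_bounded[OF J(1)] by (intro runs_one) auto
  ultimately have "runs p \<alpha> B prog s (length (adr_code a) + 1) ?s2" by (rule runs_trans)
  then show ?case
    using length_adr_code[of a] J(3) Get.prems(2) by (intro exI conjI) (assumption | auto)+
next
  case (Put d a)
  obtain J where J: "int_ops B (adr_code a) (ireg s) = Some J" "J 8 = int (adr_val e a)" "\<And>x. x \<notin> {8..13} \<Longrightarrow> J x = ireg s x"
    using int_ops_adr_code[of B "ireg s" S a e M L] Put.prems by auto
  let ?s1 = "s\<lparr>pc := pc s + length (adr_code a), ireg := J\<rparr>"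
  let ?s2 = "?s1\<lparr>pc := Suc (pc ?s1), rreg := denote p \<alpha> (Put d a) e (rreg s)\<rparr>"
  have "runs p \<alpha> B prog s (length (adr_code a)) ?s1"
    using Put.prems J by (intro int_ops_runs) auto
  moreover have "runs p \<alpha> B prog ?s1 1 ?s2"
    using Put.prems J int_ops_regs_bounded[OF J(1)] by (intro runs_one) auto
  ultimately have "runs p \<alpha> B prog s (length (adr_code a) + 1) ?s2" by (rule runs_trans)
  then show ?case
    using length_adr_code[of a] J(3) Put.prems(2) by (intro exI conjI) (assumption | auto)+
next
  case (ToR d a)
  have "8 \<notin> S" using ToR.prems(2) by auto
  then obtain u where u: "int_ops B (ix_code 8 a) (ireg s) = Some ((ireg s)(9 := u, 8 := int (ix_val e a)))"
    using int_ops_ix[of B "ireg s" S a e M L 8] ToR.prems by auto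
  let ?s1 = "s\<lparr>pc := pc s + 5, ireg := (ireg s)(9 := u, 8 := int (ix_val e a))\<rparr>"
  let ?s2 = "?s1\<lparr>pc := Suc (pc ?s1), rreg := denote p \<alpha> (ToR d a) e (rreg s)\<rparr>"
  have "runs p \<alpha> B prog s 5 ?s1"
    using int_ops_runs[OF u] ToR.prems by auto
  moreover have "runs p \<alpha> B prog ?s1 1 ?s2"
    using ToR.prems int_ops_regs_bounded[OF u] by (intro runs_one) auto
  ultimately have "runs p \<alpha> B prog s (5 + 1) ?s2" by (rule runs_trans)
  then show ?case
    using ToR.prems(2) by (intro exI conjI) (assumption | auto)+
next
  case (Mark a)
  have "8 \<notin> S" using Mark.prems(2) by auto
  then obtain u where u: "int_ops B (ix_code 8 a) (ireg s) = Some ((ireg s)(9 := u, 8 := int (ix_val e a)))"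
    and m: "ix_val e a \<le> M + ix_off a"
    using int_ops_ix[of B "ireg s" S a e M L 8] Mark.prems by auto
  have "int (ix_val e a) + 16 \<le> B" using m Mark.prems(6,7) addr_bound_ge[of L] by simp
  let ?J = "(ireg s)(9 := 16, 8 := 16 + int (ix_val e a), 16 + ix_val e a := 16 + int (ix_val e a))"
  have "int_ops B (compile (Mark a) (pc s)) (ireg s) = Some ?J"
    using u int_ops_regs_bounded[OF u] \<open>int (ix_val e a) + 16 \<le> B\<close> Mark.prems
    by (auto simp: int_ops_append nat_add_distrib fun_upd_twist)
  from int_ops_runs[OF this, of prog p \<alpha>] have
    "runs p \<alpha> B prog s 8 (s\<lparr>pc := pc s + 8, ireg := ?J\<rparr>)"
    using Mark.prems by auto
  then show ?case
    using Mark.prems(2) by (intro exI conjI) (assumption | auto)+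
next
  case (Seq c1 c2)
  have offs: "M + offs c1 \<le> L" "M + offs c2 \<le> L" using Seq.prems(6) by (auto simp: max_def split: if_splits)
  obtain t1 s1 where 1: "runs p \<alpha> B prog s t1 s1" "t1 \<le> cost_bound c1 L" "pc s1 = pc s + length (compile c1 (pc s))"
      "rreg s1 = denote p \<alpha> c1 e (rreg s)" "\<forall>x\<in>S. ireg s1 x = ireg s x"
      "\<forall>x\<ge>16. ireg s1 x = (if x \<in> marked c1 e then int x else ireg s x)"
    using Seq.IH(1)[of S s e M] Seq.prems offs by auto
  obtain t2 s2 where 2: "runs p \<alpha> B prog s1 t2 s2" "t2 \<le> cost_bound c2 L" "pc s2 = pc s1 + length (compile c2 (pc s1))"
      "rreg s2 = denote p \<alpha> c2 e (rreg s1)" "\<forall>x\<in>S. ireg s2 x = ireg s1 x"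
      "\<forall>x\<ge>16. ireg s2 x = (if x \<in> marked c2 e then int x else ireg s1 x)"
    using Seq.IH(2)[of S s1 e M] Seq.prems offs 1 runs_regs_bounded[OF 1(1)] by auto
  show ?case
    using runs_trans[OF 1(1) 2(1)] 1(2-) 2(2-) by (intro exI conjI) (assumption | auto)+
next
  case (Cond a b c1 c2)
  have offs: "M + offs c1 \<le> L" "M + offs c2 \<le> L" using Cond.prems(6) by (auto simp: max_def split: if_splits)
  define m where "m = pc s + 3 + length (compile c1 (pc s + 2))"
  define z where "z = pc s + length (compile (Cond a b c1 c2) (pc s))"
  have z: "z = m + length (compile c2 m)" by (simp add: z_def m_def Let_def)
  have code: "code_at prog (pc s) [RLess 8 a b, JmpZ 8 m]" "code_at prog (pc s + 2) (compile c1 (pc s + 2))"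
    "code_at prog (m - 1) [Jmp z]" "code_at prog m (compile c2 m)"
    using Cond.prems(9) by (auto simp: Let_def m_def z add_ac eval_nat_numeral)
  define I1 where "I1 = (ireg s)(8 := (if rreg s a < rreg s b then 1 else 0 :: int))"
  have B1: "1 \<le> B" using Cond.prems(7) addr_bound_ge[of L] by linarith
  let ?s1 = "s\<lparr>pc := pc s + 1, ireg := I1\<rparr>"
  have b1: "regs_bounded B I1" using B1 Cond.prems by (auto simp: I1_def)
  have r1: "runs p \<alpha> B prog s 1 ?s1"
    using code(1) Cond.prems(8) b1 by (intro runs_one) (auto simp: I1_def)
  let ?s2 = "s\<lparr>pc := (if rreg s a < rreg s b then pc s + 2 else m), ireg := I1\<rparr>"
  have r2: "runs p \<alpha> B prog ?s1 1 ?s2"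
    using code(1) b1 by (intro runs_one) (auto simp: I1_def)
  have r12: "runs p \<alpha> B prog s 2 ?s2" using runs_trans[OF r1 r2] by (simp only: one_add_one)
  have I1S: "I1 x = ireg s x" if "x \<in> S \<or> 16 \<le> x" for x using Cond.prems(2) that by (auto simp: I1_def)
  show ?case
  proof (cases "rreg s a < rreg s b")
    case True
    obtain t s3 where 3: "runs p \<alpha> B prog ?s2 t s3" "t \<le> cost_bound c1 L" "pc s3 = pc s + 2 + length (compile c1 (pc s + 2))"
      "rreg s3 = denote p \<alpha> c1 e (rreg s)" "\<forall>x\<in>S. ireg s3 x = I1 x"
      "\<forall>x\<ge>16. ireg s3 x = (if x \<in> marked c1 e then int x else I1 x)"
      using Cond.IH(1)[of S ?s2 e M] Cond.prems offs True code b1 I1S by auto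
    have p3: "pc s3 = m - 1" using 3 by (simp add: m_def)
    have "runs p \<alpha> B prog s3 1 (s3\<lparr>pc := z\<rparr>)"
      using code(3) p3 runs_regs_bounded[OF 3(1)] by (intro runs_one) auto
    note r = runs_trans[OF runs_trans[OF r12 3(1)] this]
    show ?thesis
      using r 3(2-) True I1S Cond.prems(1) by (intro exI conjI) (assumption | auto simp: z_def)+
  next
    case False
    obtain t s3 where 3: "runs p \<alpha> B prog ?s2 t s3" "t \<le> cost_bound c2 L" "pc s3 = m + length (compile c2 m)"
      "rreg s3 = denote p \<alpha> c2 e (rreg s)" "\<forall>x\<in>S. ireg s3 x = I1 x"
      "\<forall>x\<ge>16. ireg s3 x = (if x \<in> marked c2 e then int x else I1 x)"
      using Cond.IH(2)[of S ?s2 e M] Cond.prems offs False code b1 I1S by auto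
    have pz: "pc s3 = pc s + length (compile (Cond a b c1 c2) (pc s))"
      using 3(3) by (simp only: z_def[symmetric] z)
    show ?thesis
      using runs_trans[OF r12 3(1)] pz 3(2,4-) False I1S Cond.prems(1)
      by (intro exI conjI) (assumption | auto)+
  qed
next
  case (For v l h c)
  define H where "H = ix_val e h"
  define z where "z = pc s + 15 + length (compile c (pc s + 12))"
  have code: "code_at prog (pc s) (ix_code v l)" "code_at prog (pc s + 5) (ix_code 8 h)"
    "code_at prog (pc s + 10) [ILess 8 v 8, JmpZ 8 z]" "code_at prog (pc s + 12) (compile c (pc s + 12))"
    "code_at prog (z - 3) [IConst 8 1, IAdd v v 8, Jmp (pc s + 5)]"
    using For.prems(9) by (auto simp: Let_def z_def add_ac eval_nat_numeral)
  have v: "v < 8" "v \<notin> S" and ok: "ix_ok S l" "ix_ok S h" "scoped (insert v S) c" using For.prems(1) by auto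
  have S: "8 \<notin> S" "S \<subseteq> {..<8}" "9 \<notin> S" using For.prems(2) by auto
  have Ml: "M + ix_off l \<le> L" "M + ix_off h \<le> L" using For.prems(6) by (auto simp: max_def split: if_splits)
  have HL: "H \<le> M + ix_off h"
    using int_ops_ix(2)[of B "ireg s" S h e M L 8] For.prems ok Ml S by (auto simp: H_def)
  have lL: "ix_val e l \<le> M + ix_off l"
    using int_ops_ix(2)[of B "ireg s" S l e M L v] For.prems ok Ml S v by auto
  have BL: "int L + 16 \<le> B" using For.prems(7) addr_bound_ge[of L] by linarith
  \<comment> \<open>Induction on the number of remaining rounds, from the state in which the test of
    round \<open>i\<close> begins; 7 is the cost of the failing test.\<close>
  have loop: "\<exists>t s'. runs p \<alpha> B prog s0 t s' \<and> t \<le> 7 + (H - i) * (cost_bound c L + 10) \<and> pc s' = z \<and>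
      rreg s' = fold (\<lambda>i. denote p \<alpha> c (e(v := i))) [i..<H] (rreg s0) \<and> (\<forall>x\<in>S. ireg s' x = ireg s x) \<and>
      (\<forall>x\<ge>16. ireg s' x = (if x \<in> (\<Union>i\<in>{i..<H}. marked c (e(v := i))) then int x else ireg s0 x))"
    if "pc s0 = pc s + 5" "ireg s0 v = int i" "\<forall>x\<in>S. ireg s0 x = ireg s x" "regs_bounded B (ireg s0)" "i \<le> L" for s0 i
    using that
  proof (induction "H - i" arbitrary: i s0)
    case base: 0
    obtain u where u: "int_ops B (ix_code 8 h) (ireg s0) = Some ((ireg s0)(9 := u, 8 := int H))"
      using int_ops_ix(1)[of B "ireg s0" S h e M L 8] For.prems ok Ml S base.prems(3,4) by (auto simp: H_def)
    let ?J = "(ireg s0)(9 := u, 8 := 0)"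
    have bJ: "regs_bounded B ?J"
      using regs_bounded_upd[OF conjunct2[OF int_ops_regs_bounded[OF u]], of 0 8] BL by simp
    have "int_ops B (ix_code 8 h @ [ILess 8 v 8]) (ireg s0) = Some ?J"
      using u int_ops_regs_bounded[OF u] bJ base v BL by (simp add: int_ops_append)
    from int_ops_runs[OF this, of prog p \<alpha>] have r1: "runs p \<alpha> B prog s0 6 (s0\<lparr>pc := pc s + 11, ireg := ?J\<rparr>)"
      using code base.prems(1) by (auto simp: eval_nat_numeral)
    have "runs p \<alpha> B prog (s0\<lparr>pc := pc s + 11, ireg := ?J\<rparr>) 1 (s0\<lparr>pc := z, ireg := ?J\<rparr>)"
      using code runs_regs_bounded[OF r1] by (intro runs_one) (auto simp: eval_nat_numeral)
    note r = runs_trans[OF r1 this]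
    have "[i..<H] = []" "{i..<H} = {}" using base.hyps by auto
    then have regs: "\<forall>x\<ge>16. ireg (s0\<lparr>pc := z, ireg := ?J\<rparr>) x = (if x \<in> (\<Union>i\<in>{i..<H}. marked c (e(v := i))) then int x else ireg s0 x)"
      and R: "rreg (s0\<lparr>pc := z, ireg := ?J\<rparr>) = fold (\<lambda>i. denote p \<alpha> c (e(v := i))) [i..<H] (rreg s0)"
      by auto
    have t: "6 + 1 \<le> 7 + (H - i) * (cost_bound c L + 10)" by simp
    have I: "\<forall>x\<in>S. ireg (s0\<lparr>pc := z, ireg := ?J\<rparr>) x = ireg s x" using base.prems(3) S by auto
    have pz: "pc (s0\<lparr>pc := z, ireg := ?J\<rparr>) = z" by simp
    show ?case
      by (intro exI conjI) (rule r t pz R I regs)+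
  next
    case (Suc k)
    have iH: "i < H" using Suc.hyps(2) by auto
    obtain u where u: "int_ops B (ix_code 8 h) (ireg s0) = Some ((ireg s0)(9 := u, 8 := int H))"
      using int_ops_ix(1)[of B "ireg s0" S h e M L 8] For.prems ok Ml S Suc.prems(3,4) by (auto simp: H_def)
    let ?J = "(ireg s0)(9 := u, 8 := 1)"
    have bJ: "regs_bounded B ?J"
      using regs_bounded_upd[OF conjunct2[OF int_ops_regs_bounded[OF u]], of 1 8] BL by simp
    have "int_ops B (ix_code 8 h @ [ILess 8 v 8]) (ireg s0) = Some ?J"
      using u int_ops_regs_bounded[OF u] bJ Suc.prems v BL iH by (simp add: int_ops_append)
    from int_ops_runs[OF this, of prog p \<alpha>] have r1: "runs p \<alpha> B prog s0 6 (s0\<lparr>pc := pc s + 11, ireg := ?J\<rparr>)"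
      using code Suc.prems(1) by (auto simp: eval_nat_numeral)
    let ?s2 = "s0\<lparr>pc := pc s + 12, ireg := ?J\<rparr>"
    have "runs p \<alpha> B prog (s0\<lparr>pc := pc s + 11, ireg := ?J\<rparr>) 1 ?s2"
      using code runs_regs_bounded[OF r1] by (intro runs_one) (auto simp: eval_nat_numeral)
    note r2 = runs_trans[OF r1 this]
    let ?e = "e(v := i)"
    have "\<exists>t s'. runs p \<alpha> B prog ?s2 t s' \<and> t \<le> cost_bound c L \<and> pc s' = pc ?s2 + length (compile c (pc ?s2)) \<and>
      rreg s' = denote p \<alpha> c ?e (rreg ?s2) \<and> (\<forall>x\<in>insert v S. ireg s' x = ireg ?s2 x) \<and>
      (\<forall>x\<ge>16. ireg s' x = (if x \<in> marked c ?e then int x else ireg ?s2 x))"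
    \<comment> \<open>The new variable lies below the upper bound of the loop, hence below
      \<open>M\<close> plus the offset of that bound.\<close>
    proof (rule For.IH[of "insert v S" ?s2 ?e "M + max (ix_off l) (ix_off h)"])
      show "ireg ?s2 x = int (?e x)" if "x \<in> insert v S" for x
        using that v Suc.prems(2,3) For.prems(4) S by auto
      show "?e x \<le> M + max (ix_off l) (ix_off h)" if "x \<in> insert v S" for x
        using that For.prems(5)[of x] iH HL by auto
      show "regs_bounded B (ireg ?s2)" using runs_regs_bounded[OF r2] .
    qed (use For.prems ok v code in auto)
    then obtain t s3 where 3: "runs p \<alpha> B prog ?s2 t s3" "t \<le> cost_bound c L" "pc s3 = z - 3"
      "rreg s3 = denote p \<alpha> c ?e (rreg s0)" "\<forall>x\<in>insert v S. ireg s3 x = ireg ?s2 x"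
      "\<forall>x\<ge>16. ireg s3 x = (if x \<in> marked c ?e then int x else ireg s0 x)"
      by (auto simp: z_def)
    have v3: "ireg s3 v = int i" using 3(5) v Suc.prems(2) by auto
    let ?K = "(ireg s3)(8 := 1, v := int i + 1)"
    have i1: "int i + 1 \<le> B" using iH HL Ml BL by linarith
    have "int_ops B [IConst 8 1, IAdd v v 8] (ireg s3) = Some ?K"
      using v v3 runs_regs_bounded[OF 3(1)] i1 by (simp add: fun_upd_twist)
    from int_ops_runs[OF this, of prog p \<alpha>] have r3: "runs p \<alpha> B prog s3 2 (s3\<lparr>pc := z - 1, ireg := ?K\<rparr>)"
      using code 3(3) by (auto simp: eval_nat_numeral z_def)
    let ?s4 = "s3\<lparr>pc := pc s + 5, ireg := ?K\<rparr>"
    have "runs p \<alpha> B prog (s3\<lparr>pc := z - 1, ireg := ?K\<rparr>) 1 ?s4"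
      using code runs_regs_bounded[OF r3] by (intro runs_one) (auto simp: eval_nat_numeral z_def)
    note r4 = runs_trans[OF runs_trans[OF r2 3(1)] runs_trans[OF r3 this]]
    have "k = H - Suc i" using Suc.hyps(2) by auto
    moreover have "\<forall>x\<in>S. ireg ?s4 x = ireg s x"
      using 3(5) v S Suc.prems(3) by auto
    moreover have "Suc i \<le> L" using iH HL Ml by linarith
    moreover have "pc ?s4 = pc s + 5" "ireg ?s4 v = int (Suc i)" using v by auto
    ultimately have "\<exists>t' s'. runs p \<alpha> B prog ?s4 t' s' \<and> t' \<le> 7 + (H - Suc i) * (cost_bound c L + 10) \<and> pc s' = z \<and>
      rreg s' = fold (\<lambda>i. denote p \<alpha> c (e(v := i))) [Suc i..<H] (rreg ?s4) \<and> (\<forall>x\<in>S. ireg s' x = ireg s x) \<and>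
      (\<forall>x\<ge>16. ireg s' x = (if x \<in> (\<Union>i\<in>{Suc i..<H}. marked c (e(v := i))) then int x else ireg ?s4 x))"
      using runs_regs_bounded[OF r4] by (intro Suc.hyps(1))
    then obtain t' s' where 5: "runs p \<alpha> B prog ?s4 t' s'" "t' \<le> 7 + (H - Suc i) * (cost_bound c L + 10)" "pc s' = z"
      "rreg s' = fold (\<lambda>i. denote p \<alpha> c (e(v := i))) [Suc i..<H] (rreg ?s4)" "\<forall>x\<in>S. ireg s' x = ireg s x"
      "\<forall>x\<ge>16. ireg s' x = (if x \<in> (\<Union>i\<in>{Suc i..<H}. marked c (e(v := i))) then int x else ireg ?s4 x)"
      by (elim exE conjE)
    have up: "[i..<H] = i # [Suc i..<H]" using iH by (rule upt_conv_Cons)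
    have se: "{i..<H} = insert i {Suc i..<H}" using iH by auto
    have "H - i = Suc (H - Suc i)" using iH by auto
    then have t: "6 + 1 + t + (2 + 1) + t' \<le> 7 + (H - i) * (cost_bound c L + 10)"
      using 3(2) 5(2) by simp
    have regs: "\<forall>x\<ge>16. ireg s' x = (if x \<in> (\<Union>i\<in>{i..<H}. marked c (e(v := i))) then int x else ireg s0 x)"
      using 5(6) 3(6) v unfolding se by auto
    have R: "rreg s' = fold (\<lambda>i. denote p \<alpha> c (e(v := i))) [i..<H] (rreg s0)"
      using 5(4) 3(4) unfolding up by simp
    show ?case
      by (intro exI conjI) (rule runs_trans[OF r4 5(1)] t 5(3) R 5(5) regs)+
  qed
  obtain u where u: "int_ops B (ix_code v l) (ireg s) = Some ((ireg s)(9 := u, v := int (ix_val e l)))"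
    using int_ops_ix(1)[of B "ireg s" S l e M L v] For.prems ok Ml S v by auto
  let ?s0 = "s\<lparr>pc := pc s + 5, ireg := (ireg s)(9 := u, v := int (ix_val e l))\<rparr>"
  have r0: "runs p \<alpha> B prog s 5 ?s0"
    using int_ops_runs[OF u, of prog p \<alpha>] code by simp
  have "\<exists>t s'. runs p \<alpha> B prog ?s0 t s' \<and> t \<le> 7 + (H - ix_val e l) * (cost_bound c L + 10) \<and> pc s' = z \<and>
      rreg s' = fold (\<lambda>i. denote p \<alpha> c (e(v := i))) [ix_val e l..<H] (rreg ?s0) \<and> (\<forall>x\<in>S. ireg s' x = ireg s x) \<and>
      (\<forall>x\<ge>16. ireg s' x = (if x \<in> (\<Union>i\<in>{ix_val e l..<H}. marked c (e(v := i))) then int x else ireg ?s0 x))"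
    by (rule loop) (use int_ops_regs_bounded[OF u] S v lL Ml in auto)
  then obtain t s' where s': "runs p \<alpha> B prog ?s0 t s'" "t \<le> 7 + (H - ix_val e l) * (cost_bound c L + 10)" "pc s' = z"
    "rreg s' = denote p \<alpha> (For v l h c) e (rreg s)" "\<forall>x\<in>S. ireg s' x = ireg s x"
    "\<forall>x\<ge>16. ireg s' x = (if x \<in> marked (For v l h c) e then int x else ireg s x)"
    using v by (elim exE conjE) (auto simp: H_def)
  have "(H - ix_val e l) * (cost_bound c L + 10) \<le> L * (cost_bound c L + 10)"
    using HL Ml by (intro mult_le_mono) auto
  then have t: "5 + t \<le> cost_bound (For v l h c) L" using s'(2) unfolding cost_bound.simps by linarith
  have pz: "pc s' = pc s + length (compile (For v l h c) (pc s))"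
    using s'(3) by (simp add: z_def Let_def)
  show ?case
    by (intro exI conjI) (rule runs_trans[OF r0 s'(1)] t pz s'(4,5,6))+
qed

section \<open>Smallest axis-centred disks\<close>

lemma lp_dist_axis_infinity: "lp_dist \<infinity> z (c, 0) = max \<bar>fst z - c\<bar> \<bar>snd z\<bar>"
  by (simp add: lp_dist_def lp_norm_def)

lemma lp_dist_axis_finite:
  "q \<noteq> \<infinity> \<Longrightarrow> lp_dist q z (c, 0) =
    (\<bar>fst z - c\<bar> powr real_of_ereal q + \<bar>snd z\<bar> powr real_of_ereal q) powr (1 / real_of_ereal q)"
  by (simp add: lp_dist_def lp_norm_def)

lemma real_of_ereal_ge_one:
  assumes "1 \<le> q" "q \<noteq> \<infinity>"
  shows "1 \<le> real_of_ereal q"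
  using assms by (cases q) (auto simp: one_ereal_def)

lemma lp_dist_nonneg: "0 \<le> lp_dist q z w"
  by (simp add: lp_dist_def lp_norm_def le_max_iff_disj)

lemma lp_dist_axis_mono:
  assumes "1 \<le> q" "\<bar>fst z - c\<bar> \<le> \<bar>fst z - d\<bar>"
  shows "lp_dist q z (c, 0) \<le> lp_dist q z (d, 0)"
proof (cases "q = \<infinity>")
  case True
  then show ?thesis using assms by (auto simp: lp_dist_axis_infinity)
next
  case False
  have "1 \<le> real_of_ereal q" using assms False by (intro real_of_ereal_ge_one)
  then show ?thesis using assms False
    by (auto simp: lp_dist_axis_finite intro!: powr_mono2 add_mono)
qed

text \<open>Fails for the maximum norm, where the height may dominate both offsets. Uniqueness of
  centres is lost with it, which forces the separate treatment of
  \<open>\<infinity>\<close>.\<close>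

lemma lp_dist_axis_strict_mono:
  assumes "1 \<le> q" "q \<noteq> \<infinity>" "\<bar>fst z - c\<bar> < \<bar>fst z - d\<bar>"
  shows "lp_dist q z (c, 0) < lp_dist q z (d, 0)"
proof -
  have "1 \<le> real_of_ereal q" using assms by (intro real_of_ereal_ge_one)
  then show ?thesis using assms
    by (auto simp: lp_dist_axis_finite intro!: powr_less_mono2 add_less_le_mono)
qed

lemma continuous_lp_dist_axis:
  assumes "1 \<le> q"
  shows "continuous_on A (\<lambda>c. lp_dist q z (c, 0))"
proof (cases "q = \<infinity>")
  case True
  then show ?thesis by (auto simp: lp_dist_axis_infinity intro!: continuous_intros)
next
  case False
  have "1 \<le> real_of_ereal q" using assms False by (intro real_of_ereal_ge_one)
  then show ?thesis using False
    by (auto simp: lp_dist_axis_finite intro!: continuous_intros continuous_on_powr')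
qed

text \<open>Clamping a centre to the interval between the two abscissae brings it no farther from
  either point, so the minimum over this compact interval is global. This gives the choice in
  \<open>min_disk2\<close> its meaning.\<close>

lemma min_disk2_exists:
  assumes "1 \<le> q"
  shows "\<exists>D. snd D = max (lp_dist q a (fst D, 0)) (lp_dist q b (fst D, 0)) \<and>
      (\<forall>c. snd D \<le> max (lp_dist q a (c, 0)) (lp_dist q b (c, 0)))"
proof -
  let ?f = "\<lambda>c. max (lp_dist q a (c, 0)) (lp_dist q b (c, 0))"
  define l where "l = min (fst a) (fst b)"
  define u where "u = max (fst a) (fst b)"
  have lu: "l \<le> u" by (simp add: l_def u_def)
  have "continuous_on {l..u} ?f"
    by (intro continuous_intros continuous_lp_dist_axis assms)
  then obtain m where m: "m \<in> {l..u}" "\<And>c. c \<in> {l..u} \<Longrightarrow> ?f m \<le> ?f c"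
    using continuous_attains_inf[of "{l..u}" ?f] lu by auto
  have "?f m \<le> ?f c" for c
  proof -
    define c' where "c' = min u (max l c)"
    have c': "c' \<in> {l..u}" "\<bar>fst a - c'\<bar> \<le> \<bar>fst a - c\<bar>" "\<bar>fst b - c'\<bar> \<le> \<bar>fst b - c\<bar>"
      using lu by (auto simp: c'_def l_def u_def)
    then have "?f c' \<le> ?f c"
      using lp_dist_axis_mono[OF assms] by (intro max.mono) auto
    with m(2)[OF c'(1)] show ?thesis by linarith
  qed
  then show ?thesis by (intro exI[of _ "(m, ?f m)"]) auto
qed

lemma min_disk2:
  assumes "1 \<le> q"
  shows "snd (min_disk2 q a b) = max (lp_dist q a (fst (min_disk2 q a b), 0)) (lp_dist q b (fst (min_disk2 q a b), 0))"
    and "snd (min_disk2 q a b) \<le> max (lp_dist q a (c, 0)) (lp_dist q b (c, 0))"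
  using someI_ex[OF min_disk2_exists[OF assms, of a b]] unfolding min_disk2_def by blast+

text \<open>The midpoint of two different optimal centres is strictly nearer to each point than the
  farther of these centres, so it would admit a smaller radius.\<close>

lemma min_disk2_unique:
  assumes "1 \<le> q" "q \<noteq> \<infinity>"
    and "lp_dist q a (c, 0) \<le> snd (min_disk2 q a b)" "lp_dist q b (c, 0) \<le> snd (min_disk2 q a b)"
  shows "c = fst (min_disk2 q a b)"
proof (rule ccontr)
  define m where "m = fst (min_disk2 q a b)"
  define R where "R = snd (min_disk2 q a b)"
  assume "c \<noteq> fst (min_disk2 q a b)"
  then have "c \<noteq> m" by (simp add: m_def)
  let ?d = "(c + m) / 2"
  have less: "lp_dist q z (?d, 0) < R" if "lp_dist q z (c, 0) \<le> R" "lp_dist q z (m, 0) \<le> R" for z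
  proof -
    have "\<bar>fst z - ?d\<bar> < \<bar>fst z - c\<bar> \<or> \<bar>fst z - ?d\<bar> < \<bar>fst z - m\<bar>"
      using \<open>c \<noteq> m\<close> by (auto simp: abs_if field_simps)
    then show ?thesis using lp_dist_axis_strict_mono[OF assms(1,2)] that by (meson less_le_trans)
  qed
  have "lp_dist q a (m, 0) \<le> R" "lp_dist q b (m, 0) \<le> R"
    using min_disk2(1)[OF assms(1), of a b] by (auto simp: m_def R_def)
  then have "max (lp_dist q a (?d, 0)) (lp_dist q b (?d, 0)) < R"
    using less assms(3,4) by (auto simp: R_def)
  then show False using min_disk2(2)[OF assms(1), of a b ?d] by (auto simp: R_def max_def split: if_splits)
qed

definition min_cover :: "ereal \<Rightarrow> (real \<times> real) set \<Rightarrow> disk \<Rightarrow> bool" where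
  "min_cover q A D \<longleftrightarrow> 0 \<le> snd D \<and> (\<forall>z\<in>A. in_disk q D z) \<and> (\<forall>E. (\<forall>z\<in>A. in_disk q E z) \<longrightarrow> snd D \<le> snd E)"

lemma min_disk2_le:
  assumes "1 \<le> q" "in_disk q E a" "in_disk q E b"
  shows "snd (min_disk2 q a b) \<le> snd E"
  using min_disk2(2)[OF assms(1), of a b "fst E"] assms(2,3) by (auto simp: in_disk_def)

lemma snd_min_disk2_nonneg: "1 \<le> q \<Longrightarrow> 0 \<le> snd (min_disk2 q a b)"
  by (simp add: min_disk2(1) lp_dist_nonneg le_max_iff_disj)

text \<open>One-dimensional Helly: if another point \<open>z\<close> were outside, then the disks of \<open>{a, z}\<close> and \<open>{b, z}\<close>
  would both have their centres on the same side of the centre of the disk of \<open>{a, b}\<close>, and the one nearer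
  to it would cover \<open>{a, b}\<close> within the same radius.\<close>

lemma min_cover_max_pair_finite:
  assumes q: "1 \<le> q" "q \<noteq> \<infinity>" and ab: "a \<in> A" "b \<in> A"
    and max: "\<And>s t. s \<in> A \<Longrightarrow> t \<in> A \<Longrightarrow> snd (min_disk2 q s t) \<le> snd (min_disk2 q a b)"
  shows "min_cover q A (min_disk2 q a b)"
proof -
  define m where "m = fst (min_disk2 q a b)"
  define R where "R = snd (min_disk2 q a b)"
  have "lp_dist q z (m, 0) \<le> R" if z: "z \<in> A" for z
  proof (rule ccontr)
    assume out: "\<not> lp_dist q z (m, 0) \<le> R"
    have pair: "\<exists>c. lp_dist q s (c, 0) \<le> R \<and> lp_dist q z (c, 0) \<le> R" if "s \<in> A" for s
      using min_disk2(1)[OF q(1), of s z] max[OF that z]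
      by (intro exI[of _ "fst (min_disk2 q s z)"]) (auto simp: R_def)
    obtain c where c: "lp_dist q a (c, 0) \<le> R" "lp_dist q z (c, 0) \<le> R" using pair[OF ab(1)] by auto
    obtain d where d: "lp_dist q b (d, 0) \<le> R" "lp_dist q z (d, 0) \<le> R" using pair[OF ab(2)] by auto
    have near: "\<bar>fst z - c\<bar> < \<bar>fst z - m\<bar>" "\<bar>fst z - d\<bar> < \<bar>fst z - m\<bar>"
      using lp_dist_axis_mono[OF q(1), of z m] c(2) d(2) out by (meson not_le order_trans)+
    obtain e where e': "e \<noteq> m" "min m c \<le> e" "e \<le> max m c" "min m d \<le> e" "e \<le> max m d"
    proof -
      have "fst z \<noteq> m"
        using near by auto
      then consider "m < fst z" | "fst z < m" by linarith
      then show thesis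
      proof cases
        case 1
        then have "m < c" "m < d" using near by linarith+
        then show thesis by (intro that[of "min c d"]) auto
      next
        case 2
        then have "c < m" "d < m" using near by linarith+
        then show thesis by (intro that[of "max c d"]) auto
      qed
    qed
    \<comment> \<open>Any \<open>e\<close> between \<open>m\<close> and \<open>g\<close> is no
      farther from \<open>fst s\<close> than one of the two.\<close>
    have le: "lp_dist q s (e, 0) \<le> R" if "lp_dist q s (m, 0) \<le> R" "lp_dist q s (g, 0) \<le> R" "min m g \<le> e" "e \<le> max m g" for s g
    proof -
      have "\<bar>fst s - e\<bar> \<le> \<bar>fst s - m\<bar> \<or> \<bar>fst s - e\<bar> \<le> \<bar>fst s - g\<bar>"
        using that(3,4) by linarith
      then show ?thesis using lp_dist_axis_mono[OF q(1)] that(1,2) by (meson order_trans)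
    qed
    have "lp_dist q a (m, 0) \<le> R" "lp_dist q b (m, 0) \<le> R"
      using min_disk2(1)[OF q(1), of a b] by (auto simp: m_def R_def)
    then have "lp_dist q a (e, 0) \<le> R" "lp_dist q b (e, 0) \<le> R"
      using le[OF _ c(1)] le[OF _ d(1)] e' by blast+
    then have "e = m"
      unfolding m_def R_def by (rule min_disk2_unique[OF q])
    with e' show False by simp
  qed
  then show ?thesis
    using ab min_disk2_le[OF q(1)] snd_min_disk2_nonneg[OF q(1)]
    unfolding min_cover_def by (auto simp: in_disk_def m_def R_def)
qed

text \<open>When heights dominate, the disk of the best pair may have a badly placed centre, but its
  radius is still right. The pair of extreme points bounds half the width by this radius and the
  pair \<open>(z, z)\<close> bounds each height, so the middle of the run can serve as
  centre.\<close>

lemma min_cover_max_pair_infinity: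
  assumes ab: "a \<in> A" "b \<in> A" and lu: "l \<in> A" "u \<in> A" "\<And>z. z \<in> A \<Longrightarrow> fst l \<le> fst z \<and> fst z \<le> fst u"
    and max: "\<And>s t. s \<in> A \<Longrightarrow> t \<in> A \<Longrightarrow> snd (min_disk2 \<infinity> s t) \<le> snd (min_disk2 \<infinity> a b)"
  shows "min_cover \<infinity> A ((fst l + fst u) / 2, snd (min_disk2 \<infinity> a b))"
proof -
  define R where "R = snd (min_disk2 \<infinity> a b)"
  have dist: "\<exists>c. max \<bar>fst s - c\<bar> \<bar>snd s\<bar> \<le> R \<and> max \<bar>fst t - c\<bar> \<bar>snd t\<bar> \<le> R" if "s \<in> A" "t \<in> A" for s t
    using min_disk2(1)[of \<infinity> s t] max[OF that]
    by (intro exI[of _ "fst (min_disk2 \<infinity> s t)"]) (auto simp: R_def lp_dist_axis_infinity)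
  obtain c where "\<bar>fst l - c\<bar> \<le> R" "\<bar>fst u - c\<bar> \<le> R" using dist[OF lu(1,2)] by auto
  then have "fst u - fst l \<le> 2 * R" by linarith
  then have "in_disk \<infinity> ((fst l + fst u) / 2, R) z" if "z \<in> A" for z
    using lu(3)[OF that] dist[OF that that] by (auto simp: in_disk_def lp_dist_axis_infinity abs_le_iff field_simps)
  then show ?thesis
    using ab min_disk2_le[of \<infinity>] snd_min_disk2_nonneg[of \<infinity>]
    unfolding min_cover_def by (auto simp: R_def)
qed

section \<open>Monotone assignment of points to disks\<close>

text \<open>Extends convexity from the positive reals to 0: if one argument vanishes, what remains
  is \<open>v powr p \<le> v\<close> for \<open>v\<close> in the unit interval.\<close>

lemma powr_convex_nonneg:
  fixes a b u p :: real
  assumes "1 \<le> p" "0 \<le> a" "0 \<le> b" "0 \<le> u" "u \<le> 1"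
  shows "((1 - u) * a + u * b) powr p \<le> (1 - u) * a powr p + u * b powr p"
proof -
  have sub: "v powr p \<le> v" if "0 \<le> v" "v \<le> 1" for v :: real
    using powr_mono'[of 1 p v] that assms(1) by (cases "v = 0") auto
  show ?thesis
  proof (cases "a = 0 \<or> b = 0")
    case True
    then show ?thesis
    proof
      assume "a = 0"
      then show ?thesis using sub[of u] assms by (simp add: powr_mult mult_right_mono)
    next
      assume "b = 0"
      then show ?thesis using sub[of "1 - u"] assms by (simp add: powr_mult mult_right_mono)
    qed
  next
    case False
    then show ?thesis using convex_onD[OF powr_convex[OF assms(1)], of u a b] assms by simp
  qed
qed

text \<open>Both \<open>x - d\<close> and \<open>y - c\<close> lie between \<open>x - c\<close> and
  \<open>y - d\<close>, as convex combinations with complementary weights \<open>u\<close> and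
  \<open>1 - u\<close>. Adding the two convexity inequalities cancels the weights.\<close>

lemma abs_powr_diff_mono:
  fixes c d x y p :: real
  assumes p: "1 \<le> p" and "d \<le> c" "x \<le> y"
  shows "\<bar>x - d\<bar> powr p - \<bar>x - c\<bar> powr p \<le> \<bar>y - d\<bar> powr p - \<bar>y - c\<bar> powr p"
proof (cases "d = c \<and> x = y")
  case False
  define s where "s = (c - d) + (y - x)"
  define u where "u = (c - d) / s"
  have s: "0 < s" using False assms by (auto simp: s_def)
  then have u: "0 \<le> u" "u \<le> 1" using assms by (auto simp: u_def s_def field_simps)
  have conv: "\<bar>(1 - v) * a + v * b\<bar> powr p \<le> (1 - v) * \<bar>a\<bar> powr p + v * \<bar>b\<bar> powr p"
    if "0 \<le> v" "v \<le> 1" for a b v :: real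
  proof -
    have "\<bar>(1 - v) * a + v * b\<bar> \<le> (1 - v) * \<bar>a\<bar> + v * \<bar>b\<bar>"
      using that abs_triangle_ineq[of "(1 - v) * a" "v * b"] by (simp add: abs_mult)
    then have "\<bar>(1 - v) * a + v * b\<bar> powr p \<le> ((1 - v) * \<bar>a\<bar> + v * \<bar>b\<bar>) powr p"
      using p by (intro powr_mono2) auto
    also have "\<dots> \<le> (1 - v) * \<bar>a\<bar> powr p + v * \<bar>b\<bar> powr p"
      using that p by (intro powr_convex_nonneg) auto
    finally show ?thesis .
  qed
  have us: "u * s = c - d" using s by (simp add: u_def)
  have "(1 - u) * (x - c) + u * (y - d) = x - c + u * s" by (simp add: s_def algebra_simps)
  then have 1: "(1 - u) * (x - c) + u * (y - d) = x - d" using us by simp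
  have "(1 - (1 - u)) * (x - c) + (1 - u) * (y - d) = y - d - u * s" by (simp add: s_def algebra_simps)
  then have 2: "(1 - (1 - u)) * (x - c) + (1 - u) * (y - d) = y - c" using us by simp
  show ?thesis
    using conv[OF u, of "x - c" "y - d"] conv[of "1 - u" "x - c" "y - d"] u
    unfolding 1 2 by (simp add: algebra_simps)
qed simp

text \<open>Removing the outer root separates the two coordinates, as the power diagram
  needs.\<close>

lemma in_disk_finite_iff:
  assumes "1 \<le> q" "q \<noteq> \<infinity>" "0 \<le> snd D"
  shows "in_disk q D z \<longleftrightarrow>
    \<bar>fst z - fst D\<bar> powr real_of_ereal q + \<bar>snd z\<bar> powr real_of_ereal q \<le> snd D powr real_of_ereal q"
proof -
  let ?p = "real_of_ereal q"
  let ?S = "\<bar>fst z - fst D\<bar> powr ?p + \<bar>snd z\<bar> powr ?p"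
  have p: "1 \<le> ?p" using assms by (intro real_of_ereal_ge_one)
  have S: "0 \<le> ?S" by simp
  have "?S powr (1 / ?p) \<le> snd D \<longleftrightarrow> ?S \<le> snd D powr ?p"
  proof
    assume "?S powr (1 / ?p) \<le> snd D"
    then have "(?S powr (1 / ?p)) powr ?p \<le> snd D powr ?p" using p by (intro powr_mono2) auto
    then show "?S \<le> snd D powr ?p" using p S by (simp add: powr_powr)
  next
    assume "?S \<le> snd D powr ?p"
    then have "?S powr (1 / ?p) \<le> (snd D powr ?p) powr (1 / ?p)" using p S by (intro powr_mono2) auto
    then show "?S powr (1 / ?p) \<le> snd D" using p assms by (simp add: powr_powr)
  qed
  then show ?thesis using assms by (simp add: in_disk_def lp_dist_axis_finite)
qed

lemma lex_min_exists:
  fixes f g :: "'a \<Rightarrow> real"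
  assumes "finite T" "T \<noteq> {}"
  shows "\<exists>D\<in>T. \<forall>E\<in>T. f D < f E \<or> f D = f E \<and> g D \<le> g E"
proof -
  obtain D where D: "D \<in> T" "\<And>E. E \<in> T \<Longrightarrow> f D \<le> f E"
    using ex_min_if_finite[of "f ` T"] assms by (auto simp: not_less)
  let ?U = "{E \<in> T. f E = f D}"
  have "finite (g ` ?U)" "g ` ?U \<noteq> {}" using assms D by auto
  then obtain E where "E \<in> ?U" "\<And>F. F \<in> ?U \<Longrightarrow> g E \<le> g F"
    using ex_min_if_finite[of "g ` ?U"] by (auto simp: not_less)
  then show ?thesis using D by (intro bexI[of _ E]) (auto simp: less_le)
qed

text \<open>For finite \<open>q\<close> a point is sent to the cell of the power diagram that contains it: the power
  \<open>|x - c|^q + |y|^q - r^q\<close> depends on \<open>y\<close> in the same way for all disks, and the difference of two powers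
  is monotone in \<open>x\<close>.\<close>

lemma monotone_assignment_finite:
  assumes q: "1 \<le> q" "q \<noteq> \<infinity>" and S: "finite S" "S \<noteq> {}" "\<And>D. D \<in> S \<Longrightarrow> 0 \<le> snd D"
  shows "\<exists>\<phi> :: real \<Rightarrow> disk.
    (\<forall>z. (\<exists>D\<in>S. in_disk q D z) \<longrightarrow> \<phi> (fst z) \<in> S \<and> in_disk q (\<phi> (fst z)) z) \<and>
    (\<forall>x y. x \<le> y \<longrightarrow> fst (\<phi> x) \<le> fst (\<phi> y)) \<and>
    (\<forall>x y. fst (\<phi> x) = fst (\<phi> y) \<longrightarrow> \<phi> x = \<phi> y)"
proof -
  define p where "p = real_of_ereal q"
  have p: "1 \<le> p" unfolding p_def using q by (intro real_of_ereal_ge_one)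
  define h where "h = (\<lambda>(D :: disk) x. \<bar>x - fst D\<bar> powr p - snd D powr p)"
  have "\<forall>x. \<exists>D\<in>S. \<forall>E\<in>S. h D x < h E x \<or> h D x = h E x \<and> fst D \<le> fst E"
    by (intro allI lex_min_exists S)
  then obtain \<phi> where phi: "\<And>x. \<phi> x \<in> S" "\<And>x E. E \<in> S \<Longrightarrow> h (\<phi> x) x < h E x \<or> h (\<phi> x) x = h E x \<and> fst (\<phi> x) \<le> fst E"
    by metis
  have "in_disk q (\<phi> (fst z)) z" if "D \<in> S" "in_disk q D z" for D z
  proof -
    have "h D (fst z) + \<bar>snd z\<bar> powr p \<le> 0"
      using that S(3) q by (simp add: in_disk_finite_iff h_def p_def)
    moreover have "h (\<phi> (fst z)) (fst z) \<le> h D (fst z)" using phi(2)[OF that(1), of "fst z"] by linarith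
    ultimately show ?thesis
      using S(3)[OF phi(1)] q by (simp add: in_disk_finite_iff h_def p_def)
  qed
  moreover have "fst (\<phi> x) \<le> fst (\<phi> y)" if "x \<le> y" for x y
  proof (rule ccontr)
    assume less: "\<not> fst (\<phi> x) \<le> fst (\<phi> y)"
    \<comment> \<open>Ties go to the smaller centre, so a larger centre at \<open>x\<close> must
      have strictly smaller power there.\<close>
    then have "h (\<phi> x) x < h (\<phi> y) x" using phi(2)[OF phi(1), of x y] by linarith
    moreover have "h (\<phi> y) x - h (\<phi> x) x \<le> h (\<phi> y) y - h (\<phi> x) y"
      using abs_powr_diff_mono[OF p, of "fst (\<phi> y)" "fst (\<phi> x)" x y] less that by (simp add: h_def)
    moreover have "h (\<phi> y) y \<le> h (\<phi> x) y" using phi(2)[OF phi(1), of y x] by linarith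
    ultimately show False by linarith
  qed
  moreover have "\<phi> x = \<phi> y" if "fst (\<phi> x) = fst (\<phi> y)" for x y
  proof -
    have "h (\<phi> x) x \<le> h (\<phi> y) x" "h (\<phi> y) y \<le> h (\<phi> x) y"
      using phi(2)[OF phi(1), of x y] phi(2)[OF phi(1), of y x] by linarith+
    then have "snd (\<phi> x) powr p = snd (\<phi> y) powr p" using that by (simp add: h_def)
    then have "(snd (\<phi> x) powr p) powr (1 / p) = (snd (\<phi> y) powr p) powr (1 / p)" by simp
    then have "snd (\<phi> x) = snd (\<phi> y)" using S(3)[OF phi(1)] p by (simp add: powr_powr)
    with that show ?thesis by (simp add: prod_eq_iff)
  qed
  ultimately show ?thesis using phi(1) by (intro exI[of _ \<phi>]) blast
qed

text \<open>If two centres were in the wrong order, the disk with the larger radius would contain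
  the other abscissa in its \<open>x\<close>-range too and would have been preferred there; equal
  radii are decided by the larger centre. Heights do no harm, because the chosen disk is at least as
  large as any disk that covers the point. Abscissae outside all ranges get an arbitrary value,
  hence the premises on \<open>z\<close> and \<open>w\<close>.\<close>

lemma monotone_assignment_infinity:
  assumes S: "finite S"
  shows "\<exists>\<phi> :: real \<Rightarrow> disk. \<forall>z w. (\<exists>D\<in>S. in_disk \<infinity> D z) \<longrightarrow> (\<exists>D\<in>S. in_disk \<infinity> D w) \<longrightarrow>
     \<phi> (fst z) \<in> S \<and> in_disk \<infinity> (\<phi> (fst z)) z \<and> (fst z \<le> fst w \<longrightarrow> fst (\<phi> (fst z)) \<le> fst (\<phi> (fst w))) \<and>
     (fst (\<phi> (fst z)) = fst (\<phi> (fst w)) \<longrightarrow> \<phi> (fst z) = \<phi> (fst w))"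
proof -
  define T where "T x = {D \<in> S. \<bar>x - fst D\<bar> \<le> snd D}" for x
  have fin: "finite (T x)" for x using S by (simp add: T_def)
  have "\<exists>D. T x \<noteq> {} \<longrightarrow> D \<in> T x \<and> (\<forall>E\<in>T x. snd E < snd D \<or> snd E = snd D \<and> fst E \<le> fst D)" for x
  proof (cases "T x = {}")
    case False
    from lex_min_exists[OF fin this, of "\<lambda>D. - snd D" "\<lambda>D. - fst D"] obtain D where
      "D \<in> T x" "\<forall>E\<in>T x. - snd D < - snd E \<or> - snd D = - snd E \<and> - fst D \<le> - fst E" by blast
    then show ?thesis by (intro exI[of _ D]) auto
  qed simp
  then obtain \<phi> where phi: "\<And>x. T x \<noteq> {} \<Longrightarrow> \<phi> x \<in> T x"
      "\<And>x E. E \<in> T x \<Longrightarrow> snd E < snd (\<phi> x) \<or> snd E = snd (\<phi> x) \<and> fst E \<le> fst (\<phi> x)"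
    by (metis empty_iff)
  have in_T: "D \<in> T (fst z)" "\<bar>snd z\<bar> \<le> snd D" if "D \<in> S" "in_disk \<infinity> D z" for D z
    using that by (auto simp: T_def in_disk_def lp_dist_axis_infinity)
  have mono: "fst (\<phi> x) \<le> fst (\<phi> y)" if "T x \<noteq> {}" "T y \<noteq> {}" "x \<le> y" for x y
  proof (rule ccontr)
    assume less: "\<not> fst (\<phi> x) \<le> fst (\<phi> y)"
    have T: "\<phi> x \<in> T x" "\<phi> y \<in> T y" using phi(1) that by auto
    show False
    proof (cases "snd (\<phi> y) \<le> snd (\<phi> x)")
      case True
      then have "\<phi> x \<in> T y" using T less that by (auto simp: T_def abs_le_iff)
      then show False using phi(2)[of "\<phi> x" y] True less by auto
    next
      case False
      then have "\<phi> y \<in> T x" using T less that by (auto simp: T_def abs_le_iff)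
      then show False using phi(2)[of "\<phi> y" x] False by auto
    qed
  qed
  have eq: "snd (\<phi> x) \<le> snd (\<phi> y)" if "T x \<noteq> {}" "T y \<noteq> {}" "fst (\<phi> x) = fst (\<phi> y)" for x y
  proof (rule ccontr)
    assume less: "\<not> snd (\<phi> x) \<le> snd (\<phi> y)"
    have "\<phi> x \<in> T x" "\<phi> y \<in> T y" using phi(1) that by auto
    then have "\<phi> x \<in> T y" using less that by (auto simp: T_def)
    then show False using phi(2)[of "\<phi> x" y] less by auto
  qed
  have "\<phi> (fst z) \<in> S \<and> in_disk \<infinity> (\<phi> (fst z)) z" if "D \<in> S" "in_disk \<infinity> D z" for D z
  proof -
    have "\<phi> (fst z) \<in> T (fst z)" using phi(1) in_T(1)[OF that] by blast
    moreover have "snd D \<le> snd (\<phi> (fst z))" using phi(2)[OF in_T(1)[OF that]] by linarith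
    ultimately show ?thesis
      using in_T(2)[OF that] by (simp add: T_def in_disk_def lp_dist_axis_infinity)
  qed
  then have in_disk: "\<phi> (fst z) \<in> S \<and> in_disk \<infinity> (\<phi> (fst z)) z" if "\<exists>D\<in>S. in_disk \<infinity> D z" for z
    using that by blast
  have ne: "T (fst z) \<noteq> {}" if "\<exists>D\<in>S. in_disk \<infinity> D z" for z using in_T(1) that by blast
  have "\<phi> x = \<phi> y" if "T x \<noteq> {}" "T y \<noteq> {}" "fst (\<phi> x) = fst (\<phi> y)" for x y
    using eq[OF that] eq[OF that(2,1) that(3)[symmetric]] that(3) by (simp add: prod_eq_iff)
  then show ?thesis
    using mono in_disk ne by (intro exI[of _ \<phi>] allI impI conjI) simp_all
qed

text \<open>Under a monotone assignment the points sent to the same disk as the last one form a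
  suffix, and all earlier points go to other members of the list. The last run and one disk can thus
  be split off together, which is the recursion of the dynamic program.\<close>

lemma last_disk:
  assumes q: "1 \<le> q" and sorted: "\<And>s t. s \<le> t \<Longrightarrow> t \<le> j \<Longrightarrow> fst (Q s) \<le> fst (Q t)"
    and cov: "covers q Es (Q ` {..<Suc j})"
  shows "\<exists>D\<in>set Es. \<exists>i\<le>j. (\<forall>z\<in>Q ` {i..j}. in_disk q D z) \<and> covers q (remove1 D Es) (Q ` {..<i})"
proof -
  have Q: "\<exists>D\<in>set Es. in_disk q D (Q t)" if "t \<le> j" for t using cov that by (auto simp: covers_def)
  have ne: "set Es \<noteq> {}" using Q[of 0] by auto
  obtain \<phi> where phi: "\<And>t. t \<le> j \<Longrightarrow> \<phi> (fst (Q t)) \<in> set Es \<and> in_disk q (\<phi> (fst (Q t))) (Q t)"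
     "\<And>s t. s \<le> t \<Longrightarrow> t \<le> j \<Longrightarrow> fst (\<phi> (fst (Q s))) \<le> fst (\<phi> (fst (Q t)))"
     "\<And>s t. s \<le> j \<Longrightarrow> t \<le> j \<Longrightarrow> fst (\<phi> (fst (Q s))) = fst (\<phi> (fst (Q t))) \<Longrightarrow> \<phi> (fst (Q s)) = \<phi> (fst (Q t))"
  proof (cases "q = \<infinity>")
    case True
    from monotone_assignment_infinity[OF finite_set, of Es] obtain \<phi> where \<phi>:
      "\<And>z w. (\<exists>D\<in>set Es. in_disk q D z) \<Longrightarrow> (\<exists>D\<in>set Es. in_disk q D w) \<Longrightarrow>
        \<phi> (fst z) \<in> set Es \<and> in_disk q (\<phi> (fst z)) z \<and> (fst z \<le> fst w \<longrightarrow> fst (\<phi> (fst z)) \<le> fst (\<phi> (fst w))) \<and>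
        (fst (\<phi> (fst z)) = fst (\<phi> (fst w)) \<longrightarrow> \<phi> (fst z) = \<phi> (fst w))"
      unfolding True by blast
    show thesis
      using \<phi>[OF Q Q] sorted by (intro that[of \<phi>]) auto
  next
    case False
    have "\<And>D. D \<in> set Es \<Longrightarrow> 0 \<le> snd D" using cov by (auto simp: covers_def)
    from monotone_assignment_finite[OF q False finite_set ne this] obtain \<phi> where
      "\<And>z. (\<exists>D\<in>set Es. in_disk q D z) \<Longrightarrow> \<phi> (fst z) \<in> set Es \<and> in_disk q (\<phi> (fst z)) z"
      "\<And>x y. x \<le> y \<Longrightarrow> fst (\<phi> x) \<le> fst (\<phi> y)"
      "\<And>x y. fst (\<phi> x) = fst (\<phi> y) \<Longrightarrow> \<phi> x = \<phi> y" by blast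
    then show thesis using that[of \<phi>] Q sorted by blast
  qed
  define f where "f t = \<phi> (fst (Q t))" for t
  define i where "i = (LEAST i. f i = f j)"
  have i: "f i = f j" "i \<le> j" unfolding i_def by (auto intro: LeastI Least_le)
  have lt: "f t \<noteq> f j" if "t < i" for t using that not_less_Least unfolding i_def by blast
  have suf: "f t = f j" if "i \<le> t" "t \<le> j" for t
  proof -
    have "fst (f i) \<le> fst (f t)" "fst (f t) \<le> fst (f j)"
      using phi(2)[of i t] phi(2)[of t j] that i unfolding f_def by auto
    then have "fst (f t) = fst (f j)" using i by simp
    then show ?thesis unfolding f_def using phi(3)[of t j] that by simp
  qed
  have "in_disk q (f j) (Q t)" if "i \<le> t" "t \<le> j" for t
    using phi(1)[OF that(2)] suf[OF that] by (simp add: f_def)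
  then have "\<forall>z\<in>Q ` {i..j}. in_disk q (f j) z" by auto
  moreover have "covers q (remove1 (f j) Es) (Q ` {..<i})"
  proof -
    \<comment> \<open>The disk of a point before \<open>i\<close> differs from \<open>f j\<close>
      and survives the removal of one copy of \<open>f j\<close>.\<close>
    have "f t \<in> set (remove1 (f j) Es) \<and> in_disk q (f t) (Q t)" if "t < i" for t
      using lt[OF that] phi(1)[of t] that i by (simp add: f_def in_set_remove1)
    moreover have "\<forall>D\<in>set (remove1 (f j) Es). 0 \<le> snd D"
      using cov set_remove1_subset[of "f j" Es] unfolding covers_def by blast
    ultimately show ?thesis unfolding covers_def by blast
  qed
  ultimately show ?thesis using phi(1)[of j] i(2) unfolding f_def by blast
qed

section \<open>Dynamic programming over runs\<close>

lemma cover_cost_nonneg: "0 \<le> cover_cost \<alpha> Es"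
  by (auto simp: cover_cost_def intro!: sum_list_nonneg)

lemma cover_cost_Cons: "cover_cost \<alpha> (D # Es) = snd D powr \<alpha> + cover_cost \<alpha> Es"
  by (simp add: cover_cost_def)

lemma cover_cost_remove1:
  "D \<in> set Es \<Longrightarrow> cover_cost \<alpha> Es = snd D powr \<alpha> + cover_cost \<alpha> (remove1 D Es)"
  by (simp add: cover_cost_def sum_list_map_remove1)

lemma optimal_k_cover_same_cost:
  assumes "optimal_k_cover q \<alpha> k P Ds" "optimal_k_cover q \<alpha> k P Es"
  shows "cover_cost \<alpha> Ds = cover_cost \<alpha> Es"
  using assms by (auto simp: optimal_k_cover_def intro!: order_antisym)

text \<open>In the tables, level \<open>l\<close> stands for \<open>l + 1\<close> disks and column \<open>j\<close> for the points \<open>0, \<dots>, j\<close>;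
  \<open>dp_value V l i\<close> is the cost of covering the first \<open>i\<close> points.\<close>

definition dp_value :: "(nat \<Rightarrow> nat \<Rightarrow> real) \<Rightarrow> nat \<Rightarrow> nat \<Rightarrow> real" where
  "dp_value V l i = (if i = 0 then 0 else V l (i - 1))"

text \<open>The claim is made for every optimal rest \<open>Ds\<close> of exactly \<open>l\<close>
  disks, the form that backtracking uses. The second conjunct provides such a rest, so that
  \<open>V l j\<close> is known to be the optimal cost.\<close>

lemma dp_correct:
  fixes Q :: "nat \<Rightarrow> real \<times> real" and T :: "nat \<Rightarrow> nat \<Rightarrow> disk" and V :: "nat \<Rightarrow> nat \<Rightarrow> real" and ch :: "nat \<Rightarrow> nat \<Rightarrow> nat"
  assumes q: "1 \<le> q" and \<alpha>: "1 \<le> \<alpha>"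
    and sorted: "\<And>s t. s \<le> t \<Longrightarrow> t < n \<Longrightarrow> fst (Q s) \<le> fst (Q t)"
    and T: "\<And>i j. i \<le> j \<Longrightarrow> j < n \<Longrightarrow> min_cover q (Q ` {i..j}) (T i j)"
    and base: "\<And>j. j < n \<Longrightarrow> ch 0 j = 0" "\<And>j. j < n \<Longrightarrow> V 0 j = snd (T 0 j) powr \<alpha>"
    and step: "\<And>l j. l < m \<Longrightarrow> j < n \<Longrightarrow> ch (Suc l) j \<le> j"
      "\<And>l j. l < m \<Longrightarrow> j < n \<Longrightarrow> V (Suc l) j = dp_value V l (ch (Suc l) j) + snd (T (ch (Suc l) j) j) powr \<alpha>"
      "\<And>l i j. l < m \<Longrightarrow> j < n \<Longrightarrow> i \<le> j \<Longrightarrow> V (Suc l) j \<le> dp_value V l i + snd (T i j) powr \<alpha>"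
  shows "l \<le> m \<Longrightarrow> j < n \<Longrightarrow>
    (\<forall>Ds. length Ds = l \<longrightarrow> optimal_k_cover q \<alpha> l (Q ` {..<ch l j}) Ds \<longrightarrow>
       optimal_k_cover q \<alpha> (Suc l) (Q ` {..<Suc j}) (T (ch l j) j # Ds) \<and>
       cover_cost \<alpha> (T (ch l j) j # Ds) = V l j) \<and>
    (\<exists>Ds. length Ds = l \<and> optimal_k_cover q \<alpha> l (Q ` {..<ch l j}) Ds)"
proof (induction l arbitrary: j)
  have extend: "optimal_k_cover q \<alpha> (Suc l) (Q ` {..<Suc j}) (T i j # Ds) \<and> cover_cost \<alpha> (T i j # Ds) = v"
    if "l \<le> m" "j < n" "i \<le> j" "length Ds = l" "covers q Ds (Q ` {..<i})" "v = cover_cost \<alpha> Ds + snd (T i j) powr \<alpha>"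
      and le: "\<And>i' Es. i' \<le> j \<Longrightarrow> length Es \<le> l \<Longrightarrow> covers q Es (Q ` {..<i'}) \<Longrightarrow>
         v \<le> cover_cost \<alpha> Es + snd (T i' j) powr \<alpha>"
    for l j i Ds v
  proof -
    have mc: "min_cover q (Q ` {i..j}) (T i j)" using T that by simp
    have "{..<Suc j} = {..<i} \<union> {i..j}" using that by auto
    then have "Q ` {..<Suc j} = Q ` {..<i} \<union> Q ` {i..j}" by (simp add: image_Un)
    then have "covers q (T i j # Ds) (Q ` {..<Suc j})"
      using mc that(5) by (auto simp: covers_def min_cover_def)
    moreover have "cover_cost \<alpha> (T i j # Ds) = v" using that by (simp add: cover_cost_Cons)
    moreover have "v \<le> cover_cost \<alpha> Es" if Es: "length Es \<le> Suc l" "covers q Es (Q ` {..<Suc j})" for Es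
    proof -
      \<comment> \<open>An arbitrary competitor is split at its last run; the smallest disk of that
        run costs no more than the disk removed.\<close>
      obtain D i' where D: "D \<in> set Es" "i' \<le> j" "\<forall>z\<in>Q ` {i'..j}. in_disk q D z"
          "covers q (remove1 D Es) (Q ` {..<i'})"
        using last_disk[OF q _ Es(2)] sorted \<open>j < n\<close> by (meson le_less_trans)
      have "0 \<le> snd (T i' j)" "snd (T i' j) \<le> snd D"
        using T[OF D(2) \<open>j < n\<close>] D(3) unfolding min_cover_def by blast+
      then have "snd (T i' j) powr \<alpha> \<le> snd D powr \<alpha>"
        using \<alpha> by (intro powr_mono2) auto
      moreover have "v \<le> cover_cost \<alpha> (remove1 D Es) + snd (T i' j) powr \<alpha>"
        using D Es(1) by (intro le) (auto simp: length_remove1)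
      ultimately show ?thesis using cover_cost_remove1[OF D(1), of \<alpha>] by linarith
    qed
    ultimately show ?thesis using that(4) by (auto simp: optimal_k_cover_def)
  qed
  {
    case 0
    have "optimal_k_cover q \<alpha> (Suc 0) (Q ` {..<Suc j}) (T 0 j # Ds) \<and> cover_cost \<alpha> (T 0 j # Ds) = V 0 j" if "Ds = []" for Ds
    proof (rule extend)
      fix i' :: nat and Es :: "disk list"
      assume "length Es \<le> 0" "covers q Es (Q ` {..<i'})"
      \<comment> \<open>Without disks only the empty prefix is covered, so on level 0 the run has to
        start at point 0.\<close>
      then have "i' = 0" by (auto simp: covers_def)
      then show "V 0 j \<le> cover_cost \<alpha> Es + snd (T i' j) powr \<alpha>"
        using base(2)[OF 0(2)] cover_cost_nonneg[of \<alpha> Es] by simp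
    qed (use that base(2)[OF 0(2)] 0 in \<open>auto simp: covers_def cover_cost_def\<close>)
    moreover have "optimal_k_cover q \<alpha> 0 {} []"
      by (simp add: optimal_k_cover_def covers_def)
    ultimately show ?case using base(1)[OF 0(2)] by simp
  next
    case (Suc l)
    have lm: "l < m" "l \<le> m" using Suc.prems by auto
    have opt: "\<exists>Ds. length Ds = Suc l \<and> optimal_k_cover q \<alpha> (Suc l) (Q ` {..<i}) Ds \<and> cover_cost \<alpha> Ds = dp_value V l i"
      if "i \<le> j" for i
    proof (cases i)
      case 0
      \<comment> \<open>The empty prefix is covered by padding alone, at cost
        \<open>0 powr \<alpha> = 0\<close> per disk.\<close>
      have "optimal_k_cover q \<alpha> (Suc l) {} (replicate (Suc l) (0, 0))" "cover_cost \<alpha> (replicate (Suc l) (0, 0)) = 0"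
        using cover_cost_nonneg[of \<alpha>]
        by (auto simp: optimal_k_cover_def covers_def cover_cost_def sum_list_replicate simp del: replicate.simps)
      with 0 show ?thesis by (intro exI[of _ "replicate (Suc l) (0, 0)"]) (simp add: dp_value_def del: replicate.simps)
    next
      case (Suc i')
      then have "i' < n" using that Suc.prems by simp
      from Suc.IH[OF lm(2) this] obtain Ds where Ds: "length Ds = l" "optimal_k_cover q \<alpha> l (Q ` {..<ch l i'}) Ds" by blast
      then show ?thesis
        using Suc.IH[OF lm(2) \<open>i' < n\<close>] \<open>i = Suc i'\<close> by (intro exI[of _ "T (ch l i') i' # Ds"]) (simp add: dp_value_def)
    qed
    define i where "i = ch (Suc l) j"
    have i: "i \<le> j" using step(1)[OF lm(1) Suc.prems(2)] by (simp add: i_def)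
    have "optimal_k_cover q \<alpha> (Suc (Suc l)) (Q ` {..<Suc j}) (T i j # Ds) \<and> cover_cost \<alpha> (T i j # Ds) = V (Suc l) j"
      if Ds: "length Ds = Suc l" "optimal_k_cover q \<alpha> (Suc l) (Q ` {..<i}) Ds" for Ds
    proof (rule extend)
      have "cover_cost \<alpha> Ds = dp_value V l i"
        using opt[OF i] optimal_k_cover_same_cost[OF Ds(2)] by auto
      then show "V (Suc l) j = cover_cost \<alpha> Ds + snd (T i j) powr \<alpha>"
        using step(2)[OF lm(1) Suc.prems(2)] by (simp add: i_def)
      show "covers q Ds (Q ` {..<i})" using Ds by (simp add: optimal_k_cover_def)
      fix i' :: nat and Es :: "disk list"
      assume Es: "i' \<le> j" "length Es \<le> Suc l" "covers q Es (Q ` {..<i'})"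
      then have "dp_value V l i' \<le> cover_cost \<alpha> Es" using opt[OF Es(1)] by (auto simp: optimal_k_cover_def)
      then show "V (Suc l) j \<le> cover_cost \<alpha> Es + snd (T i' j) powr \<alpha>"
        using step(3)[OF lm(1) Suc.prems(2) Es(1)] by linarith
    qed (use Suc.prems i Ds in auto)
    then show ?case using opt[OF i] unfolding i_def by blast
  }
qed

section \<open>Reading and sorting the points\<close>

lemma high_addr_ge: "4 * ((n + 2) * (n + 2)) \<le> high_addr n r a b c"
  by (simp add: high_addr_def)

lemma high_addr_not_small [simp]: "m < 16 \<Longrightarrow> high_addr n r a b c \<noteq> m" "m < 16 \<Longrightarrow> m \<noteq> high_addr n r a b c"
  using high_addr_ge[of n r a b c] by auto

lemma low_addr_less_high_addr:
  assumes "a \<le> n" "b \<le> n" "\<beta> < 2"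
  shows "low_addr n \<beta> a b < high_addr n r x y z"
proof -
  have "a * (n + 1) \<le> n * (n + 1)" using assms by (intro mult_le_mono) auto
  then have "low_addr n \<beta> a b < 4 * ((n + 2) * (n + 2))" using assms by (simp add: low_addr_def)
  then show ?thesis using high_addr_ge[of n r x y z] by linarith
qed

lemma low_addr_neq_high_addr [simp]:
  assumes "a \<le> n" "b \<le> n" "\<beta> < 2"
  shows "low_addr n \<beta> a b \<noteq> high_addr n r x y z" "high_addr n r x y z \<noteq> low_addr n \<beta> a b"
  using low_addr_less_high_addr[OF assms, of r x y z] by auto

lemma low_addr_inject [simp]:
  assumes "b \<le> n" "b' \<le> n" "\<beta> < 2" "\<beta>' < 2"
  shows "low_addr n \<beta> a b = low_addr n \<beta>' a' b' \<longleftrightarrow> \<beta> = \<beta>' \<and> a = a' \<and> b = b'"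
proof
  assume eq: "low_addr n \<beta> a b = low_addr n \<beta>' a' b'"
  then have "low_addr n \<beta> a b mod 2 = low_addr n \<beta>' a' b' mod 2" by simp
  then have \<beta>: "\<beta> = \<beta>'" using assms by (simp only: low_addr_def mod_mult_self4 mod_less)
  then have q: "a * (n + 1) + b = a' * (n + 1) + b'"
    using eq unfolding low_addr_def by (metis add_right_cancel mult_left_cancel zero_neq_numeral)
  then have "(a * (n + 1) + b) div (n + 1) = (a' * (n + 1) + b') div (n + 1)" by simp
  then have "a = a'" using assms by (simp only: div_mult_self3 div_less)
  then show "\<beta> = \<beta>' \<and> a = a' \<and> b = b'" using \<beta> q by simp
qed simp

text \<open>Output rows start at row 1, beyond the four scratch real registers; the input in row 0
  does overlap them.\<close>

lemma low_addr_not_small [simp]: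
  assumes "1 \<le> n" "m < 4"
  shows "low_addr n \<beta> (Suc a) b \<noteq> m" "m \<noteq> low_addr n \<beta> (Suc a) b"
  using assms by (auto simp: low_addr_def)

lemma fold_upt_invariant:
  assumes "P l s" "\<And>i s. l \<le> i \<Longrightarrow> i < h \<Longrightarrow> P i s \<Longrightarrow> P (Suc i) (f i s)" "l \<le> h"
  shows "P h (fold f [l..<h] s)"
  using assms(3,1,2)
proof (induction h rule: dec_induct)
  case (step m)
  have "P m (fold f [l..<m] s)" using step by auto
  then show ?case using step by (auto intro: step.prems)
qed simp

text \<open>Register 1 holds 0, so nothing is subtracted; \<open>Cur 1\<close> is the index 0 and
  \<open>Cur 0\<close> is \<open>n\<close>.\<close>

abbreviation Cur :: "nat \<Rightarrow> ix" where
  "Cur v \<equiv> Ix v 0 1"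

abbreviation Nxt :: "nat \<Rightarrow> ix" where
  "Nxt v \<equiv> Ix v 1 1"

text \<open>Names of arrays: 0 and 1 hold the coordinates; 2, 3 and 4 the centres, radii and costs
  of the disks of runs; 5 the optimal values, 6 and 7 the last disks, 8 the starts of the last runs;
  9, 10 and 11 are single cells.\<close>

definition points :: "nat \<Rightarrow> (nat \<Rightarrow> real) \<Rightarrow> nat \<Rightarrow> real \<times> real" where
  "points n R i = (R (high_addr n 0 i 0 0), R (high_addr n 1 i 0 0))"

definition mark_cmd :: cmd where
  "mark_cmd = For 2 (Cur 1) (Cur 0) (Mark (Cur 2))"

text \<open>The first two points lie in the real registers 0 to 3, which serve as scratch, so they
  are saved before the loop overwrites register 0. For fewer than two points these copies fill
  entries beyond the range of \<open>n\<close>.\<close>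

definition read_cmd :: cmd where
  "read_cmd = Put 0 (Hi 0 (Cur 1) (Cur 1) (Cur 1)) ;;; Put 1 (Hi 1 (Cur 1) (Cur 1) (Cur 1)) ;;;
     Put 2 (Hi 0 (Nxt 1) (Cur 1) (Cur 1)) ;;; Put 3 (Hi 1 (Nxt 1) (Cur 1) (Cur 1)) ;;;
     For 2 (Ix 1 2 1) (Cur 0)
       (Get 0 (Lo 0 (Cur 1) (Cur 2)) ;;; Put 0 (Hi 0 (Cur 2) (Cur 1) (Cur 1)) ;;;
        Get 0 (Lo 1 (Cur 1) (Cur 2)) ;;; Put 0 (Hi 1 (Cur 2) (Cur 1) (Cur 1)))"

definition swap_cmd :: cmd where
  "swap_cmd = Get 0 (Hi 0 (Cur 2) (Cur 1) (Cur 1)) ;;; Get 1 (Hi 0 (Cur 3) (Cur 1) (Cur 1)) ;;;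
     Cond 1 0
       (Put 1 (Hi 0 (Cur 2) (Cur 1) (Cur 1)) ;;; Put 0 (Hi 0 (Cur 3) (Cur 1) (Cur 1)) ;;;
        Get 0 (Hi 1 (Cur 2) (Cur 1) (Cur 1)) ;;; Get 1 (Hi 1 (Cur 3) (Cur 1) (Cur 1)) ;;;
        Put 1 (Hi 1 (Cur 2) (Cur 1) (Cur 1)) ;;; Put 0 (Hi 1 (Cur 3) (Cur 1) (Cur 1)))
       Skip"

text \<open>Exchange sort; its quadratic time is dominated by the cubic tables.\<close>

definition sort_cmd :: cmd where
  "sort_cmd = For 2 (Cur 1) (Cur 0) (For 3 (Nxt 2) (Cur 0) swap_cmd)"

context
  fixes q :: ereal and \<alpha> :: real and n :: nat and e :: "nat \<Rightarrow> nat"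
  assumes e: "e 0 = n" "e (Suc 0) = 0"
begin

lemma read_correct:
  assumes R: "\<And>i. i < 2 * n \<Longrightarrow> R i = (if even i then fst (P ! (i div 2)) else snd (P ! (i div 2)))"
  shows "\<forall>i<n. points n (denote q \<alpha> read_cmd e R) i = P ! i"
proof (cases "n < 2")
  case True
  then show ?thesis using R[of 0] R[of 1]
    by (cases n) (auto simp: read_cmd_def e points_def)
next
  case False
  define c where "c = Get 0 (Lo 0 (Cur 1) (Cur 2)) ;;; Put 0 (Hi 0 (Cur 2) (Cur 1) (Cur 1)) ;;;
        Get 0 (Lo 1 (Cur 1) (Cur 2)) ;;; Put 0 (Hi 1 (Cur 2) (Cur 1) (Cur 1))"
  define R0 where "R0 = R(high_addr n 0 0 0 0 := R 0, high_addr n 1 0 0 0 := R 1, high_addr n 0 1 0 0 := R 2, high_addr n 1 1 0 0 := R 3)"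
  \<comment> \<open>The loop uses register 0, so only input cells from 4 on are claimed to be
    intact; points 0 and 1 are stored already.\<close>
  let ?P = "\<lambda>m R'. (\<forall>i. 4 \<le> i \<and> i < 2 * n \<longrightarrow> R' i = R i) \<and> (\<forall>i<m. points n R' i = P ! i)"
  have small: "high_addr n r a b c \<noteq> i" if "i < 2 * n" for i r a b c
    using high_addr_ge[of n r a b c] that by (auto simp: algebra_simps)
  have P01: "R 0 = fst (P ! 0)" "R (Suc 0) = snd (P ! 0)" "R 2 = fst (P ! 1)" "R 3 = snd (P ! 1)"
    using R[of 0] R[of "Suc 0"] R[of 2] R[of 3] False by auto
  have "?P n (fold (\<lambda>i. denote q \<alpha> c (e(2 := i))) [2..<n] R0)"
  proof (rule fold_upt_invariant[where P = ?P])
    have "points n R0 i = P ! i" if "i < 2" for i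
      using that P01 by (cases i) (auto simp: points_def R0_def)
    then show "?P 2 R0" using small[symmetric] by (auto simp: R0_def)
  next
    fix m R' assume m: "2 \<le> m" "m < n" and inv: "?P m R'"
    have "R' (2 * m) = fst (P ! m)" "R' (Suc (2 * m)) = snd (P ! m)"
      using inv R[of "2 * m"] R[of "Suc (2 * m)"] m by auto
    moreover have "low_addr n 0 0 m = 2 * m" "low_addr n (Suc 0) 0 m = Suc (2 * m)" by (auto simp: low_addr_def)
    moreover have "2 * m < 2 * n" "Suc (2 * m) < 2 * n" "0 < m" using m by auto
    ultimately show "?P (Suc m) (denote q \<alpha> c (e(2 := m)) R')"
      using inv small[symmetric] m(1) by (auto simp: c_def e points_def less_Suc_eq)
  qed (use False in simp)
  moreover have "denote q \<alpha> read_cmd e R = fold (\<lambda>i. denote q \<alpha> c (e(2 := i))) [2..<n] R0"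
    by (simp add: read_cmd_def c_def R0_def e numeral_2_eq_2[symmetric])
  ultimately show ?thesis by simp
qed

lemma swap_correct:
  assumes "i \<noteq> j"
  shows "points n (denote q \<alpha> swap_cmd (e(2 := i, 3 := j)) R) =
    (if fst (points n R j) < fst (points n R i) then (points n R)(i := points n R j, j := points n R i) else points n R)"
  using assms by (auto simp: swap_cmd_def e points_def fun_eq_iff)

lemma sort_correct:
  fixes R :: "nat \<Rightarrow> real"
  defines "Q \<equiv> points n (denote q \<alpha> sort_cmd e R)"
  shows "Q ` {..<n} = points n R ` {..<n}" "s \<le> t \<Longrightarrow> t < n \<Longrightarrow> fst (Q s) \<le> fst (Q t)"
proof -
  define A where "A = points n R ` {..<n}"
  \<comment> \<open>Positions below \<open>i\<close> are in order with everything behind them;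
    \<open>?J\<close> adds that position \<open>i\<close> is minimal among those seen so
    far.\<close>
  let ?I = "\<lambda>i R. points n R ` {..<n} = A \<and> (\<forall>s<i. \<forall>t. s \<le> t \<and> t < n \<longrightarrow> fst (points n R s) \<le> fst (points n R t))"
  let ?J = "\<lambda>i j R. ?I i R \<and> (\<forall>t. i \<le> t \<and> t < j \<longrightarrow> fst (points n R i) \<le> fst (points n R t))"
  have inner: "?J i (Suc j) (denote q \<alpha> swap_cmd (e(2 := i, 3 := j)) R)" if "i < j" "j < n" "?J i j R" for i j R
  proof (cases "fst (points n R j) < fst (points n R i)")
    case False
    then show ?thesis using that by (auto simp: swap_correct less_Suc_eq)
  next
    case True
    let ?f = "(points n R)(i := points n R j, j := points n R i)"
    have f: "points n (denote q \<alpha> swap_cmd (e(2 := i, 3 := j)) R) = ?f" using that True by (simp add: swap_correct)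
    have "?f ` {..<n} = points n R ` {..<n}"
    proof -
      have "?f = points n R \<circ> (id(i := j, j := i))" by (auto simp: fun_eq_iff)
      moreover have "(id(i := j, j := i)) ` {..<n} = {..<n}" using that(1,2) by (auto simp: image_iff)
      ultimately show ?thesis by (metis image_comp)
    qed
    moreover have "fst (?f s) \<le> fst (?f t)" if "s < i" "s \<le> t" "t < n" for s t
      using that \<open>?J i j R\<close> \<open>i < j\<close> \<open>j < n\<close> by (auto simp: fun_upd_def)
    moreover have "fst (?f i) \<le> fst (?f t)" if "i \<le> t" "t < Suc j" for t
    proof -
      have "t = i \<or> t = j \<or> i < t \<and> t < j" using that by auto
      then show ?thesis
        using True \<open>?J i j R\<close> \<open>i < j\<close> by (auto intro: less_imp_le order_trans[OF less_imp_le[OF True]])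
    qed
    ultimately show ?thesis unfolding f using \<open>?J i j R\<close> by auto
  qed
  have "?I n (fold (\<lambda>i. denote q \<alpha> (For 3 (Nxt 2) (Cur 0) swap_cmd) (e(2 := i))) [0..<n] R)"
  proof (rule fold_upt_invariant[where P = ?I])
    show "?I 0 R" by (simp add: A_def)
    fix i R assume i: "i < n" and I: "?I i R"
    have "?J i n (fold (\<lambda>j. denote q \<alpha> swap_cmd (e(2 := i, 3 := j))) [Suc i..<n] R)"
    proof (rule fold_upt_invariant[where P = "?J i"])
      show "?J i (Suc i) R" using I by (auto simp: less_Suc_eq le_less)
    qed (use inner i in auto)
    then show "?I (Suc i) (denote q \<alpha> (For 3 (Nxt 2) (Cur 0) swap_cmd) (e(2 := i)) R)"
      by (auto simp: e less_Suc_eq)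
  qed simp
  moreover have "denote q \<alpha> sort_cmd e R = fold (\<lambda>i. denote q \<alpha> (For 3 (Nxt 2) (Cur 0) swap_cmd) (e(2 := i))) [0..<n] R"
    by (simp add: sort_cmd_def e)
  ultimately show "Q ` {..<n} = points n R ` {..<n}" "s \<le> t \<Longrightarrow> t < n \<Longrightarrow> fst (Q s) \<le> fst (Q t)"
    unfolding Q_def A_def by auto
qed

end

section \<open>The table of smallest disks\<close>

definition pair_cmd :: cmd where
  "pair_cmd = Get 0 (Hi 0 (Cur 4) (Cur 1) (Cur 1)) ;;; Get 1 (Hi 1 (Cur 4) (Cur 1) (Cur 1)) ;;;
     Get 2 (Hi 0 (Cur 3) (Cur 1) (Cur 1)) ;;; Get 3 (Hi 1 (Cur 3) (Cur 1) (Cur 1)) ;;;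
     RI (PMinDisk 0 1 0 1 2 3) ;;; Get 2 (Hi 10 (Cur 1) (Cur 1) (Cur 1)) ;;;
     Cond 2 1 (Put 0 (Hi 9 (Cur 1) (Cur 1) (Cur 1)) ;;; Put 1 (Hi 10 (Cur 1) (Cur 1) (Cur 1))) Skip"

definition record_cmd :: "ereal \<Rightarrow> cmd" where
  "record_cmd q = Get 0 (Hi 9 (Cur 1) (Cur 1) (Cur 1)) ;;; Get 1 (Hi 10 (Cur 1) (Cur 1) (Cur 1)) ;;;
     (if q = \<infinity> then
        Get 0 (Hi 0 (Cur 2) (Cur 1) (Cur 1)) ;;; Get 2 (Hi 0 (Cur 3) (Cur 1) (Cur 1)) ;;;
        RI (RAdd 0 0 2) ;;; RI (RConst 2 2) ;;; RI (RDiv 0 0 2)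
      else Skip) ;;;
     Put 0 (Hi 2 (Cur 2) (Cur 3) (Cur 1)) ;;; Put 1 (Hi 3 (Cur 2) (Cur 3) (Cur 1)) ;;;
     RI (PPow 1 1) ;;; Put 1 (Hi 4 (Cur 2) (Cur 3) (Cur 1))"

text \<open>The arrays 9 and 10 hold the disk of the pair with the largest radius seen so far; for \<open>p = \<infinity>\<close> its
  centre is not unique and has to be replaced by the middle of the run.\<close>

definition disks_cmd :: "ereal \<Rightarrow> cmd" where
  "disks_cmd q = For 2 (Cur 1) (Cur 0)
     (RI (RConst 0 (-1)) ;;; Put 0 (Hi 10 (Cur 1) (Cur 1) (Cur 1)) ;;;
      For 3 (Cur 2) (Cur 0) (For 4 (Cur 2) (Nxt 3) pair_cmd ;;; record_cmd q))"

definition disk_table :: "nat \<Rightarrow> (nat \<Rightarrow> real) \<Rightarrow> nat \<Rightarrow> nat \<Rightarrow> disk" where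
  "disk_table n R i j = (R (high_addr n 2 i j 0), R (high_addr n 3 i j 0))"

definition weight_table :: "nat \<Rightarrow> (nat \<Rightarrow> real) \<Rightarrow> nat \<Rightarrow> nat \<Rightarrow> real" where
  "weight_table n R i j = R (high_addr n 4 i j 0)"

text \<open>The radius -1 stands for no pair at all: it is below every radius, so the first pair
  always replaces it.\<close>

definition best_pair :: "ereal \<Rightarrow> (nat \<Rightarrow> real \<times> real) \<Rightarrow> (nat \<times> nat) set \<Rightarrow> disk \<Rightarrow> bool" where
  "best_pair q Q A D \<longleftrightarrow> (if A = {} then snd D = -1
     else (\<exists>(s, t)\<in>A. D = min_disk2 q (Q s) (Q t)) \<and> (\<forall>(s, t)\<in>A. snd (min_disk2 q (Q s) (Q t)) \<le> snd D))"

lemma best_pair_insert: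
  assumes "1 \<le> q" "best_pair q Q A D"
  shows "best_pair q Q (insert (s, t) A)
    (if snd D < snd (min_disk2 q (Q s) (Q t)) then min_disk2 q (Q s) (Q t) else D)"
proof (cases "A = {}")
  case True
  then show ?thesis using assms snd_min_disk2_nonneg[OF assms(1), of "Q s" "Q t"] by (auto simp: best_pair_def)
next
  case False
  let ?m = "min_disk2 q (Q s) (Q t)"
  have D: "\<exists>(s, t)\<in>A. D = min_disk2 q (Q s) (Q t)"
    and le: "\<And>s t. (s, t) \<in> A \<Longrightarrow> snd (min_disk2 q (Q s) (Q t)) \<le> snd D"
    using assms(2) False by (auto simp: best_pair_def)
  show ?thesis
  proof (cases "snd D < snd ?m")
    case True
    then have "snd (min_disk2 q (Q s') (Q t')) \<le> snd ?m" if "(s', t') \<in> A" for s' t'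
      using le[OF that] by linarith
    with True show ?thesis by (auto simp: best_pair_def)
  next
    case False
    with D le show ?thesis by (auto simp: best_pair_def not_less)
  qed
qed

text \<open>The program forms pairs in one order of the indices only. For the maximum over all pairs
  just the radii matter, while the chosen centres may depend on the order.\<close>

lemma snd_min_disk2_commute:
  assumes "1 \<le> q"
  shows "snd (min_disk2 q a b) = snd (min_disk2 q b a)"
proof -
  have "snd (min_disk2 q a b) \<le> snd (min_disk2 q b a)" for a b
    using min_disk2(2)[OF assms, of a b "fst (min_disk2 q b a)"] min_disk2(1)[OF assms, of b a]
    by (simp add: max.commute)
  then show ?thesis by (intro order_antisym)
qed

text \<open>In a sorted run the end points are the extreme ones, so for \<open>\<infinity>\<close>
  the middle between \<open>Q i\<close> and \<open>Q j\<close> is the centre asked for.\<close>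

lemma best_pair_min_cover:
  assumes q: "1 \<le> q" and ij: "i \<le> j"
    and sorted: "\<And>s t. s \<le> t \<Longrightarrow> t \<le> j \<Longrightarrow> fst (Q s) \<le> fst (Q t)"
    and best: "best_pair q Q {(s, t). i \<le> s \<and> s \<le> t \<and> t \<le> j} D"
  shows "min_cover q (Q ` {i..j}) (if q = \<infinity> then (fst (Q i) + fst (Q j)) / 2 else fst D, snd D)"
proof -
  have "{(s, t). i \<le> s \<and> s \<le> t \<and> t \<le> j} \<noteq> {}" using ij by auto
  with best have
    "\<exists>(s, t)\<in>{(s, t). i \<le> s \<and> s \<le> t \<and> t \<le> j}. D = min_disk2 q (Q s) (Q t)"
    "\<forall>(s, t)\<in>{(s, t). i \<le> s \<and> s \<le> t \<and> t \<le> j}. snd (min_disk2 q (Q s) (Q t)) \<le> snd D"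
    unfolding best_pair_def by meson+
  then obtain a b where ab: "i \<le> a" "a \<le> b" "b \<le> j" "D = min_disk2 q (Q a) (Q b)"
    and le: "\<And>s t. i \<le> s \<Longrightarrow> s \<le> t \<Longrightarrow> t \<le> j \<Longrightarrow> snd (min_disk2 q (Q s) (Q t)) \<le> snd D"
    by auto
  have max: "snd (min_disk2 q u v) \<le> snd (min_disk2 q (Q a) (Q b))" if "u \<in> Q ` {i..j}" "v \<in> Q ` {i..j}" for u v
  proof -
    obtain s t where st: "u = Q s" "v = Q t" "s \<in> {i..j}" "t \<in> {i..j}" using \<open>u \<in> _\<close> \<open>v \<in> _\<close> by blast
    then show ?thesis
      using le[of s t] le[of t s] snd_min_disk2_commute[OF q, of u v] ab(4) by (cases "s \<le> t") auto
  qed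
  have in_A: "Q a \<in> Q ` {i..j}" "Q b \<in> Q ` {i..j}" "Q i \<in> Q ` {i..j}" "Q j \<in> Q ` {i..j}" using ab ij by auto
  show ?thesis
  proof (cases "q = \<infinity>")
    case True
    have "fst (Q i) \<le> fst z \<and> fst z \<le> fst (Q j)" if "z \<in> Q ` {i..j}" for z using that sorted by auto
    then show ?thesis using min_cover_max_pair_infinity[OF in_A] max unfolding True ab(4) by simp
  next
    case False
    then show ?thesis using min_cover_max_pair_finite[OF q False in_A(1,2)] max unfolding ab(4) by simp
  qed
qed

definition good_entry :: "ereal \<Rightarrow> real \<Rightarrow> nat \<Rightarrow> (nat \<Rightarrow> real \<times> real) \<Rightarrow> (nat \<Rightarrow> real) \<Rightarrow> nat \<Rightarrow> nat \<Rightarrow> bool" where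
  "good_entry q \<alpha> n Q R i j \<longleftrightarrow>
     min_cover q (Q ` {i..j}) (disk_table n R i j) \<and> weight_table n R i j = snd (disk_table n R i j) powr \<alpha>"

context
  fixes q :: ereal and \<alpha> :: real and n :: nat and e :: "nat \<Rightarrow> nat"
  assumes e: "e 0 = n" "e (Suc 0) = 0"
begin

definition scratch :: "(nat \<Rightarrow> real) \<Rightarrow> disk" where
  "scratch R = (R (high_addr n 9 0 0 0), R (high_addr n 10 0 0 0))"

lemma pair_correct:
  fixes i j a :: nat and R :: "nat \<Rightarrow> real"
  defines "R' \<equiv> denote q \<alpha> pair_cmd (e(2 := i, 3 := j, 4 := a)) R"
  shows "points n R' = points n R" "disk_table n R' = disk_table n R" "weight_table n R' = weight_table n R"
    "scratch R' = (if snd (scratch R) < snd (min_disk2 q (points n R a) (points n R j))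
       then min_disk2 q (points n R a) (points n R j) else scratch R)"
  by (auto simp: R'_def pair_cmd_def e points_def disk_table_def weight_table_def scratch_def fun_eq_iff)

lemma record_correct:
  fixes i j :: nat and R :: "nat \<Rightarrow> real"
  defines "R' \<equiv> denote q \<alpha> (record_cmd q) (e(2 := i, 3 := j)) R"
  shows "points n R' = points n R" "scratch R' = scratch R"
    "disk_table n R' i' j' = (if i' = i \<and> j' = j then
       (if q = \<infinity> then (fst (points n R i) + fst (points n R j)) / 2 else fst (scratch R), snd (scratch R)) else disk_table n R i' j')"
    "weight_table n R' i' j' = (if i' = i \<and> j' = j then snd (scratch R) powr \<alpha> else weight_table n R i' j')"
  by (auto simp: R'_def record_cmd_def e points_def disk_table_def weight_table_def scratch_def fun_eq_iff)

text \<open>Enlarging a run by point \<open>j\<close> adds only the pairs \<open>(a, j)\<close> with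
  \<open>i \<le> a \<le> j\<close>, including \<open>a = j\<close>. The best pair is therefore
  carried along a row and each run takes linear time. The invariants \<open>?I\<close>,
  \<open>?J\<close> and \<open>?K\<close> belong to the loops over \<open>i\<close>,
  \<open>j\<close> and \<open>a\<close>.\<close>

lemma disks_correct:
  fixes R :: "nat \<Rightarrow> real"
  defines "Q \<equiv> points n R" and "R' \<equiv> denote q \<alpha> (disks_cmd q) e R"
  assumes q: "1 \<le> q" and sorted: "\<And>s t. s \<le> t \<Longrightarrow> t < n \<Longrightarrow> fst (Q s) \<le> fst (Q t)"
  shows "i \<le> j \<Longrightarrow> j < n \<Longrightarrow> good_entry q \<alpha> n Q R' i j"
proof -
  define row where "row = RI (RConst 0 (-1)) ;;; Put 0 (Hi 10 (Cur 1) (Cur 1) (Cur 1)) ;;;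
      For 3 (Cur 2) (Cur 0) (For 4 (Cur 2) (Nxt 3) pair_cmd ;;; record_cmd q)"
  define init where "init R = R(0 := -1, high_addr n 10 0 0 0 := -1)" for R :: "nat \<Rightarrow> real"
  let ?I = "\<lambda>i R. points n R = Q \<and> (\<forall>s<i. \<forall>t. s \<le> t \<and> t < n \<longrightarrow> good_entry q \<alpha> n Q R s t)"
  let ?J = "\<lambda>i j R. ?I i R \<and> (\<forall>t. i \<le> t \<and> t < j \<longrightarrow> good_entry q \<alpha> n Q R i t) \<and>
     best_pair q Q {(s, t). i \<le> s \<and> s \<le> t \<and> t < j} (scratch R)"
  let ?K = "\<lambda>i j a R. ?I i R \<and> (\<forall>t. i \<le> t \<and> t < j \<longrightarrow> good_entry q \<alpha> n Q R i t) \<and>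
     best_pair q Q ({(s, t). i \<le> s \<and> s \<le> t \<and> t < j} \<union> {i..<a} \<times> {j}) (scratch R)"
  have K: "?K i j (Suc a) (denote q \<alpha> pair_cmd (e(2 := i, 3 := j, 4 := a)) R)" if "i \<le> a" "?K i j a R" for i j a R
  proof -
    have "{(s, t). i \<le> s \<and> s \<le> t \<and> t < j} \<union> {i..<Suc a} \<times> {j} =
        insert (a, j) ({(s, t). i \<le> s \<and> s \<le> t \<and> t < j} \<union> {i..<a} \<times> {j})"
      using that(1) by (auto simp: less_Suc_eq)
    moreover have Q: "points n R = Q" using that(2) by simp
    moreover have "best_pair q Q (insert (a, j) ({(s, t). i \<le> s \<and> s \<le> t \<and> t < j} \<union> {i..<a} \<times> {j}))
        (scratch (denote q \<alpha> pair_cmd (e(2 := i, 3 := j, 4 := a)) R))"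
      unfolding pair_correct Q using that(2) by (intro best_pair_insert[OF q]) simp
    ultimately show ?thesis
      using that(2) by (simp add: good_entry_def pair_correct(1-3))
  qed
  have J: "?J i (Suc j) (denote q \<alpha> (For 4 (Cur 2) (Nxt 3) pair_cmd ;;; record_cmd q) (e(2 := i, 3 := j)) R)"
    if "i \<le> j" "j < n" "?J i j R" for i j R
  proof -
    define R1 where "R1 = fold (\<lambda>a. denote q \<alpha> pair_cmd (e(2 := i, 3 := j, 4 := a))) [i..<Suc j] R"
    have "?K i j (Suc j) R1"
      unfolding R1_def by (rule fold_upt_invariant[where P = "?K i j"]) (use that K in auto)
    moreover have "{(s, t). i \<le> s \<and> s \<le> t \<and> t < j} \<union> {i..<Suc j} \<times> {j} = {(s, t). i \<le> s \<and> s \<le> t \<and> t \<le> j}"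
      using that(1) by auto
    ultimately have R1: "points n R1 = Q" "\<And>s t. s < i \<Longrightarrow> s \<le> t \<Longrightarrow> t < n \<Longrightarrow> good_entry q \<alpha> n Q R1 s t"
      "\<And>t. i \<le> t \<Longrightarrow> t < j \<Longrightarrow> good_entry q \<alpha> n Q R1 i t"
      "best_pair q Q {(s, t). i \<le> s \<and> s \<le> t \<and> t \<le> j} (scratch R1)"
      by auto
    have mc: "min_cover q (Q ` {i..j}) (if q = \<infinity> then (fst (Q i) + fst (Q j)) / 2 else fst (scratch R1), snd (scratch R1))"
      using best_pair_min_cover[OF q that(1) _ R1(4)] sorted that(2) by simp
    have eq: "denote q \<alpha> (For 4 (Cur 2) (Nxt 3) pair_cmd ;;; record_cmd q) (e(2 := i, 3 := j)) R =
        denote q \<alpha> (record_cmd q) (e(2 := i, 3 := j)) R1"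
      by (simp add: R1_def e)
    have good: "good_entry q \<alpha> n Q (denote q \<alpha> (record_cmd q) (e(2 := i, 3 := j)) R1) s t \<longleftrightarrow>
        (s = i \<and> t = j) \<or> good_entry q \<alpha> n Q R1 s t" for s t
      using mc R1(1) by (auto simp: good_entry_def record_correct)
    have "{(s, t). i \<le> s \<and> s \<le> t \<and> t < Suc j} = {(s, t). i \<le> s \<and> s \<le> t \<and> t \<le> j}" by auto
    then show ?thesis
      unfolding eq good using R1 by (auto simp: record_correct less_Suc_eq)
  qed
  have "?I n (fold (\<lambda>i. denote q \<alpha> row (e(2 := i))) [0..<n] R)"
  proof (rule fold_upt_invariant[where P = ?I])
    show "?I 0 R" by (simp add: Q_def)
    fix i R assume i: "i < n" and I: "?I i R"
    have "points n (init R) = points n R" "disk_table n (init R) = disk_table n R" "weight_table n (init R) = weight_table n R" "snd (scratch (init R)) = -1"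
      by (auto simp: init_def points_def disk_table_def weight_table_def scratch_def fun_eq_iff)
    moreover have "{(s, t). i \<le> s \<and> s \<le> t \<and> t < i} = {}" by auto
    ultimately have 0: "?J i i (init R)"
      using I by (auto simp: good_entry_def best_pair_def)
    have "?J i n (fold (\<lambda>j. denote q \<alpha> (For 4 (Cur 2) (Nxt 3) pair_cmd ;;; record_cmd q) (e(2 := i, 3 := j))) [i..<n] (init R))"
      by (rule fold_upt_invariant[where P = "?J i"]) (use 0 J i in auto)
    moreover have "denote q \<alpha> row (e(2 := i)) R =
        fold (\<lambda>j. denote q \<alpha> (For 4 (Cur 2) (Nxt 3) pair_cmd ;;; record_cmd q) (e(2 := i, 3 := j))) [i..<n] (init R)"
      by (simp add: row_def init_def e del: denote.simps(7)) (simp add: e)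
    ultimately show "?I (Suc i) (denote q \<alpha> row (e(2 := i)) R)"
      by (auto simp: less_Suc_eq)
  qed simp
  moreover have "R' = fold (\<lambda>i. denote q \<alpha> row (e(2 := i))) [0..<n] R"
    by (simp add: R'_def disks_cmd_def row_def e del: denote.simps(7))
  ultimately show "i \<le> j \<Longrightarrow> j < n \<Longrightarrow> good_entry q \<alpha> n Q R' i j" by auto
qed

end

section \<open>The dynamic programming table\<close>

text \<open>The last run starts at point 0, so one disk serves the whole column and the others have
  radius 0. This is all of level 0 and the first candidate on higher levels.\<close>

definition init_cmd :: "ix \<Rightarrow> cmd" where
  "init_cmd l = Get 0 (Hi 4 (Cur 1) (Cur 3) (Cur 1)) ;;; Put 0 (Hi 5 l (Cur 3) (Cur 1)) ;;;
     Get 0 (Hi 2 (Cur 1) (Cur 3) (Cur 1)) ;;; Put 0 (Hi 6 l (Cur 3) (Cur 1)) ;;;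
     Get 0 (Hi 3 (Cur 1) (Cur 3) (Cur 1)) ;;; Put 0 (Hi 7 l (Cur 3) (Cur 1)) ;;;
     RI (RConst 0 0) ;;; Put 0 (Hi 8 l (Cur 3) (Cur 1))"

text \<open>With \<open>i\<close> in register 4, the start tried is \<open>Suc i\<close>, so the
  points before it are column \<open>i\<close> of the level below; start 0 is left to
  \<open>init_cmd\<close>. The last disk is stored with the value, which spares backtracking an
  access to the run table at a computed start.\<close>

definition relax_cmd :: cmd where
  "relax_cmd = Get 0 (Hi 5 (Cur 2) (Cur 4) (Cur 1)) ;;; Get 1 (Hi 4 (Nxt 4) (Cur 3) (Cur 1)) ;;; RI (RAdd 0 0 1) ;;;
     Get 1 (Hi 5 (Nxt 2) (Cur 3) (Cur 1)) ;;;
     Cond 0 1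
       (Put 0 (Hi 5 (Nxt 2) (Cur 3) (Cur 1)) ;;;
        Get 0 (Hi 2 (Nxt 4) (Cur 3) (Cur 1)) ;;; Put 0 (Hi 6 (Nxt 2) (Cur 3) (Cur 1)) ;;;
        Get 0 (Hi 3 (Nxt 4) (Cur 3) (Cur 1)) ;;; Put 0 (Hi 7 (Nxt 2) (Cur 3) (Cur 1)) ;;;
        ToR 0 (Nxt 4) ;;; Put 0 (Hi 8 (Nxt 2) (Cur 3) (Cur 1)))
       Skip"

definition dp_cmd :: cmd where
  "dp_cmd = For 3 (Cur 1) (Cur 0) (init_cmd (Cur 1)) ;;;
     For 2 (Cur 1) (Cur 0) (For 3 (Cur 1) (Cur 0) (init_cmd (Nxt 2) ;;; For 4 (Cur 1) (Cur 3) relax_cmd))"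

definition dp_val :: "nat \<Rightarrow> (nat \<Rightarrow> real) \<Rightarrow> nat \<Rightarrow> nat \<Rightarrow> real" where
  "dp_val n R l j = R (high_addr n 5 l j 0)"

definition dp_last :: "nat \<Rightarrow> (nat \<Rightarrow> real) \<Rightarrow> nat \<Rightarrow> nat \<Rightarrow> disk" where
  "dp_last n R l j = (R (high_addr n 6 l j 0), R (high_addr n 7 l j 0))"

definition dp_split :: "nat \<Rightarrow> (nat \<Rightarrow> real) \<Rightarrow> nat \<Rightarrow> nat \<Rightarrow> real" where
  "dp_split n R l j = R (high_addr n 8 l j 0)"

definition upd2 :: "(nat \<Rightarrow> nat \<Rightarrow> 'a) \<Rightarrow> nat \<Rightarrow> nat \<Rightarrow> 'a \<Rightarrow> nat \<Rightarrow> nat \<Rightarrow> 'a" where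
  "upd2 f l j v l' j' = (if l' = l \<and> j' = j then v else f l' j')"

text \<open>\<open>m\<close> is the largest start of the last run that has been tried so far.\<close>

definition dp_entry :: "nat \<Rightarrow> (nat \<Rightarrow> nat \<Rightarrow> disk) \<Rightarrow> (nat \<Rightarrow> nat \<Rightarrow> real) \<Rightarrow> (nat \<Rightarrow> real) \<Rightarrow> nat \<Rightarrow> nat \<Rightarrow> nat \<Rightarrow> bool" where
  "dp_entry n T w R l j m \<longleftrightarrow>
     (\<exists>c\<le>m. dp_split n R (Suc l) j = real c \<and> dp_last n R (Suc l) j = T c j \<and>
        dp_val n R (Suc l) j = dp_value (dp_val n R) l c + w c j) \<and>
     (\<forall>i\<le>m. dp_val n R (Suc l) j \<le> dp_value (dp_val n R) l i + w i j)"

context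
  fixes q :: ereal and \<alpha> :: real and n :: nat and e :: "nat \<Rightarrow> nat"
  assumes e: "e 0 = n" "e (Suc 0) = 0"
begin

lemma init_correct:
  fixes l :: ix and R :: "nat \<Rightarrow> real"
  assumes "e' 0 = n" "e' (Suc 0) = 0"
  defines "R' \<equiv> denote q \<alpha> (init_cmd l) e' R"
  shows "disk_table n R' = disk_table n R" "weight_table n R' = weight_table n R"
    "dp_val n R' = upd2 (dp_val n R) (ix_val e' l) (e' 3) (weight_table n R 0 (e' 3))"
    "dp_last n R' = upd2 (dp_last n R) (ix_val e' l) (e' 3) (disk_table n R 0 (e' 3))"
    "dp_split n R' = upd2 (dp_split n R) (ix_val e' l) (e' 3) 0"
  by (auto simp: R'_def init_cmd_def assms dp_val_def dp_last_def dp_split_def disk_table_def weight_table_def upd2_def fun_eq_iff)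

lemma relax_correct:
  fixes l j i :: nat and R :: "nat \<Rightarrow> real"
  defines "R' \<equiv> denote q \<alpha> relax_cmd (e(2 := l, 3 := j, 4 := i)) R"
  defines "v \<equiv> dp_val n R l i + weight_table n R (Suc i) j"
  defines "b \<equiv> v < dp_val n R (Suc l) j"
  shows "disk_table n R' = disk_table n R" "weight_table n R' = weight_table n R"
    "dp_val n R' = upd2 (dp_val n R) (Suc l) j (if b then v else dp_val n R (Suc l) j)"
    "dp_last n R' = upd2 (dp_last n R) (Suc l) j (if b then disk_table n R (Suc i) j else dp_last n R (Suc l) j)"
    "dp_split n R' = upd2 (dp_split n R) (Suc l) j (if b then real (Suc i) else dp_split n R (Suc l) j)"
  by (auto simp: R'_def v_def b_def relax_cmd_def e dp_val_def dp_last_def dp_split_def disk_table_def weight_table_def upd2_def fun_eq_iff)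

text \<open>An entry reads its own cell on level \<open>Suc l'\<close> and values on level
  \<open>l'\<close>; neither is the cell written.\<close>

lemma dp_entry_frame:
  assumes "dp_val n R' = upd2 (dp_val n R) (Suc l) j a" "dp_last n R' = upd2 (dp_last n R) (Suc l) j b"
    "dp_split n R' = upd2 (dp_split n R) (Suc l) j c"
    and "l' \<le> l" "l' < l \<or> j' \<noteq> j"
  shows "dp_entry n T w R' l' j' m = dp_entry n T w R l' j' m"
proof -
  have "dp_value (dp_val n R') l' i = dp_value (dp_val n R) l' i" for i
    using assms(1,4) by (auto simp: dp_value_def upd2_def)
  then show ?thesis using assms by (auto simp: dp_entry_def upd2_def)
qed

lemma dp_cmd_correct:
  fixes R :: "nat \<Rightarrow> real"
  defines "T \<equiv> disk_table n R" and "w \<equiv> weight_table n R" and "R' \<equiv> denote q \<alpha> dp_cmd e R"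
  shows "j < n \<Longrightarrow> dp_val n R' 0 j = w 0 j \<and> dp_last n R' 0 j = T 0 j \<and> dp_split n R' 0 j = 0"
    and "l < n \<Longrightarrow> j < n \<Longrightarrow> dp_entry n T w R' l j j"
proof -
  define base where "base m R \<longleftrightarrow> disk_table n R = T \<and> weight_table n R = w \<and>
     (\<forall>j<m. dp_val n R 0 j = w 0 j \<and> dp_last n R 0 j = T 0 j \<and> dp_split n R 0 j = 0)" for m R
  define R1 where "R1 = fold (\<lambda>j. denote q \<alpha> (init_cmd (Cur 1)) (e(3 := j))) [0..<n] R"
  have "base n R1"
    unfolding R1_def
    by (rule fold_upt_invariant[where P = base])
      (auto simp: base_def T_def w_def init_correct e upd2_def less_Suc_eq)
  let ?I = "\<lambda>l R. base n R \<and> (\<forall>l'<l. \<forall>j<n. dp_entry n T w R l' j j)"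
  let ?J = "\<lambda>l j R. ?I l R \<and> (\<forall>j'<j. dp_entry n T w R l j' j')"
  define cell where "cell = init_cmd (Nxt 2) ;;; For 4 (Cur 1) (Cur 3) relax_cmd"
  have frame: "base n R' \<and> (\<forall>l'<l. \<forall>j<n. dp_entry n T w R' l' j j) \<and> (\<forall>j'<j. dp_entry n T w R' l j' j')"
    if R': "disk_table n R' = disk_table n R" "weight_table n R' = weight_table n R" "dp_val n R' = upd2 (dp_val n R) (Suc l) j a"
      "dp_last n R' = upd2 (dp_last n R) (Suc l) j b" "dp_split n R' = upd2 (dp_split n R) (Suc l) j c"
      and J: "?J l j R" for R R' l j a b c
    using J dp_entry_frame[OF R'(3-5)] R' by (auto simp: base_def upd2_def)
  have J: "?J l (Suc j) (denote q \<alpha> cell (e(2 := l, 3 := j)) R)" if J: "?J l j R" and "j < n" for l j R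
  proof -
    let ?K = "\<lambda>i R. ?J l j R \<and> dp_entry n T w R l j i"
    define R0 where "R0 = denote q \<alpha> (init_cmd (Nxt 2)) (e(2 := l, 3 := j)) R"
    have TW: "disk_table n R = T" "weight_table n R = w" using J by (auto simp: base_def)
    have R0: "disk_table n R0 = disk_table n R" "weight_table n R0 = weight_table n R" "dp_val n R0 = upd2 (dp_val n R) (Suc l) j (w 0 j)"
      "dp_last n R0 = upd2 (dp_last n R) (Suc l) j (T 0 j)" "dp_split n R0 = upd2 (dp_split n R) (Suc l) j 0"
      unfolding R0_def by (subst init_correct; simp add: e TW)+
    have K0: "?K 0 R0"
      using frame[OF R0 J] R0 by (auto simp: dp_entry_def upd2_def dp_value_def)
    have "?K j (fold (\<lambda>i. denote q \<alpha> relax_cmd (e(2 := l, 3 := j, 4 := i))) [0..<j] R0)"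
    proof (rule fold_upt_invariant[where P = ?K])
      show "?K 0 R0" by (rule K0)
      fix i R assume i: "i < j" and K: "?K i R"
      have TW: "disk_table n R = T" "weight_table n R = w" using K by (auto simp: base_def)
      define R' where "R' = denote q \<alpha> relax_cmd (e(2 := l, 3 := j, 4 := i)) R"
      define v where "v = dp_val n R l i + w (Suc i) j"
      define b where "b \<longleftrightarrow> v < dp_val n R (Suc l) j"
      have R': "disk_table n R' = disk_table n R" "weight_table n R' = weight_table n R"
        "dp_val n R' = upd2 (dp_val n R) (Suc l) j (if b then v else dp_val n R (Suc l) j)"
        "dp_last n R' = upd2 (dp_last n R) (Suc l) j (if b then T (Suc i) j else dp_last n R (Suc l) j)"
        "dp_split n R' = upd2 (dp_split n R) (Suc l) j (if b then real (Suc i) else dp_split n R (Suc l) j)"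
        unfolding R'_def b_def v_def TW[symmetric] by (rule relax_correct)+
      have dv: "dp_value (dp_val n R') l = dp_value (dp_val n R) l" "v = dp_value (dp_val n R) l (Suc i) + w (Suc i) j"
        using R'(3) by (auto simp: dp_value_def upd2_def fun_eq_iff v_def)
      have dp_val': "dp_val n R' (Suc l) j = min v (dp_val n R (Suc l) j)"
        using R'(3) by (auto simp: upd2_def b_def)
      obtain c where c: "c \<le> i" "dp_split n R (Suc l) j = real c" "dp_last n R (Suc l) j = T c j"
          "dp_val n R (Suc l) j = dp_value (dp_val n R) l c + w c j"
        and le: "\<And>i'. i' \<le> i \<Longrightarrow> dp_val n R (Suc l) j \<le> dp_value (dp_val n R) l i' + w i' j"
        using K by (auto simp: dp_entry_def)
      have "dp_entry n T w R' l j (Suc i)"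
        unfolding dp_entry_def dv(1)
      proof (intro conjI allI impI)
        show "\<exists>c\<le>Suc i. dp_split n R' (Suc l) j = real c \<and> dp_last n R' (Suc l) j = T c j \<and>
            dp_val n R' (Suc l) j = dp_value (dp_val n R) l c + w c j"
        proof (cases b)
          case True
          then show ?thesis using R' dv by (intro exI[of _ "Suc i"]) (simp add: upd2_def)
        next
          case False
          then show ?thesis using R' c by (intro exI[of _ c]) (simp add: upd2_def)
        qed
        fix i' assume "i' \<le> Suc i"
        then show "dp_val n R' (Suc l) j \<le> dp_value (dp_val n R) l i' + w i' j"
          unfolding dp_val' using le[of i'] dv(2) by (cases "i' = Suc i") (auto simp: min_le_iff_disj)
      qed
      then show "?K (Suc i) (denote q \<alpha> relax_cmd (e(2 := l, 3 := j, 4 := i)) R)"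
        using frame[OF R'] K unfolding R'_def by blast
    qed simp
    moreover have "denote q \<alpha> cell (e(2 := l, 3 := j)) R =
        fold (\<lambda>i. denote q \<alpha> relax_cmd (e(2 := l, 3 := j, 4 := i))) [0..<j] R0"
      by (simp add: cell_def R0_def e)
    ultimately show ?thesis by (auto simp: less_Suc_eq)
  qed
  have "?I n (fold (\<lambda>l. denote q \<alpha> (For 3 (Cur 1) (Cur 0) cell) (e(2 := l))) [0..<n] R1)"
  proof (rule fold_upt_invariant[where P = ?I])
    show "?I 0 R1" using \<open>base n R1\<close> by simp
    fix l R assume I: "?I l R"
    have "?J l n (fold (\<lambda>j. denote q \<alpha> cell (e(2 := l, 3 := j))) [0..<n] R)"
      by (rule fold_upt_invariant[where P = "?J l"]) (use I J in auto)
    then show "?I (Suc l) (denote q \<alpha> (For 3 (Cur 1) (Cur 0) cell) (e(2 := l)) R)"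
      by (auto simp: e less_Suc_eq)
  qed simp
  moreover have "R' = fold (\<lambda>l. denote q \<alpha> (For 3 (Cur 1) (Cur 0) cell) (e(2 := l))) [0..<n] R1"
    by (simp add: R'_def dp_cmd_def R1_def cell_def e)
  ultimately show "j < n \<Longrightarrow> dp_val n R' 0 j = w 0 j \<and> dp_last n R' 0 j = T 0 j \<and> dp_split n R' 0 j = 0"
    and "l < n \<Longrightarrow> j < n \<Longrightarrow> dp_entry n T w R' l j j"
    by (auto simp: base_def)
qed

end

section \<open>Backtracking\<close>

text \<open>With \<open>k\<close>, \<open>m\<close> and \<open>j\<close> in registers 2, 3 and 4,
  equality of the cursor with \<open>j + 1\<close> is tested as the failure of both strict
  comparisons. After \<open>m\<close> disks of the covering by \<open>k + 1\<close> disks, the next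
  one comes from level \<open>k - m\<close>, hence \<open>Ix 2 0 3\<close>.\<close>

definition match_cmd :: cmd where
  "match_cmd = Get 0 (Hi 11 (Cur 1) (Cur 1) (Cur 1)) ;;; ToR 1 (Nxt 4) ;;;
     Cond 0 1 Skip (Cond 1 0 Skip
       (Get 0 (Hi 6 (Ix 2 0 3) (Cur 4) (Cur 1)) ;;; Put 0 (Lo 0 (Nxt 2) (Cur 3)) ;;;
        Get 0 (Hi 7 (Ix 2 0 3) (Cur 4) (Cur 1)) ;;; Put 0 (Lo 1 (Nxt 2) (Cur 3)) ;;;
        Get 0 (Hi 8 (Ix 2 0 3) (Cur 4) (Cur 1)) ;;; Put 0 (Hi 11 (Cur 1) (Cur 1) (Cur 1))))"

text \<open>The disk written here remains exactly when no points are left, which produces the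
  padding with radius 0.\<close>

definition clear_cmd :: cmd where
  "clear_cmd = RI (RConst 0 0) ;;; Put 0 (Lo 0 (Nxt 2) (Cur 3)) ;;; Put 0 (Lo 1 (Nxt 2) (Cur 3))"

text \<open>Array 11 holds the number of points that remain to be covered, as a real number; its table entry
  is found by a scan because the language cannot load integers from memory.\<close>

definition backtrack_cmd :: cmd where
  "backtrack_cmd = For 2 (Cur 1) (Cur 0)
     (ToR 0 (Cur 0) ;;; Put 0 (Hi 11 (Cur 1) (Cur 1) (Cur 1)) ;;;
      For 3 (Cur 1) (Nxt 2) (clear_cmd ;;; For 4 (Cur 1) (Cur 0) match_cmd))"

definition out :: "nat \<Rightarrow> (nat \<Rightarrow> real) \<Rightarrow> nat \<Rightarrow> nat \<Rightarrow> disk" where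
  "out n R k m = (R (low_addr n 0 k m), R (low_addr n 1 k m))"

definition cursor :: "nat \<Rightarrow> (nat \<Rightarrow> real) \<Rightarrow> real" where
  "cursor n R = R (high_addr n 11 0 0 0)"

text \<open>An optimal covering of no points costs no more than the empty list, and a disk of radius
  0 adds nothing.\<close>

lemma optimal_k_cover_empty_Cons:
  assumes "optimal_k_cover q \<alpha> k {} Ds"
  shows "optimal_k_cover q \<alpha> (Suc k) {} ((0, 0) # Ds)"
proof -
  have "covers q [] {}" by (simp add: covers_def)
  then have "cover_cost \<alpha> Ds \<le> cover_cost \<alpha> []"
    using assms unfolding optimal_k_cover_def by (metis le0 list.size(3))
  then have "cover_cost \<alpha> ((0, 0) # Ds) \<le> cover_cost \<alpha> Es" for Es
    using cover_cost_nonneg[of \<alpha> Es] by (simp add: cover_cost_def)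
  then show ?thesis using assms by (auto simp: optimal_k_cover_def covers_def)
qed

context
  fixes q :: ereal and \<alpha> :: real and n :: nat and e :: "nat \<Rightarrow> nat"
  assumes e: "e 0 = n" "e (Suc 0) = 0"
begin

lemma match_correct:
  fixes R :: "nat \<Rightarrow> real"
  assumes kmj: "k < n" "m \<le> k" "j < n"
  defines "R' \<equiv> denote q \<alpha> match_cmd (e(2 := k, 3 := m, 4 := j)) R"
  defines "b \<equiv> cursor n R = real (Suc j)"
  shows "dp_last n R' = dp_last n R" "dp_split n R' = dp_split n R"
    "cursor n R' = (if b then dp_split n R (k - m) j else cursor n R)"
    "k' < n \<Longrightarrow> m' \<le> n \<Longrightarrow> out n R' (Suc k') m' =
       (if b \<and> k' = k \<and> m' = m then dp_last n R (k - m) j else out n R (Suc k') m')"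
  using kmj
  by (auto simp: R'_def b_def match_cmd_def e dp_last_def dp_split_def cursor_def out_def fun_eq_iff)

lemma clear_correct:
  fixes R :: "nat \<Rightarrow> real"
  assumes kmj: "k < n" "m \<le> k"
  defines "R' \<equiv> denote q \<alpha> clear_cmd (e(2 := k, 3 := m)) R"
  shows "dp_last n R' = dp_last n R" "dp_split n R' = dp_split n R" "cursor n R' = cursor n R"
    "k' < n \<Longrightarrow> m' \<le> n \<Longrightarrow> out n R' (Suc k') m' = (if k' = k \<and> m' = m then (0, 0) else out n R (Suc k') m')"
  using kmj
  by (auto simp: R'_def clear_cmd_def e dp_last_def dp_split_def cursor_def out_def fun_eq_iff)

text \<open>The scan is ascending and a split never exceeds its column, so after the match at
  \<open>J - 1\<close> the new cursor is below every value tested later: at most one step of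
  backtracking is made.\<close>

lemma find_correct:
  fixes R :: "nat \<Rightarrow> real"
  assumes km: "k < n" "m \<le> k" and J: "J \<le> n" "cursor n R = real J" "out n R (Suc k) m = (0, 0)"
    and c: "\<forall>j<n. dp_split n R (k - m) j = real (c j) \<and> c j \<le> j"
  defines "R' \<equiv> denote q \<alpha> (For 4 (Cur 1) (Cur 0) match_cmd) (e(2 := k, 3 := m)) R"
  shows "dp_last n R' = dp_last n R" "dp_split n R' = dp_split n R"
    "cursor n R' = (if J = 0 then 0 else real (c (J - 1)))"
    "out n R' (Suc k) m = (if J = 0 then (0, 0) else dp_last n R (k - m) (J - 1))"
    "k' < n \<Longrightarrow> m' \<le> n \<Longrightarrow> k' \<noteq> k \<or> m' \<noteq> m \<Longrightarrow> out n R' (Suc k') m' = out n R (Suc k') m'"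
proof -
  let ?I = "\<lambda>j S. dp_last n S = dp_last n R \<and> dp_split n S = dp_split n R \<and>
    cursor n S = (if J = 0 \<or> j < J then real J else real (c (J - 1))) \<and>
    out n S (Suc k) m = (if J = 0 \<or> j < J then (0, 0) else dp_last n R (k - m) (J - 1)) \<and>
    (\<forall>k' m'. k' < n \<and> m' \<le> n \<and> (k' \<noteq> k \<or> m' \<noteq> m) \<longrightarrow> out n S (Suc k') m' = out n R (Suc k') m')"
  have "?I n (fold (\<lambda>j. denote q \<alpha> match_cmd (e(2 := k, 3 := m, 4 := j))) [0..<n] R)"
  proof (rule fold_upt_invariant[where P = ?I])
    show "?I 0 R" using J by auto
    fix j S assume j: "j < n" and I: "?I j S"
    have iff: "cursor n S = real (Suc j) \<longleftrightarrow> J = Suc j"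
    proof (cases "J = 0 \<or> j < J")
      case True
      then show ?thesis using I by (auto simp del: of_nat_Suc)
    next
      case False
      then have "c (J - 1) \<le> J - 1" using j c by auto
      then show ?thesis using I False by (auto simp del: of_nat_Suc)
    qed
    have km': "k < n" "m \<le> n" using km by auto
    have o4: "out n (denote q \<alpha> match_cmd (e(2 := k, 3 := m, 4 := j)) S) (Suc k') m' =
        (if J = Suc j \<and> k' = k \<and> m' = m then dp_last n S (k - m) j else out n S (Suc k') m')"
      if "k' < n" "m' \<le> n" for k' m'
      using match_correct(4)[OF km j that, of S] unfolding iff .
    show "?I (Suc j) (denote q \<alpha> match_cmd (e(2 := k, 3 := m, 4 := j)) S)"
      unfolding match_correct(1-3)[OF km j] iff using I c j km' o4 by (cases "J = Suc j") auto
  qed simp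
  moreover have "R' = fold (\<lambda>j. denote q \<alpha> match_cmd (e(2 := k, 3 := m, 4 := j))) [0..<n] R"
    by (simp add: R'_def e)
  ultimately show "dp_last n R' = dp_last n R" "dp_split n R' = dp_split n R"
    "cursor n R' = (if J = 0 then 0 else real (c (J - 1)))"
    "out n R' (Suc k) m = (if J = 0 then (0, 0) else dp_last n R (k - m) (J - 1))"
    "k' < n \<Longrightarrow> m' \<le> n \<Longrightarrow> k' \<noteq> k \<or> m' \<noteq> m \<Longrightarrow> out n R' (Suc k') m' = out n R (Suc k') m'"
    using J(1) by auto
qed

text \<open>The invariant \<open>?J\<close> is a continuation: every optimal covering
  \<open>Ds\<close> of the remaining \<open>J\<close> points by \<open>Suc k - m\<close> disks
  completes the disks written so far to an optimal covering. It is finally applied to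
  \<open>Ds = []\<close>.\<close>

lemma backtrack_correct:
  fixes R :: "nat \<Rightarrow> real" and c :: "nat \<Rightarrow> nat \<Rightarrow> nat"
  assumes tabs: "\<And>l j. l < n \<Longrightarrow> j < n \<Longrightarrow> dp_split n R l j = real (c l j)"
    "\<And>l j. l < n \<Longrightarrow> j < n \<Longrightarrow> dp_last n R l j = T (c l j) j"
    "\<And>l j. l < n \<Longrightarrow> j < n \<Longrightarrow> c l j \<le> j" "\<And>j. j < n \<Longrightarrow> c 0 j = 0"
    and opt: "\<And>l j Ds. l < n \<Longrightarrow> j < n \<Longrightarrow> length Ds = l \<Longrightarrow> optimal_k_cover q \<alpha> l (Q ` {..<c l j}) Ds \<Longrightarrow>
       optimal_k_cover q \<alpha> (Suc l) (Q ` {..<Suc j}) (T (c l j) j # Ds)"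
  defines "R' \<equiv> denote q \<alpha> backtrack_cmd e R"
  shows "k < n \<Longrightarrow> optimal_k_cover q \<alpha> (Suc k) (Q ` {..<n}) (map (out n R' (Suc k)) [0..<Suc k])"
proof -
  let ?T = "\<lambda>S. dp_last n S = dp_last n R \<and> dp_split n S = dp_split n R"
  let ?O = "\<lambda>k S. \<forall>k'<k. optimal_k_cover q \<alpha> (Suc k') (Q ` {..<n}) (map (out n S (Suc k')) [0..<Suc k'])"
  let ?I = "\<lambda>k S. ?T S \<and> ?O k S"
  let ?J = "\<lambda>k m S. ?I k S \<and> (\<exists>J\<le>n. cursor n S = real J \<and> (m = Suc k \<longrightarrow> J = 0) \<and>
     (\<forall>Ds. length Ds = Suc k - m \<longrightarrow> optimal_k_cover q \<alpha> (Suc k - m) (Q ` {..<J}) Ds \<longrightarrow>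
        optimal_k_cover q \<alpha> (Suc k) (Q ` {..<n}) (map (out n S (Suc k)) [0..<m] @ Ds)))"
  define body where "body = clear_cmd ;;; For 4 (Cur 1) (Cur 0) match_cmd"
  define row where "row = ToR 0 (Cur 0) ;;; Put 0 (Hi 11 (Cur 1) (Cur 1) (Cur 1)) ;;; For 3 (Cur 1) (Nxt 2) body"
  have J: "?J k (Suc m) (denote q \<alpha> body (e(2 := k, 3 := m)) S)" if km: "k < n" "m < Suc k" and JS: "?J k m S" for k m S
  proof -
    have km': "k < n" "m \<le> k" using km by auto
    have le: "k < n" "m \<le> n" "k - m < n" using km by auto
    obtain J where J: "J \<le> n" "cursor n S = real J"
      "\<And>Ds. length Ds = Suc k - m \<Longrightarrow> optimal_k_cover q \<alpha> (Suc k - m) (Q ` {..<J}) Ds \<Longrightarrow>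
        optimal_k_cover q \<alpha> (Suc k) (Q ` {..<n}) (map (out n S (Suc k)) [0..<m] @ Ds)"
      using JS by blast
    define S1 where "S1 = denote q \<alpha> clear_cmd (e(2 := k, 3 := m)) S"
    define S2 where "S2 = denote q \<alpha> (For 4 (Cur 1) (Cur 0) match_cmd) (e(2 := k, 3 := m)) S1"
    have S1: "dp_last n S1 = dp_last n R" "dp_split n S1 = dp_split n R" "cursor n S1 = real J" "out n S1 (Suc k) m = (0, 0)"
      "\<And>k' m'. k' < n \<Longrightarrow> m' \<le> n \<Longrightarrow> k' \<noteq> k \<or> m' \<noteq> m \<Longrightarrow> out n S1 (Suc k') m' = out n S (Suc k') m'"
      using JS J(2) le unfolding S1_def by (auto simp: clear_correct[OF km'])
    have "\<forall>j<n. dp_split n S1 (k - m) j = real (c (k - m) j) \<and> c (k - m) j \<le> j"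
      using tabs(1,3)[OF le(3)] S1(2) by auto
    note F = find_correct[OF km' J(1) S1(3,4) this, folded S2_def]
    define J' where "J' = (if J = 0 then 0 else c (k - m) (J - 1))"
    define D where "D = (if J = 0 then (0, 0) else T (c (k - m) (J - 1)) (J - 1))"
    have S2: "?T S2" "cursor n S2 = real J'" "out n S2 (Suc k) m = D"
      using F S1 tabs(2)[OF le(3), of "J - 1"] J(1) by (auto simp: J'_def D_def)
    have old: "out n S2 (Suc k') m' = out n S (Suc k') m'" if "k' < n" "m' \<le> n" "k' \<noteq> k \<or> m' \<noteq> m" for k' m'
      using F(5)[OF that] S1(5)[OF that] by simp
    have "map (out n S2 (Suc k')) [0..<Suc k'] = map (out n S (Suc k')) [0..<Suc k']" if "k' < k" for k'
      using old[of k'] that km by (intro map_cong) auto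
    then have "?O k S2" using JS by metis
    then have "?I k S2" using S2(1) by blast
    moreover have "J' \<le> n" using J(1) tabs(3)[OF le(3), of "J - 1"] by (cases J) (auto simp: J'_def)
    \<comment> \<open>The last disk comes from level 0, where every split is 0, so no points are
      left.\<close>
    moreover have "J' = 0" if "Suc m = Suc k" using tabs(4)[of "J - 1"] J(1) that by (auto simp: J'_def)
    moreover have "optimal_k_cover q \<alpha> (Suc k) (Q ` {..<n}) (map (out n S2 (Suc k)) [0..<Suc m] @ Ds)"
      if Ds: "length Ds = Suc k - Suc m" "optimal_k_cover q \<alpha> (Suc k - Suc m) (Q ` {..<J'}) Ds" for Ds
    proof -
      have Suc: "Suc k - m = Suc (k - m)" using km by simp
      have "optimal_k_cover q \<alpha> (Suc k - m) (Q ` {..<J}) (D # Ds)"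
      proof (cases J)
        case 0
        then show ?thesis using Ds optimal_k_cover_empty_Cons[of q \<alpha> "k - m" Ds] by (simp add: J'_def D_def Suc)
      next
        case (Suc j)
        then show ?thesis
          using opt[OF le(3), of j Ds] Ds J(1) by (simp add: J'_def D_def \<open>Suc k - m = Suc (k - m)\<close>)
      qed
      then have "optimal_k_cover q \<alpha> (Suc k) (Q ` {..<n}) (map (out n S (Suc k)) [0..<m] @ D # Ds)"
        using Ds(1) by (intro J(3)) (simp_all add: Suc)
      moreover have "map (out n S (Suc k)) [0..<m] = map (out n S2 (Suc k)) [0..<m]"
        using old[of k] le by (intro map_cong) auto
      ultimately show ?thesis using S2(3) by simp
    qed
    ultimately have "?J k (Suc m) S2" using S2(2) by blast
    then show ?thesis by (simp add: body_def S2_def S1_def del: denote.simps(9))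
  qed
  have "?I n (fold (\<lambda>k. denote q \<alpha> row (e(2 := k))) [0..<n] R)"
  proof (rule fold_upt_invariant[where P = ?I])
    show "?I 0 R" by simp
    fix k S assume k: "k < n" and I: "?I k S"
    define S0 where "S0 = S(0 := real n, high_addr n 11 0 0 0 := real n)"
    have S0: "?T S0" "cursor n S0 = real n"
      using I by (auto simp: S0_def dp_last_def dp_split_def cursor_def fun_eq_iff)
    have "out n S0 (Suc k') m' = out n S (Suc k') m'" if "k' < n" "m' \<le> n" for k' m'
      using that by (simp add: S0_def out_def)
    then have "map (out n S0 (Suc k')) [0..<Suc k'] = map (out n S (Suc k')) [0..<Suc k']" if "k' < k" for k'
      using that k by (intro map_cong) auto
    then have "?O k S0" using I by metis
    then have "?J k 0 S0" using S0 by (auto simp del: upt_Suc)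
    then have "?J k (Suc k) (fold (\<lambda>m. denote q \<alpha> body (e(2 := k, 3 := m))) [0..<Suc k] S0)"
      by (intro fold_upt_invariant[where P = "?J k"] J k) auto
    then obtain J where "J \<le> n" "?I k (fold (\<lambda>m. denote q \<alpha> body (e(2 := k, 3 := m))) [0..<Suc k] S0)"
      "optimal_k_cover q \<alpha> 0 {} [] \<Longrightarrow> optimal_k_cover q \<alpha> (Suc k) (Q ` {..<n})
         (map (out n (fold (\<lambda>m. denote q \<alpha> body (e(2 := k, 3 := m))) [0..<Suc k] S0) (Suc k)) [0..<Suc k])"
      by (auto simp del: upt_Suc)
    moreover have "optimal_k_cover q \<alpha> 0 {} []" by (simp add: optimal_k_cover_def covers_def)
    moreover have "denote q \<alpha> row (e(2 := k)) S = fold (\<lambda>m. denote q \<alpha> body (e(2 := k, 3 := m))) [0..<Suc k] S0"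
      by (simp add: row_def e S0_def del: upt_Suc)
    ultimately show "?I (Suc k) (denote q \<alpha> row (e(2 := k)) S)"
      by (auto simp: less_Suc_eq simp del: upt_Suc)
  qed simp
  moreover have "R' = fold (\<lambda>k. denote q \<alpha> row (e(2 := k))) [0..<n] R"
    by (simp add: R'_def backtrack_cmd_def row_def body_def e del: denote.simps(7))
  ultimately show "k < n \<Longrightarrow> optimal_k_cover q \<alpha> (Suc k) (Q ` {..<n}) (map (out n R' (Suc k)) [0..<Suc k])"
    by blast
qed

end

section \<open>Correctness and running time\<close>

definition main_cmd :: "ereal \<Rightarrow> cmd" where
  "main_cmd q = mark_cmd ;;; read_cmd ;;; sort_cmd ;;; disks_cmd q ;;; dp_cmd ;;; backtrack_cmd"

definition prog_of :: "cmd \<Rightarrow> instr list" where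
  "prog_of c = compile c 0 @ map (\<lambda>k. IConst k (int k)) [1..<16] @ [Halt]"

lemma main_correct:
  fixes R :: "nat \<Rightarrow> real" and P :: "(real \<times> real) list"
  assumes q: "1 \<le> q" and \<alpha>: "1 \<le> \<alpha>" and e: "e 0 = n" "e (Suc 0) = 0" and n: "n = length P"
    and R: "\<And>i. i < 2 * n \<Longrightarrow> R i = (if even i then fst (P ! (i div 2)) else snd (P ! (i div 2)))"
    and k: "k < n"
  shows "optimal_k_cover q \<alpha> (Suc k) (set P) (map (out n (denote q \<alpha> (main_cmd q) e R) (Suc k)) [0..<Suc k])"
proof -
  define R1 where "R1 = denote q \<alpha> read_cmd e R"
  define R2 where "R2 = denote q \<alpha> sort_cmd e R1"
  define R3 where "R3 = denote q \<alpha> (disks_cmd q) e R2"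
  define R4 where "R4 = denote q \<alpha> dp_cmd e R3"
  define Q where "Q = points n R2"
  define T where "T = disk_table n R3"
  \<comment> \<open>Splits are stored as reals with natural values, which the floor
    recovers.\<close>
  define c where "c l j = nat \<lfloor>dp_split n R4 l j\<rfloor>" for l j
  have "points n R1 i = P ! i" if "i < n" for i
    using read_correct[OF e R] that unfolding R1_def by blast
  then have "points n R1 ` {..<n} = set P" by (auto simp: n set_conv_nth image_iff)
  then have QP: "Q ` {..<n} = set P"
    using sort_correct(1)[OF e, where R = R1 and q = q and \<alpha> = \<alpha>] by (simp add: Q_def R2_def)
  have sorted: "fst (Q s) \<le> fst (Q t)" if "s \<le> t" "t < n" for s t
    using sort_correct(2)[OF e that, where R = R1 and q = q and \<alpha> = \<alpha>] by (simp add: Q_def R2_def)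
  have "good_entry q \<alpha> n Q R3 i j" if "i \<le> j" "j < n" for i j
    unfolding Q_def R3_def using sorted by (intro disks_correct[OF e q _ that]) (simp add: Q_def)
  then have T: "min_cover q (Q ` {i..j}) (T i j)" "weight_table n R3 i j = snd (T i j) powr \<alpha>" if "i \<le> j" "j < n" for i j
    using that by (auto simp: good_entry_def T_def)
  have base: "dp_val n R4 0 j = snd (T 0 j) powr \<alpha>" "dp_last n R4 0 j = T 0 j" "dp_split n R4 0 j = real (c 0 j)" "c 0 j = 0"
    if "j < n" for j
    using dp_cmd_correct(1)[OF e that, where R = R3 and q = q and \<alpha> = \<alpha>] T(2)[OF _ that] by (auto simp: R4_def T_def c_def)
  have step: "c (Suc l) j \<le> j" "dp_split n R4 (Suc l) j = real (c (Suc l) j)" "dp_last n R4 (Suc l) j = T (c (Suc l) j) j"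
    "dp_val n R4 (Suc l) j = dp_value (dp_val n R4) l (c (Suc l) j) + snd (T (c (Suc l) j) j) powr \<alpha>"
    "i \<le> j \<Longrightarrow> dp_val n R4 (Suc l) j \<le> dp_value (dp_val n R4) l i + snd (T i j) powr \<alpha>"
    if l: "l < n" and j: "j < n" for l i j
  proof -
    have entry: "dp_entry n T (weight_table n R3) R4 l j j"
      using dp_cmd_correct(2)[OF e l j, where R = R3 and q = q and \<alpha> = \<alpha>] by (simp add: R4_def T_def)
    then obtain c' where "c' \<le> j" "dp_split n R4 (Suc l) j = real c'" "dp_last n R4 (Suc l) j = T c' j"
       "dp_val n R4 (Suc l) j = dp_value (dp_val n R4) l c' + weight_table n R3 c' j"
      by (auto simp: dp_entry_def)
    moreover from this have "c (Suc l) j = c'" by (simp add: c_def)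
    ultimately show "c (Suc l) j \<le> j" "dp_split n R4 (Suc l) j = real (c (Suc l) j)" "dp_last n R4 (Suc l) j = T (c (Suc l) j) j"
      "dp_val n R4 (Suc l) j = dp_value (dp_val n R4) l (c (Suc l) j) + snd (T (c (Suc l) j) j) powr \<alpha>"
      using T(2) j by auto
    show "dp_val n R4 (Suc l) j \<le> dp_value (dp_val n R4) l i + snd (T i j) powr \<alpha>" if "i \<le> j"
      using entry T(2)[OF that j] that by (auto simp: dp_entry_def)
  qed
  have dp: "optimal_k_cover q \<alpha> (Suc l) (Q ` {..<Suc j}) (T (c l j) j # Ds)"
    if "l < n" "j < n" "length Ds = l" "optimal_k_cover q \<alpha> l (Q ` {..<c l j}) Ds" for l j Ds
    using dp_correct[of q \<alpha> n Q T c "dp_val n R4" n l j] q \<alpha> sorted T(1) base(1,4) step that by simp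
  have "optimal_k_cover q \<alpha> (Suc k) (Q ` {..<n}) (map (out n (denote q \<alpha> backtrack_cmd e R4) (Suc k)) [0..<Suc k])"
  proof (rule backtrack_correct[OF e, where c = c and T = T])
    fix l j assume lj: "l < n" "j < n"
    show "dp_split n R4 l j = real (c l j)" "dp_last n R4 l j = T (c l j) j" "c l j \<le> j"
      using base[OF lj(2)] step[of "l - 1" j] lj by (cases l; simp)+
  qed (use base dp k in auto)
  moreover have "denote q \<alpha> (main_cmd q) e R = denote q \<alpha> backtrack_cmd e R4"
  proof -
    have "fold (\<lambda>i. denote q \<alpha> (Mark (Cur 2)) (e(2 := i))) xs R = R" for xs
      by (induction xs) auto
    then have "denote q \<alpha> mark_cmd e R = R" by (simp only: mark_cmd_def denote.simps(9))
    then show ?thesis by (simp add: main_cmd_def R4_def R3_def R2_def R1_def)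
  qed
  ultimately show ?thesis by (simp only: QP)
qed

section \<open>Cubic time and polynomially bounded registers\<close>

fun depth :: "cmd \<Rightarrow> nat" where
  "depth (Seq c d) = max (depth c) (depth d)"
| "depth (Cond a b c d) = max (depth c) (depth d)"
| "depth (For v l h c) = Suc (depth c)"
| "depth _ = 0"

text \<open>A loop is charged at most \<open>L\<close> rounds, so the degree is the nesting depth;
  22 adds the 12 for a loop and the 10 per round.\<close>

lemma cost_bound_power: "\<exists>K. \<forall>L\<ge>1. cost_bound c L \<le> K * L ^ depth c"
proof (induction c)
  case (Seq c d)
  then obtain K K' where K: "\<And>L. 1 \<le> L \<Longrightarrow> cost_bound c L \<le> K * L ^ depth c"
     "\<And>L. 1 \<le> L \<Longrightarrow> cost_bound d L \<le> K' * L ^ depth d" by blast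
  have "cost_bound (Seq c d) L \<le> (K + K') * L ^ depth (Seq c d)" if "1 \<le> L" for L
  proof -
    have "K * L ^ depth c \<le> K * L ^ max (depth c) (depth d)" "K' * L ^ depth d \<le> K' * L ^ max (depth c) (depth d)"
      using that by (auto intro!: mult_left_mono power_increasing)
    then show ?thesis using K[OF that] unfolding cost_bound.simps depth.simps add_mult_distrib by linarith
  qed
  then show ?case by blast
next
  case (Cond a b c d)
  then obtain K K' where K: "\<And>L. 1 \<le> L \<Longrightarrow> cost_bound c L \<le> K * L ^ depth c"
     "\<And>L. 1 \<le> L \<Longrightarrow> cost_bound d L \<le> K' * L ^ depth d" by blast
  have "cost_bound (Cond a b c d) L \<le> (3 + K + K') * L ^ depth (Cond a b c d)" if "1 \<le> L" for L
  proof -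
    have "K * L ^ depth c \<le> K * L ^ max (depth c) (depth d)" "K' * L ^ depth d \<le> K' * L ^ max (depth c) (depth d)"
      "1 \<le> L ^ max (depth c) (depth d)"
      using that by (auto intro!: mult_left_mono power_increasing)
    then show ?thesis using K[OF that] unfolding cost_bound.simps depth.simps add_mult_distrib by linarith
  qed
  then show ?case by blast
next
  case (For v l h c)
  then obtain K where K: "\<And>L. 1 \<le> L \<Longrightarrow> cost_bound c L \<le> K * L ^ depth c" by blast
  have "cost_bound (For v l h c) L \<le> (K + 22) * L ^ depth (For v l h c)" if "1 \<le> L" for L
  proof -
    have "1 \<le> L ^ depth c" using that by simp
    then have "cost_bound c L + 10 \<le> (K + 10) * L ^ depth c"
      using K[OF that] by (simp add: add_mult_distrib)
    then have "L * (cost_bound c L + 10) \<le> L * ((K + 10) * L ^ depth c)" by (rule mult_le_mono2)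
    moreover have "L * ((K + 10) * L ^ depth c) = (K + 10) * (L * L ^ depth c)" by simp
    moreover have "1 \<le> L * L ^ depth c" using that by simp
    ultimately show ?thesis
      unfolding cost_bound.simps depth.simps power_Suc add_mult_distrib by linarith
  qed
  then show ?case by blast
qed (auto intro: exI[of _ "0::nat"] exI[of _ "1::nat"] exI[of _ "40::nat"])

text \<open>With \<open>y\<close> at least \<open>n + K\<close> and 2, each of the three nested
  pairings raises the bound to its fifth power, which gives 125 = 5 * 5 * 5; two more powers of
  \<open>y\<close> absorb the factor 4.\<close>

lemma addr_bound_polynomial: "\<exists>c. \<forall>n. addr_bound (n + K) \<le> (n + 2) ^ c"
proof (intro exI allI)
  fix n :: nat
  define x where "x = n + 2"
  define y where "y = x ^ (K + 2)"
  have x: "2 \<le> x" by (simp add: x_def)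
  have "K + 1 \<le> 2 ^ K" by (induction K) auto
  also have "\<dots> \<le> x ^ K" using x by (intro power_mono) auto
  finally have "x * (K + 1) \<le> x * x ^ K" by (rule mult_le_mono2)
  moreover have "n + K \<le> x * (K + 1)" by (simp add: x_def)
  moreover have "x * x ^ K \<le> y" using x by (simp add: y_def)
  ultimately have L: "n + K \<le> y" by linarith
  have y: "2 \<le> y"
  proof -
    have "x ^ 1 \<le> y" unfolding y_def using x by (intro power_increasing) auto
    then show ?thesis using x by simp
  qed
  have pr_le: "pair_code a b \<le> m ^ 5" if "a \<le> m" "b \<le> m" "2 \<le> m" for a b m :: nat
  proof -
    have "pair_code a b \<le> pair_code m m" using that by (intro pair_code_mono)
    also have "\<dots> \<le> 5 * m ^ 2"
      using mult_le_mono1[of 1 m m] that(3) by (simp add: pair_code_def power2_eq_square algebra_simps)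
    also have "\<dots> \<le> m ^ 3 * m ^ 2"
      using power_mono[OF that(3), of 3] by (intro mult_le_mono1) simp
    finally show ?thesis by (simp flip: power_add)
  qed
  have pw: "2 \<le> y ^ Suc i" "y \<le> y ^ Suc i" for i
  proof -
    have "y ^ 1 \<le> y ^ Suc i" using y by (intro power_increasing) auto
    then show "2 \<le> y ^ Suc i" "y \<le> y ^ Suc i" using y by (simp_all only: power_one_right)
  qed
  have "pair_code (n + K) (n + K) \<le> y ^ 5" by (rule pr_le) (use L y in auto)
  then have "pair_code (n + K) (pair_code (n + K) (n + K)) \<le> (y ^ 5) ^ 5"
    by - (rule pr_le, use L pw[of 4] in auto)
  then have "pair_code (n + K) (pair_code (n + K) (pair_code (n + K) (n + K))) \<le> ((y ^ 5) ^ 5) ^ 5"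
    by - (rule pr_le, use L pw[of 24] in \<open>auto simp flip: power_mult\<close>)
  then have 1: "pair_code (n + K) (pair_code (n + K) (pair_code (n + K) (n + K))) \<le> y ^ 125" by (simp flip: power_mult)
  have "n + K + 2 \<le> 2 * y" using L y by simp
  also have "\<dots> \<le> y * y" using y by (rule mult_le_mono1)
  finally have "n + K + 2 \<le> y * y" .
  then have "(n + K + 2) * (n + K + 2) \<le> (y * y) * (y * y)" by (simp only: mult_le_mono)
  also have "\<dots> = y ^ 4" by (simp add: eval_nat_numeral)
  finally have 2: "4 * ((n + K + 2) * (n + K + 2)) \<le> 4 * y ^ 4" by simp
  have "4 * y ^ 4 \<le> y ^ 2 * y ^ 4" using power_mono[OF y, of 2] by (intro mult_le_mono1) simp
  also have "\<dots> = y ^ 6" by (simp flip: power_add)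
  also have "\<dots> \<le> y ^ 125" using y by (intro power_increasing) auto
  finally have 3: "4 * y ^ 4 \<le> y ^ 125" .
  have "(2::nat) ^ 4 \<le> y ^ 4" using y by (intro power_mono) auto
  also have "\<dots> \<le> y ^ 125" using y by (intro power_increasing) auto
  finally have 4: "16 \<le> y ^ 125" by simp
  have "addr_bound (n + K) \<le> 4 * y ^ 125" using 1 2 3 4 by (simp add: addr_bound_def)
  also have "\<dots> \<le> y ^ 2 * y ^ 125" using power_mono[OF y, of 2] by (intro mult_le_mono1) simp
  also have "\<dots> = y ^ 127" by (simp flip: power_add)
  also have "\<dots> = x ^ ((K + 2) * 127)" by (simp only: y_def power_mult)
  finally show "addr_bound (n + K) \<le> (n + 2) ^ ((K + 2) * 127)" by (simp add: x_def)
qed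

lemma int_ops_consts:
  assumes "regs_bounded B I" "int m \<le> B"
  shows "\<exists>J. int_ops B (map (\<lambda>k. IConst k (int k)) [l..<m]) I = Some J \<and>
    (\<forall>x. J x = (if l \<le> x \<and> x < m then int x else I x))"
  using assms
proof (induction "m - l" arbitrary: l I)
  case 0
  then show ?case by auto
next
  case (Suc d)
  then have "l < m" by auto
  then have "[l..<m] = l # [Suc l..<m]" by (rule upt_conv_Cons)
  moreover have "regs_bounded B (I(l := int l))" using Suc.prems \<open>l < m\<close> by auto
  ultimately show ?case
    using Suc.hyps(1)[of "Suc l" "I(l := int l)"] Suc.hyps(2) Suc.prems \<open>l < m\<close> by force
qed

lemma main_scoped: "scoped {0, 1} (main_cmd q)"
  by (auto simp: main_cmd_def mark_cmd_def read_cmd_def sort_cmd_def swap_cmd_def disks_cmd_def pair_cmd_def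
      record_cmd_def dp_cmd_def init_cmd_def relax_cmd_def backtrack_cmd_def clear_cmd_def match_cmd_def)

text \<open>The exponent of the running time. The third loop runs over the pairs added to a run, the
  starts of a last run, or the columns searched for the cursor.\<close>

lemma main_depth: "depth (main_cmd q) = 3"
  by (simp add: main_cmd_def mark_cmd_def read_cmd_def sort_cmd_def swap_cmd_def disks_cmd_def pair_cmd_def
      record_cmd_def dp_cmd_def init_cmd_def relax_cmd_def backtrack_cmd_def clear_cmd_def match_cmd_def)

lemma prog_of_runs:
  assumes "scoped {0, 1} c" "e 0 = n" "e 1 = 0" "pc s = 0" "ireg s = (\<lambda>i. if i = 0 then int n else 0)"
  defines "B \<equiv> int (addr_bound (n + offs c))"
  shows "\<exists>t s'. runs p \<alpha> B (prog_of c) s t s' \<and> halted (prog_of c) s' \<and> t \<le> cost_bound c (n + offs c) + 15 \<and>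
    rreg s' = denote p \<alpha> c e (rreg s) \<and> (\<forall>x. 1 \<le> x \<longrightarrow> x < 16 \<or> x \<in> marked c e \<longrightarrow> ireg s' x = int x)"
proof -
  have B: "int n \<le> B" "16 \<le> B" using addr_bound_ge[of "n + offs c"] by (auto simp: B_def)
  have regs_bounded: "regs_bounded B (ireg s)" using B by (auto simp: assms(5) regs_bounded_def)
  have code: "code_at (prog_of c) (pc s) (compile c (pc s))"
    using assms(4) by (simp add: code_at_def prog_of_def nth_append)
  have es: "ireg s x = int (e x)" "e x \<le> n" if "x \<in> {0, 1}" for x using that assms(2,3,5) by auto
  have "\<exists>t s'. runs p \<alpha> B (prog_of c) s t s' \<and> t \<le> cost_bound c (n + offs c) \<and>
      pc s' = pc s + length (compile c (pc s)) \<and> rreg s' = denote p \<alpha> c e (rreg s) \<and>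
      (\<forall>x\<in>{0, 1}. ireg s' x = ireg s x) \<and>
      (\<forall>x\<ge>16. ireg s' x = (if x \<in> marked c e then int x else ireg s x))"
    by (rule compile_correct[OF assms(1) _ _ es _ _ regs_bounded code]) (auto simp: B_def)
  then obtain t s1 where 1: "runs p \<alpha> B (prog_of c) s t s1" "t \<le> cost_bound c (n + offs c)"
    "pc s1 = length (compile c 0)" "rreg s1 = denote p \<alpha> c e (rreg s)"
    "\<And>x. 16 \<le> x \<Longrightarrow> ireg s1 x = (if x \<in> marked c e then int x else ireg s x)"
    by (auto simp: assms(4))
  let ?tail = "map (\<lambda>k. IConst k (int k)) [1..<16]"
  obtain J where J: "int_ops B ?tail (ireg s1) = Some J" "\<And>x. J x = (if 1 \<le> x \<and> x < 16 then int x else ireg s1 x)"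
    using int_ops_consts[OF runs_regs_bounded[OF 1(1)], of 16 1] B by auto
  let ?s2 = "s1\<lparr>pc := pc s1 + length ?tail, ireg := J\<rparr>"
  have code: "code_at (prog_of c) (pc s1) ?tail"
    using 1(3) by (auto simp: code_at_def prog_of_def nth_append simp del: upt_Suc upt_rec_numeral)
  have "runs p \<alpha> B (prog_of c) s1 (length ?tail) ?s2"
    by (rule int_ops_runs[OF J(1) code])
  note r = runs_trans[OF 1(1) this]
  have "halted (prog_of c) ?s2"
    using 1(3) by (auto simp: halted_def prog_of_def nth_append simp del: upt_Suc upt_rec_numeral)
  then show ?thesis
    using r 1(2,4,5) J(2) by (intro exI[of _ "t + length ?tail"] exI[of _ ?s2]) (auto simp del: upt_Suc upt_rec_numeral)
qed

theorem theorem2: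
  fixes \<alpha> :: real and p :: ereal
  assumes "1 \<le> \<alpha>" and "1 \<le> p"
  shows "\<exists>(prog :: instr list) (C :: real) (N :: nat) (c :: nat).
     \<forall>P :: (real \<times> real) list. distinct P \<longrightarrow>
       (\<exists>t s. halts_in p \<alpha> prog (init_state P) t s \<and>
              correct_output p \<alpha> P s \<and>
              ints_bounded p \<alpha> prog (init_state P) t (int (length P + 2) ^ c) \<and>
              (length P \<ge> N \<longrightarrow>
                 real t \<le> C * real (length P) ^ 3 *
                   (if p = \<infinity> then 1 else ln (real (length P)))))"
proof -
  let ?c = "main_cmd p"
  define m where "m = offs ?c"
  obtain d where d: "\<And>n. addr_bound (n + m) \<le> (n + 2) ^ d" using addr_bound_polynomial by blast
  obtain K where K: "\<And>L. 1 \<le> L \<Longrightarrow> cost_bound ?c L \<le> K * L ^ 3"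
    using cost_bound_power[of ?c] by (auto simp: main_depth)
  \<comment> \<open>15 counts the constants loaded at the end, and
    \<open>n + m \<le> (m + 1) * n\<close> turns a bound in \<open>n + m\<close> into one in
    \<open>n\<close>.\<close>
  define C where "C = (K + 15) * (m + 1) ^ 3"
  have "\<exists>t s. halts_in p \<alpha> (prog_of ?c) (init_state P) t s \<and> correct_output p \<alpha> P s \<and>
      ints_bounded p \<alpha> (prog_of ?c) (init_state P) t (int (length P + 2) ^ d) \<and>
      (length P \<ge> 3 \<longrightarrow> real t \<le> real C * real (length P) ^ 3 * (if p = \<infinity> then 1 else ln (real (length P))))" for P
  proof -
    define n where "n = length P"
    define e where "e = (\<lambda>i :: nat. if i = 0 then n else 0)"
    have e: "e 0 = n" "e 1 = 0" "e (Suc 0) = 0" by (auto simp: e_def)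
    have init: "pc (init_state P) = 0" "ireg (init_state P) = (\<lambda>i. if i = 0 then int n else 0)"
      unfolding init_state_def n_def by simp_all
    obtain t s where ts: "runs p \<alpha> (int (addr_bound (n + m))) (prog_of ?c) (init_state P) t s" "halted (prog_of ?c) s"
      "t \<le> cost_bound ?c (n + m) + 15" "rreg s = denote p \<alpha> ?c e (rreg (init_state P))"
      "\<And>x. 1 \<le> x \<Longrightarrow> x < 16 \<or> x \<in> marked ?c e \<Longrightarrow> ireg s x = int x"
      using prog_of_runs[OF main_scoped e(1,2) init, of p \<alpha> p] unfolding m_def by blast
    have "halts_in p \<alpha> (prog_of ?c) (init_state P) t s"
      using ts(1,2) by (auto simp: halts_in_def runs_def)
    moreover have "correct_output p \<alpha> P s"
      unfolding correct_output_def
    proof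
      fix k assume k: "k \<in> {1..length P}"
      then obtain k' where k': "k = Suc k'" "k' < n" by (cases k) (auto simp: n_def)
      \<comment> \<open>Count registers from 16 on are marked; the lower ones are set by the tail of
        the program.\<close>
      have "x \<in> marked ?c e" if "16 \<le> x" "x \<le> n" for x
        using that by (auto simp: main_cmd_def mark_cmd_def e intro!: bexI[of _ "x - 16"])
      then have ik: "ireg s k = int k" using k ts(5)[of k] by (cases "k < 16") (auto simp: n_def)
      have "output_cover (length P) s k = map (out n (rreg s) k) [0..<k]"
        by (simp add: output_cover_def ik out_def low_addr_def n_def)
      moreover have "optimal_k_cover p \<alpha> (Suc k') (set P) (map (out n (rreg s) (Suc k')) [0..<Suc k'])"
        unfolding ts(4) by (rule main_correct[OF assms(2,1) e(1,3) n_def _ k'(2)]) (simp add: init_state_def n_def)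
      ultimately show "0 \<le> ireg s k \<and> optimal_k_cover p \<alpha> k (set P) (output_cover (length P) s k)"
        using ik k'(1) by simp
    qed
    moreover have "ints_bounded p \<alpha> (prog_of ?c) (init_state P) t (int (length P + 2) ^ d)"
    proof -
      have "int (addr_bound (n + m)) \<le> int ((n + 2) ^ d)" using d of_nat_le_iff by blast
      then have "int (addr_bound (n + m)) \<le> int (length P + 2) ^ d" by (simp add: n_def)
      then show ?thesis using ts(1) unfolding runs_def ints_bounded_def regs_bounded_def by (meson order_trans)
    qed
    moreover have "real t \<le> real C * real n ^ 3 * (if p = \<infinity> then 1 else ln (real n))" if n: "3 \<le> n"
    proof -
      have "1 \<le> n + m" using n by simp
      from K[OF this] have "t \<le> K * (n + m) ^ 3 + 15 * 1" using ts(3) by linarith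
      also have "\<dots> \<le> K * (n + m) ^ 3 + 15 * (n + m) ^ 3" using n by (intro add_left_mono mult_le_mono2) simp
      also have "\<dots> = (K + 15) * (n + m) ^ 3" by (simp add: add_mult_distrib)
      also have "\<dots> \<le> (K + 15) * ((m + 1) * n) ^ 3" using n by (intro mult_le_mono2 power_mono) auto
      also have "\<dots> = C * n ^ 3" by (simp only: C_def power_mult_distrib mult.assoc)
      finally have "real t \<le> real (C * n ^ 3)" by (simp only: of_nat_le_iff)
      then have t: "real t \<le> real C * real n ^ 3" by simp
      \<comment> \<open>From three points on \<open>ln n\<close> is at least 1, so the cubic bound
        implies the one with the logarithm.\<close>
      have "exp 1 \<le> real n" using exp_le n by linarith
      then have "1 \<le> ln (real n)" using n by (simp add: ln_ge_iff)
      then have "1 \<le> (if p = \<infinity> then 1 else ln (real n))" by simp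
      then have "real C * real n ^ 3 * 1 \<le> real C * real n ^ 3 * (if p = \<infinity> then 1 else ln (real n))"
        by (intro mult_left_mono) auto
      with t show ?thesis by linarith
    qed
    ultimately show ?thesis unfolding n_def by blast
  qed
  then show ?thesis by blast
qed

end
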